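(* Let $d\alpha$ be a standardized probability measure on $\mathbb{R}$, let $\{P_\ell\}_{\ell\ge0}$ be the monic orthogonal polynomials associated with $d\alpha$, and for $\omega\in\mathbb{C}$ define the linear operator $K_\omega$ on $\mathbb{C}[x]$ by $K_\omega:P_\ell\mapsto\omega^\ell P_\ell$ for all $\ell\ge 0$. Write $K=K_\omega$ and $K_{\ell,m}=\int_{\mathbb{R}}K(H_\ell)(x)H_m(x)\,d\alpha(x)$. Then $K_{0,0}=1$, $K_{0,1}=K_{1,0}=0$ and $\mathrm{Re}\,K_{0,2}>-1$, and $T_\omega$ is the Centered Gaussian Operator associated with $K_\omega$; that is, $\mathcal{C}=T_\omega$ is the unique operator in $\mathfrak{C}$ such that $$\lim_{N\to\infty}\int_{\mathbb{R}^N}K_N(f_+)(\boldsymbol{x})\,g_+(\boldsymbol{x})\,d\alpha_N(\sqrt{N}\boldsymbol{x})=\int_{\mathbb{R}}\mathcal{C}(f)(x)\,g(x)\,d\gamma(x)$$ for every $f,g\in\mathbb{C}[x]$. Furthermore, if for some $\omega\in\mathbb{C}$ and $p,q>0$ with $1\le p\le q<\infty$ we have $$\|K_\omega f\|_{L^q(d\alpha)}\le\|f\|_{L^p(d\alpha)}$$ for every $f\in\mathbb{C}[x]$, then $$\|T_\omega f\|_{L^q(\mathbb{R},d\gamma)}\le\|f\|_{L^p(\mathbb{R},d\gamma)}$$ for every $f\in\mathbb{C}[x]$, or equivalently, the condition $$|p-2-\omega^2(q-2)|\le p-|\omega|^2q$$ must be satisfied.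
   Context: A probability measure on $\mathbb{R}$ is called standardized if it has zero mean, unit variance and finite moments of all orders. $d\gamma(x)=(2\pi)^{-1/2}e^{-x^2/2}dx$ is the normal distribution. $\{H_\ell\}_{\ell\ge0}$ are the monic Hermite polynomials, orthogonal with respect to $d\gamma$ ($H_0=1$, $H_1=x$, $H_{\ell+1}=xH_\ell-\ell H_{\ell-1}$). $\mathbb{C}[x]$ and $\mathbb{C}[x_1,\dots,x_N]$ are rings of polynomials with complex coefficients. The monic orthogonal polynomials associated with $d\alpha$: $P_\ell$ is monic of degree $\ell$ and $\int P_\ell(x)x^j\,d\alpha(x)=0$ for $0\le j<\ell$. (If $d\alpha$ has finite support of $n$ points, then any such $P_\ell$ with $\ell\ge n$ vanishes $d\alpha$-a.e., and $K_\omega f$, viewed as an element of $L^q(\mathbb{R},d\alpha)$, does not depend on the choice of these $P_\ell$.) The operator $K_\omega$ is viewed as a linear operator $\mathbb{C}[x]\to L^q(\mathbb{R},d\alpha)$, $q>1$; also $0^0=1$. For a probability measure $d\alpha$ on $\mathbb{R}$, $d\alpha_N(\boldsymbol{x})=d\alpha(x_1)\times\cdots\times d\alpha(x_N)$ is the $N$-fold product measure on $\mathbb{R}^N$, and $d\alpha_N(\sqrt N\boldsymbol{x})$ is its rescaling, i.e. $\int h(\boldsymbol{x})\,d\alpha_N(\sqrt N\boldsymbol{x})=\int h(\boldsymbol{x}/\sqrt N)\,d\alpha_N(\boldsymbol{x})$. For a function $f$ of one real variable, $f_+(\boldsymbol{x})=f(x_1+\dots+x_N)$. The operators $K_N$: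 for a linear operator $K:\mathbb{C}[x]\to L^q(\mathbb{R},d\alpha)$ and an integer $N>0$, $K_N:\mathbb{C}[x_1,\dots,x_N]\to L^q(\mathbb{R}^N,d\alpha_N(\sqrt N\boldsymbol{x}))$ is the linear operator $K_N=S_{N,\sqrt N}K_{N,N}K_{N,N-1}\cdots K_{N,1}S_{N,1/\sqrt N}$, where $K_{N,n}$ is $K$ applied in the $n$th variable and $S_{N,\lambda}f(x_1,\dots,x_N)=f(\lambda x_1,\dots,\lambda x_N)$. Explicitly, with $p_j(x)=x^j$, $K_N$ is the linear map with $$K_N\big(x_1^{j_1}\cdots x_N^{j_N}\big)(\boldsymbol{x})=N^{-(j_1+\dots+j_N)/2}\,K(p_{j_1})(\sqrt N x_1)\cdots K(p_{j_N})(\sqrt N x_N).$$ Centered Gaussian Operators: for $\omega,\lambda,\tau\in\mathbb{C}$ with $\mathrm{Re}\,\tau>-1$, $T_\omega:\mathbb{C}[x]\to\mathbb{C}[x]$ is the linear operator with $T_\omega H_\ell=\omega^\ell H_\ell$ for all $\ell\ge 0$; $(S_\lambda f)(x)=f(\lambda x)$; and $(M_\tau f)(x)=\sqrt{1+\tau}\,e^{-\tau x^2/2}f(x)$, with the principal branch of the square root. The family of Centered Gaussian Operators, regarded as operators on $\mathbb{C}[x]$, is $$\mathfrak{C}=\{M_\tau T_\omega S_\lambda:\ \lambda,\omega,\tau\in\mathbb{C},\ \mathrm{Re}\,\tau>-1\}.$$ *)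

theory Defs
  imports
    "HOL-Probability.Probability"
    "HOL-Computational_Algebra.Polynomial"
    "HOL-Library.Poly_Mapping"
begin

definition standardized :: "real measure \<Rightarrow> bool" where
  "standardized \<alpha> \<longleftrightarrow>
     real_distribution \<alpha> \<and>
     (\<forall>n::nat. integrable \<alpha> (\<lambda>x. x ^ n)) \<and>
     prob_space.expectation \<alpha> (\<lambda>x. x) = 0 \<and>
     prob_space.variance \<alpha> (\<lambda>x. x) = 1"

definition poly_fun :: "complex poly \<Rightarrow> real \<Rightarrow> complex" where
  "poly_fun f x = poly f (complex_of_real x)"

definition Lp_norm :: "real \<Rightarrow> 'a measure \<Rightarrow> ('a \<Rightarrow> complex) \<Rightarrow> real" where
  "Lp_norm p M f = (\<integral>x. norm (f x) powr p \<partial>M) powr (1 / p)"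

fun hermite :: "nat \<Rightarrow> complex poly" where
  "hermite 0 = 1"
| "hermite (Suc 0) = [:0, 1:]"
| "hermite (Suc (Suc n)) =
     [:0, 1:] * hermite (Suc n) - smult (of_nat (Suc n)) (hermite n)"

definition monic_sequence :: "(nat \<Rightarrow> complex poly) \<Rightarrow> bool" where
  "monic_sequence P \<longleftrightarrow> (\<forall>l. degree (P l) = l \<and> lead_coeff (P l) = 1)"

text \<open>If the measure has finite support, such a sequence is not unique; the statement is
  meant for any choice of it.\<close>

definition monic_orthogonal :: "real measure \<Rightarrow> (nat \<Rightarrow> complex poly) \<Rightarrow> bool" where
  "monic_orthogonal \<alpha> P \<longleftrightarrow>
     monic_sequence P \<and>
     (\<forall>l. \<forall>j<l. (\<integral>x. poly_fun (P l) x * complex_of_real x ^ j \<partial>\<alpha>) = 0)"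

text \<open>The linear operator \<open>P\<^sub>l \<mapsto> \<omega>\<^sup>l P\<^sub>l\<close>. For a monic sequence it exists and is unique, see
  \<open>diag_op_linear\<close>, \<open>diag_op_basis\<close> and \<open>diag_op_eqI\<close> below.\<close>

definition diag_op :: "(nat \<Rightarrow> complex poly) \<Rightarrow> complex \<Rightarrow> complex poly \<Rightarrow> complex poly" where
  "diag_op P \<omega> =
     (THE K. Vector_Spaces.linear smult smult K \<and> (\<forall>l. K (P l) = smult (\<omega> ^ l) (P l)))"

definition K_op :: "(nat \<Rightarrow> complex poly) \<Rightarrow> complex \<Rightarrow> complex poly \<Rightarrow> real \<Rightarrow> complex" where
  "K_op P \<omega> f = poly_fun (diag_op P \<omega> f)"

definition matrix_elem ::
  "real measure \<Rightarrow> (complex poly \<Rightarrow> real \<Rightarrow> complex) \<Rightarrow> nat \<Rightarrow> nat \<Rightarrow> complex" where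
  "matrix_elem \<alpha> K l m = (\<integral>x. K (hermite l) x * poly_fun (hermite m) x \<partial>\<alpha>)"

definition T_op :: "complex \<Rightarrow> complex poly \<Rightarrow> complex poly" where
  "T_op \<omega> = diag_op hermite \<omega>"

definition S_op :: "complex \<Rightarrow> complex poly \<Rightarrow> complex poly" where
  "S_op c f = pcompose f [:0, c:]"

definition M_op :: "complex \<Rightarrow> (real \<Rightarrow> complex) \<Rightarrow> real \<Rightarrow> complex" where
  "M_op \<tau> f x = csqrt (1 + \<tau>) * exp (- \<tau> * complex_of_real x ^ 2 / 2) * f x"

definition centered_gaussian_ops :: "(complex poly \<Rightarrow> real \<Rightarrow> complex) set" where
  "centered_gaussian_ops =
     {(\<lambda>f. M_op \<tau> (poly_fun (T_op \<omega> (S_op c f)))) |c \<omega> \<tau>. Re \<tau> > - 1}"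

text \<open>Polynomials in the variables with indices \<open>0, 1, 2, \<dots>\<close>: finitely supported maps from
  exponent vectors to coefficients. Those in \<open>N\<close> variables only involve the indices \<open>i < N\<close>.\<close>

type_synonym mpoly = "(nat \<Rightarrow>\<^sub>0 nat) \<Rightarrow>\<^sub>0 complex"

definition mvar :: "nat \<Rightarrow> mpoly" where
  "mvar i = Poly_Mapping.single (Poly_Mapping.single i 1) 1"

definition mconst :: "complex \<Rightarrow> mpoly" where
  "mconst c = Poly_Mapping.single 0 c"

text \<open>\<open>f\<^sub>+\<close> as a polynomial in \<open>N\<close> variables and as a function of \<open>N\<close> real variables;
  \<open>meval_plus_poly\<close> below relates the two.\<close>

definition plus_poly :: "nat \<Rightarrow> complex poly \<Rightarrow> mpoly" where
  "plus_poly N f = poly (map_poly mconst f) (\<Sum>i<N. mvar i)"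

definition plus_fun :: "nat \<Rightarrow> complex poly \<Rightarrow> (nat \<Rightarrow> real) \<Rightarrow> complex" where
  "plus_fun N f x = poly_fun f (\<Sum>i<N. x i)"

definition K_N ::
  "(complex poly \<Rightarrow> real \<Rightarrow> complex) \<Rightarrow> nat \<Rightarrow> mpoly \<Rightarrow> (nat \<Rightarrow> real) \<Rightarrow> complex" where
  "K_N K N F x =
     (\<Sum>m\<in>Poly_Mapping.keys F. Poly_Mapping.lookup F m *
        (complex_of_real (real N powr (- real (\<Sum>i<N. Poly_Mapping.lookup m i) / 2)) *
         (\<Prod>i<N. K (monom 1 (Poly_Mapping.lookup m i)) (sqrt (real N) * x i))))"

text \<open>The rescaled product measure \<open>d\<alpha>\<^sub>N(\<surd>N x)\<close>; see \<open>integral_scaled_prod\<close> below.\<close>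

definition scaled_prod :: "real measure \<Rightarrow> nat \<Rightarrow> (nat \<Rightarrow> real) measure" where
  "scaled_prod \<alpha> N =
     distr (Pi\<^sub>M {..<N} (\<lambda>_. \<alpha>)) (Pi\<^sub>M {..<N} (\<lambda>_. borel)) (\<lambda>x. \<lambda>i\<in>{..<N}. x i / sqrt (real N))"

definition clt_limit ::
  "real measure \<Rightarrow> (complex poly \<Rightarrow> real \<Rightarrow> complex) \<Rightarrow> (complex poly \<Rightarrow> real \<Rightarrow> complex) \<Rightarrow> bool"
  where
  "clt_limit \<alpha> K C \<longleftrightarrow>
     (\<forall>f g. (\<lambda>N. \<integral>x. K_N K N (plus_poly N f) x * plus_fun N g x \<partial>scaled_prod \<alpha> N)
        \<longlonglongrightarrow> (\<integral>x. C f x * poly_fun g x \<partial>std_normal_distribution))"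

lemma monic_sequence_hermite: "monic_sequence hermite"
proof -
  have "degree (hermite l) = l \<and> lead_coeff (hermite l) = 1" for l
  proof (induction l rule: hermite.induct)
    case (3 n)
    have a: "degree ([:0, 1:] * hermite (Suc n)) = Suc (Suc n)"
      using 3 by (subst degree_mult_eq) auto
    have b: "degree (smult (of_nat (Suc n)) (hermite n)) < Suc (Suc n)"
      using 3 by (metis degree_smult_le le_imp_less_Suc less_SucI)
    have "lead_coeff ([:0, 1:] * hermite (Suc n)) = lead_coeff [:0, 1:] * lead_coeff (hermite (Suc n))"
      by (rule lead_coeff_mult)
    then have "lead_coeff ([:0, 1:] * hermite (Suc n)) = 1"
      using 3 by (metis lead_coeff_pCons(1) lead_coeff_1 mult_1 one_neq_zero one_pCons pCons_eq_0_iff)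
    moreover have "degree (hermite (Suc (Suc n))) = Suc (Suc n)"
      using a b degree_add_eq_left[of "- smult (of_nat (Suc n)) (hermite n)" "[:0, 1:] * hermite (Suc n)"]
      by (simp only: hermite.simps degree_minus) simp
    moreover have "coeff (smult (of_nat (Suc n)) (hermite n)) (Suc (Suc n)) = 0"
      using b by (rule coeff_eq_0)
    ultimately show ?case
      using a by (simp only: hermite.simps coeff_diff) simp
  qed auto
  then show ?thesis unfolding monic_sequence_def by blast
qed

lemma vector_space_smult: "vector_space (smult :: 'a::field \<Rightarrow> 'a poly \<Rightarrow> 'a poly)"
  by unfold_locales (auto simp: smult_add_right smult_add_left)

lemma linear_smult_iff:
  "Vector_Spaces.linear smult smult (K :: complex poly \<Rightarrow> complex poly) \<longleftrightarrow>
     (\<forall>f g. K (f + g) = K f + K g) \<and> (\<forall>c f. K (smult c f) = smult c (K f))"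
  by (auto simp: Vector_Spaces.linear_iff vector_space_smult)

lemma linear_eq_on_monic_sequence:
  assumes "monic_sequence P"
    and "Vector_Spaces.linear smult smult K" "Vector_Spaces.linear smult smult L"
    and "\<And>l. K (P l) = L (P l)"
  shows "K = L"
proof
  fix f
  show "K f = L f"
  proof (induction "degree f" arbitrary: f rule: less_induct)
    case less
    define g where "g = f - smult (lead_coeff f) (P (degree f))"
    have P: "degree (P (degree f)) = degree f" "coeff (P (degree f)) (degree f) = 1"
      using assms(1) unfolding monic_sequence_def by metis+
    have f: "f = smult (lead_coeff f) (P (degree f)) + g" by (simp add: g_def)
    have K: "K f = smult (lead_coeff f) (K (P (degree f))) + K g"
      using assms(2) f unfolding linear_smult_iff by metis
    have L: "L f = smult (lead_coeff f) (L (P (degree f))) + L g"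
      using assms(3) f unfolding linear_smult_iff by metis
    have "K g = L g"
    proof (cases "g = 0")
      case True
      have "K 0 = 0" "L 0 = 0"
        using assms(2,3) unfolding linear_smult_iff by (metis smult_0_left)+
      with True show ?thesis by simp
    next
      case False
      have "degree g \<le> degree f"
        unfolding g_def using P by (intro degree_diff_le) auto
      moreover have "coeff g (degree f) = 0" using P by (simp add: g_def)
      ultimately have "degree g < degree f"
        using False by (metis leading_coeff_0_iff order_le_less)
      then show ?thesis by (rule less)
    qed
    with K L assms(4) show ?case by simp
  qed
qed

lemma diag_op_exists:
  assumes "monic_sequence P"
  shows "\<exists>K. Vector_Spaces.linear smult smult K \<and> (\<forall>l. K (P l) = smult (\<omega> ^ l) (P l))"
proof -
  have P: "degree (P l) = l" "coeff (P l) l = 1" for l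
    using assms unfolding monic_sequence_def by metis+
  define R where "R = rec_nat (\<lambda>f. smult (coeff f 0) (P 0))
    (\<lambda>n r f. smult (coeff f (Suc n) * \<omega> ^ Suc n) (P (Suc n))
       + r (f - smult (coeff f (Suc n)) (P (Suc n))))"
  have R0: "R 0 f = smult (coeff f 0) (P 0)" for f by (simp add: R_def)
  have RS: "R (Suc n) f = smult (coeff f (Suc n) * \<omega> ^ Suc n) (P (Suc n))
       + R n (f - smult (coeff f (Suc n)) (P (Suc n)))" for n f by (simp add: R_def)
  have add: "R n (f + g) = R n f + R n g" for n f g
  proof (induction n arbitrary: f g)
    case (Suc n)
    have "f + g - smult (coeff (f + g) (Suc n)) (P (Suc n)) =
      (f - smult (coeff f (Suc n)) (P (Suc n))) + (g - smult (coeff g (Suc n)) (P (Suc n)))"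
      by (simp add: smult_add_left)
    then show ?case
      by (simp add: RS Suc[symmetric] smult_add_left algebra_simps del: power_Suc)
  qed (simp add: R0 smult_add_left)
  have scale: "R n (smult c f) = smult c (R n f)" for n c f
  proof (induction n arbitrary: f)
    case (Suc n)
    have "smult c f - smult (coeff (smult c f) (Suc n)) (P (Suc n)) =
      smult c (f - smult (coeff f (Suc n)) (P (Suc n)))"
      by (simp add: smult_diff_right)
    then show ?case
      by (simp add: RS Suc smult_add_right mult.assoc del: power_Suc)
  qed (simp add: R0)
  have stable: "R n f = R (degree f) f" if "degree f \<le> n" for n f
    using that
  proof (induction n)
    case (Suc n)
    show ?case
    proof (cases "degree f = Suc n")
      case False
      with Suc show ?thesis by (simp add: RS coeff_eq_0)
    qed simp
  qed simp
  have zero: "R n 0 = 0" for n using scale[of n 0 0] by simp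
  define K where "K = (\<lambda>f. R (degree f) f)"
  have "K (f + g) = K f + K g" for f g
  proof -
    define n where "n = max (degree f) (degree g)"
    have "degree (f + g) \<le> n" by (simp add: n_def degree_add_le_max)
    then have "K (f + g) = R n (f + g)" unfolding K_def by (rule stable[symmetric])
    also have "\<dots> = R n f + R n g" by (rule add)
    also have "\<dots> = K f + K g"
      using stable[of f n] stable[of g n] unfolding K_def n_def by auto
    finally show ?thesis .
  qed
  moreover have "K (smult c f) = smult c (K f)" for c f
    unfolding K_def
    by (metis scale stable degree_smult_le)
  moreover have "K (P l) = smult (\<omega> ^ l) (P l)" for l
  proof (cases l)
    case 0
    then show ?thesis using P(1)[of 0] P(2)[of 0] by (simp add: K_def R0)
  next
    case (Suc k)
    then show ?thesis using P(1)[of l] P(2)[of l] by (simp add: K_def RS zero del: power_Suc)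
  qed
  ultimately show ?thesis unfolding linear_smult_iff by blast
qed

lemma diag_op_linear_basis:
  assumes "monic_sequence P"
  shows "Vector_Spaces.linear smult smult (diag_op P \<omega>) \<and>
    (\<forall>l. diag_op P \<omega> (P l) = smult (\<omega> ^ l) (P l))"
proof -
  have "\<exists>!K. Vector_Spaces.linear smult smult K \<and> (\<forall>l. K (P l) = smult (\<omega> ^ l) (P l))"
    using linear_eq_on_monic_sequence[OF assms]
    by (intro ex_ex1I diag_op_exists[OF assms]) simp
  from theI'[OF this] show ?thesis unfolding diag_op_def .
qed

lemma diag_op_linear: "monic_sequence P \<Longrightarrow> Vector_Spaces.linear smult smult (diag_op P \<omega>)"
  using diag_op_linear_basis by blast

lemma diag_op_basis: "monic_sequence P \<Longrightarrow> diag_op P \<omega> (P l) = smult (\<omega> ^ l) (P l)"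
  using diag_op_linear_basis by blast

lemma diag_op_eqI:
  assumes "monic_sequence P" "Vector_Spaces.linear smult smult K"
    and "\<And>l. K (P l) = smult (\<omega> ^ l) (P l)"
  shows "diag_op P \<omega> = K"
  using assms diag_op_linear_basis linear_eq_on_monic_sequence by metis

definition meval :: "nat \<Rightarrow> mpoly \<Rightarrow> (nat \<Rightarrow> real) \<Rightarrow> complex" where
  "meval N F x = (\<Sum>m\<in>Poly_Mapping.keys F. Poly_Mapping.lookup F m *
     (\<Prod>i<N. complex_of_real (x i) ^ Poly_Mapping.lookup m i))"

lemma meval_add: "meval N (F + G) x = meval N F x + meval N G x"
  unfolding meval_def by (rule setsum_keys_plus_distrib) (auto simp: algebra_simps)

lemma meval_single:
  "meval N (Poly_Mapping.single m c) x =
     c * (\<Prod>i<N. complex_of_real (x i) ^ Poly_Mapping.lookup m i)"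
  by (simp add: meval_def)

lemma mpoly_induct [case_names zero single add]:
  fixes F :: mpoly
  assumes "Q 0" "\<And>m c. Q (Poly_Mapping.single m c)" "\<And>F G. Q F \<Longrightarrow> Q G \<Longrightarrow> Q (F + G)"
  shows "Q F"
proof (induction F rule: update_induct)
  case (update f a b)
  have "Poly_Mapping.update a b f = f + Poly_Mapping.single a b"
    using update(1)
    by (intro poly_mapping_eqI) (auto simp: lookup_update lookup_add lookup_single when_def in_keys_iff)
  with update assms show ?case by simp
qed (use assms in auto)

lemma meval_mult: "meval N (F * G) x = meval N F x * meval N G x"
proof (induction F rule: mpoly_induct)
  case (single m c)
  show ?case
  proof (induction G rule: mpoly_induct)
    case (single m' c')
    show ?case
      by (simp add: mult_single meval_single lookup_add power_add prod.distrib)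
  qed (simp_all add: meval_def[of N 0] distrib_left meval_add)
qed (simp_all add: meval_def[of N 0] distrib_right meval_add)

lemma meval_mvar: "i < N \<Longrightarrow> meval N (mvar i) x = complex_of_real (x i)"
proof -
  assume i: "i < N"
  have "(\<Prod>j<N. complex_of_real (x j) ^ Poly_Mapping.lookup (Poly_Mapping.single i (1::nat)) j)
      = (\<Prod>j<N. if j = i then complex_of_real (x i) else 1)"
    by (intro prod.cong) (auto simp: lookup_single when_def)
  with i show ?thesis by (simp add: mvar_def meval_single)
qed

lemma meval_plus_poly: "meval N (plus_poly N f) x = plus_fun N f x"
proof -
  have c: "mconst 0 = 0" by (simp add: mconst_def)
  have mc: "meval N (mconst c) x = c" for c by (simp add: mconst_def meval_single)
  have ms: "meval N (\<Sum>i<k. mvar i) x = complex_of_real (\<Sum>i<k. x i)" if "k \<le> N" for k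
    using that
    by (induction k) (simp_all add: meval_def[of N 0] meval_add meval_mvar)
  show ?thesis
    unfolding plus_poly_def plus_fun_def poly_fun_def
  proof (induction f)
    case (pCons a f)
    then show ?case
      by (simp add: map_poly_pCons c meval_add meval_mult mc ms del: of_real_sum)
  qed (simp add: meval_def)
qed

lemma integral_scaled_prod:
  fixes h :: "(nat \<Rightarrow> real) \<Rightarrow> complex"
  assumes "sets \<alpha> = sets borel" and "h \<in> borel_measurable (Pi\<^sub>M {..<N} (\<lambda>_. borel))"
  shows "(\<integral>x. h x \<partial>scaled_prod \<alpha> N) =
    (\<integral>x. h (\<lambda>i\<in>{..<N}. x i / sqrt (real N)) \<partial>Pi\<^sub>M {..<N} (\<lambda>_. \<alpha>))"
proof -
  have "(\<lambda>x. \<lambda>i\<in>{..<N}. x i / sqrt (real N)) \<in>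
      Pi\<^sub>M {..<N} (\<lambda>_. borel) \<rightarrow>\<^sub>M Pi\<^sub>M {..<N} (\<lambda>_. borel)"
    by measurable
  moreover have "sets (Pi\<^sub>M {..<N} (\<lambda>_. \<alpha>)) = sets (Pi\<^sub>M {..<N} (\<lambda>_. borel))"
    using assms(1) by (intro sets_PiM_cong) auto
  ultimately have "(\<lambda>x. \<lambda>i\<in>{..<N}. x i / sqrt (real N)) \<in>
      Pi\<^sub>M {..<N} (\<lambda>_. \<alpha>) \<rightarrow>\<^sub>M Pi\<^sub>M {..<N} (\<lambda>_. borel)"
    by (simp cong: measurable_cong_sets)
  then show ?thesis
    unfolding scaled_prod_def using assms(2) by (rule integral_distr)
qed

end

theory Submission
  imports Defs "HOL-Real_Asymp.Real_Asymp"
begin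

text \<open>
Both contraction properties are compared with the pointwise inequality
\<open>(q - 2) (Re \<omega>w)\<^sup>2 + \<bar>\<omega>w\<bar>\<^sup>2 \<le> \<bar>w\<bar>\<^sup>2 + (p - 2) (Re w)\<^sup>2\<close> for all complex \<open>w\<close>, which is the stated
condition on \<open>\<omega>\<close>. It is necessary for \<open>K\<^sub>\<omega>\<close>, and hence (with \<open>\<alpha> = \<gamma>\<close>) for \<open>T\<^sub>\<omega>\<close>: apply the bound to
\<open>1 + \<epsilon>ax\<close> and compare the terms of order \<open>\<epsilon>\<^sup>2\<close>. For sufficiency, let \<open>U\<^sub>s f\<close> be the heat flow of \<open>f\<close> and set
\<open>h(t, x, y) = (U\<^bsub>(1 - \<omega>\<^sup>2) sin\<^sup>2 t\<^esub> f)(\<omega> sin t x + cos t y)\<close>, which interpolates between \<open>f(y)\<close> and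
\<open>T\<^sub>\<omega> f(x)\<close>. Gaussian integration by parts turns the \<open>t\<close>-derivative of
\<open>\<integral> (\<integral> \<bar>h(t, x, y)\<bar>\<^sup>p d\<gamma>(y))\<^bsup>q/p\<^esup> d\<gamma>(x)\<close> into an integral whose sign is decided by the pointwise inequality;
replacing \<open>\<bar>h\<bar>\<^sup>p\<close> by \<open>(\<bar>h\<bar>\<^sup>2 + \<epsilon>)\<^bsup>p/2\<^esup>\<close> keeps everything smooth.

For the limit theorem, the integrals belonging to the monomials \<open>f = x\<^sup>n\<close>, \<open>g = x\<^sup>m\<close> satisfy a recursion in
\<open>N\<close> whose leading terms involve only the moments of order two, so the Stolz-Cesaro theorem and
induction on \<open>n + m\<close> give the limit. Uniqueness: the weight \<open>e\<^bsup>-\<tau>x\<^sup>2/2\<^esup>\<close> of \<open>C(1)\<close> must have variance one,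
which forces \<open>\<tau> = 0\<close>, and polynomials are determined by their Gaussian pairings.
\<close>

section \<open>Gaussian integrals\<close>

text \<open>For complex \<omega> the operator \<open>T_op \<omega>\<close> has in general no
  positive kernel, so arguments by positivity and convexity are not at hand; the interpolation
  replaces them. Its parameters are a variance budget: \<omega> sin t x + cos t y has formal
  variance \<omega>^2 sin^2 t + cos^2 t, and the heat time completes this to 1 for every t. The
  inner integral is over y and the outer one over x because h depends on y alone at t = 0, where the
  functional is a power of the L^p norm of f, and on x alone at t = pi/2, where it is a power of the
  L^q norm of the transform. Regularization is forced by p < 2, where |h|^p is not twice
  differentiable at zeros of h. It costs nothing, since the condition on \<omega> contains
  |\<omega>| \<le> 1. In the limit theorem only the operator on polynomials of degree at most two
  matters. There, a standardized \<alpha> behaves like the Gaussian measure up to terms of mean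
  zero, which is why the limit does not depend on \<alpha>.\<close>

lemma std_normal_distribution_integral:
  fixes F :: "real \<Rightarrow> 'a::{banach, second_countable_topology}"
  assumes "F \<in> borel_measurable borel"
  shows "(\<integral>x. F x \<partial>std_normal_distribution) = (\<integral>x. std_normal_density x *\<^sub>R F x \<partial>lborel)"
  using assms by (subst integral_density) auto

lemma std_normal_distribution_integrable_iff:
  fixes F :: "real \<Rightarrow> 'a::{banach, second_countable_topology}"
  assumes "F \<in> borel_measurable borel"
  shows "integrable std_normal_distribution F \<longleftrightarrow> integrable lborel (\<lambda>x. std_normal_density x *\<^sub>R F x)"
  using assms by (subst integrable_density) auto

lemma std_normal_density_has_derivative:
  "(std_normal_density has_real_derivative - x * std_normal_density x) (at x)"
  unfolding std_normal_density_def[abs_def]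
  by (auto intro!: derivative_eq_intros simp: field_simps)

text \<open>The fundamental theorem of calculus on the whole line for density times
  \<open>G\<close>. The boundary limits are hypotheses because the lemma is also applied to weights
  exp(- \<tau> x^2 / 2), which for negative \<open>Re \<tau>\<close> outgrow every
  polynomial.\<close>

lemma gaussian_integration_by_parts_general:
  fixes G :: "real \<Rightarrow> 'a::euclidean_space"
  assumes G: "\<And>x. (G has_vector_derivative G' x) (at x)"
    and G': "\<And>x. isCont G' x"
    and int: "integrable std_normal_distribution (\<lambda>x. x *\<^sub>R G x)" "integrable std_normal_distribution G'"
    and lim: "((\<lambda>x. std_normal_density x *\<^sub>R G x) \<longlongrightarrow> 0) at_top"
      "((\<lambda>x. std_normal_density x *\<^sub>R G x) \<longlongrightarrow> 0) at_bot"
  shows "(\<integral>x. x *\<^sub>R G x \<partial>std_normal_distribution) = (\<integral>x. G' x \<partial>std_normal_distribution)"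
proof -
  have cG: "isCont G x" for x using G has_vector_derivative_continuous by blast
  have mG: "G \<in> borel_measurable borel" "G' \<in> borel_measurable borel"
    using cG G' by (auto intro!: borel_measurable_continuous_onI continuous_at_imp_continuous_on)
  have cd: "isCont std_normal_density x" for x
    using std_normal_density_has_derivative DERIV_isCont by blast
  let ?F = "\<lambda>x. std_normal_density x *\<^sub>R G x"
  let ?f = "\<lambda>x. std_normal_density x *\<^sub>R G' x + (- x * std_normal_density x) *\<^sub>R G x"
  have i1: "integrable lborel (\<lambda>x. std_normal_density x *\<^sub>R (x *\<^sub>R G x))"
    using int(1) mG by (subst (asm) std_normal_distribution_integrable_iff) auto
  have i2: "integrable lborel (\<lambda>x. std_normal_density x *\<^sub>R G' x)"
    using int(2) mG by (subst (asm) std_normal_distribution_integrable_iff) auto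
  have f: "?f = (\<lambda>x. std_normal_density x *\<^sub>R G' x - std_normal_density x *\<^sub>R (x *\<^sub>R G x))"
    by (auto simp: mult_ac)
  have "integrable lborel ?f" unfolding f using i1 i2 by (rule Bochner_Integration.integrable_diff[rotated])
  moreover have "(?F has_vector_derivative ?f x) (at x)" for x
    by (rule has_vector_derivative_scaleR[OF std_normal_density_has_derivative G])
  moreover have "isCont ?f x" for x
    using cd cG G' by (intro continuous_intros) auto
  ultimately have "(LBINT x=-\<infinity>..\<infinity>. ?f x) = 0 - 0"
    using lim by (intro interval_integral_FTC_integrable[where F="?F"])
      (auto simp: ereal_tendsto_simps set_integrable_def)
  then have "(\<integral>x. ?f x \<partial>lborel) = 0"
    by (simp add: interval_lebesgue_integral_def set_lebesgue_integral_def)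
  then have "(\<integral>x. std_normal_density x *\<^sub>R G' x \<partial>lborel) - (\<integral>x. std_normal_density x *\<^sub>R (x *\<^sub>R G x) \<partial>lborel) = 0"
    unfolding f using i1 i2 by (simp add: Bochner_Integration.integral_diff)
  then show ?thesis
    using mG by (subst (1 2) std_normal_distribution_integral) auto
qed

lemma integrable_gauss_weight: "integrable std_normal_distribution (\<lambda>x. C * (1 + x\<^sup>2) ^ k)"
proof -
  have "integrable std_normal_distribution (\<lambda>x. \<Sum>i\<le>k. of_nat (k choose i) * x ^ (2 * i))"
    using integrable_std_normal_distribution_moment
    by (intro Bochner_Integration.integrable_sum Bochner_Integration.integrable_mult_right) auto
  then show ?thesis
    by (intro Bochner_Integration.integrable_mult_right)
      (simp add: add.commute[of 1] binomial_ring power_mult flip: power_mult)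
qed

lemma gaussian_integration_by_parts:
  fixes G :: "real \<Rightarrow> 'a::euclidean_space"
  assumes G: "\<And>x. (G has_vector_derivative G' x) (at x)"
    and G': "\<And>x. isCont G' x"
    and b: "\<And>x. norm (G x) \<le> C * (1 + x\<^sup>2) ^ k" "\<And>x. norm (G' x) \<le> C * (1 + x\<^sup>2) ^ k"
  shows "(\<integral>x. x *\<^sub>R G x \<partial>std_normal_distribution) = (\<integral>x. G' x \<partial>std_normal_distribution)"
proof (rule gaussian_integration_by_parts_general[OF G G'])
  have cG: "isCont G x" for x using G has_vector_derivative_continuous by blast
  have mG: "G \<in> borel_measurable borel" "G' \<in> borel_measurable borel"
    using cG G' by (auto intro!: borel_measurable_continuous_onI continuous_at_imp_continuous_on)
  have C: "0 \<le> C" using order_trans[OF norm_ge_zero b(1)[of 0]] by simp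
  have x: "\<bar>x\<bar> \<le> 1 + x\<^sup>2" for x :: real
    using zero_le_power2[of "\<bar>x\<bar> - 1"] by (simp add: power2_diff)
  show "integrable std_normal_distribution G'"
    by (rule Bochner_Integration.integrable_bound[OF integrable_gauss_weight[of C k]])
      (use mG b(2) in \<open>auto intro!: order_trans[OF _ abs_ge_self]\<close>)
  have "norm (x *\<^sub>R G x) \<le> C * (1 + x\<^sup>2) ^ Suc k" for x
    using mult_mono[OF x[of x] b(1)[of x]] by (simp add: mult_ac)
  then show "integrable std_normal_distribution (\<lambda>x. x *\<^sub>R G x)"
    by (intro Bochner_Integration.integrable_bound[OF integrable_gauss_weight[of C "Suc k"]])
      (use mG in \<open>auto intro!: order_trans[OF _ abs_ge_self]\<close>)
  have l: "((\<lambda>x. C * (std_normal_density x * (1 + x\<^sup>2) ^ k)) \<longlongrightarrow> 0) at_top"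
      "((\<lambda>x. C * (std_normal_density x * (1 + x\<^sup>2) ^ k)) \<longlongrightarrow> 0) at_bot"
    unfolding std_normal_density_def by real_asymp+
  have n: "norm (std_normal_density x *\<^sub>R G x) \<le> C * (std_normal_density x * (1 + x\<^sup>2) ^ k)" for x
    using mult_left_mono[OF b(1)[of x], of "std_normal_density x"] by (simp add: mult_ac)
  show "((\<lambda>x. std_normal_density x *\<^sub>R G x) \<longlongrightarrow> 0) at_top"
    by (rule Lim_null_comparison[OF _ l(1)]) (use n in auto)
  show "((\<lambda>x. std_normal_density x *\<^sub>R G x) \<longlongrightarrow> 0) at_bot"
    by (rule Lim_null_comparison[OF _ l(2)]) (use n in auto)
qed

text \<open>Dominated convergence for difference quotients: the mean value inequality on the unit
  ball around \<open>s0\<close> turns the bound on \<open>F'\<close> into a bound on the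
  quotients.\<close>

lemma has_real_derivative_integral_param:
  fixes F :: "real \<Rightarrow> real \<Rightarrow> real"
  assumes d: "\<And>s y. ((\<lambda>s. F s y) has_real_derivative F' s y) (at s)"
    and m: "\<And>s. integrable M (F s)"
    and b: "\<And>s y. \<bar>s - s0\<bar> \<le> 1 \<Longrightarrow> \<bar>F' s y\<bar> \<le> B y" and B: "integrable M B"
  shows "((\<lambda>s. \<integral>y. F s y \<partial>M) has_real_derivative (\<integral>y. F' s0 y \<partial>M)) (at s0)"
proof -
  have "((\<lambda>h. ((\<integral>y. F (s0 + h) y \<partial>M) - (\<integral>y. F s0 y \<partial>M)) / h) \<longlongrightarrow> (\<integral>y. F' s0 y \<partial>M)) (at 0)"
  proof (subst tendsto_at_iff_sequentially, intro allI impI)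
    fix X :: "nat \<Rightarrow> real" assume X0: "\<forall>i. X i \<in> UNIV - {0}" and X: "X \<longlonglongrightarrow> 0"
    have q: "(\<lambda>i. (F (s0 + X i) y - F s0 y) / X i) \<longlonglongrightarrow> F' s0 y" for y
    proof -
      have "((\<lambda>h. (F (s0 + h) y - F s0 y) / h) \<longlongrightarrow> F' s0 y) (at 0)"
        using d[where s=s0 and y=y] by (simp add: DERIV_def)
      then show ?thesis using X0 X by (subst (asm) tendsto_at_iff_sequentially) (auto simp: o_def)
    qed
    have "\<forall>\<^sub>F i in sequentially. \<bar>X i\<bar> < 1"
      using X by (metis (mono_tags, lifting) LIMSEQ_iff eventually_sequentially diff_zero real_norm_def zero_less_one)
    \<comment> \<open>Steps shorter than 1 stay in the ball where \<open>B\<close> dominates, so the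
      sequence is shifted by \<open>k\<close>; \<open>LIMSEQ_offset\<close> removes the shift at the
      end.\<close>
    then obtain k where k: "\<And>i. i \<ge> k \<Longrightarrow> \<bar>X i\<bar> < 1" by (auto simp: eventually_sequentially)
    have bnd: "\<bar>(F (s0 + X (i + k)) y - F s0 y) / X (i + k)\<bar> \<le> B y" for i y
    proof -
      let ?h = "X (i + k)"
      have h: "\<bar>?h\<bar> < 1" "?h \<noteq> 0" using k[of "i+k"] X0 by auto
      have "norm (F (s0 + ?h) y - F s0 y) \<le> B y * norm (s0 + ?h - s0)"
      proof (rule field_differentiable_bound[where S="cball s0 1" and f="\<lambda>s. F s y" and f'="\<lambda>s. F' s y"])
        show "((\<lambda>s. F s y) has_field_derivative F' s y) (at s within cball s0 1)" for s
          using d by (rule has_field_derivative_at_within)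
        show "norm (F' s y) \<le> B y" if "s \<in> cball s0 1" for s
          using b[of s y] that by (auto simp: dist_real_def)
      qed (use h in \<open>auto simp: dist_real_def\<close>)
      then show ?thesis using h by (simp add: field_simps)
    qed
    have "(\<lambda>i. \<integral>y. (F (s0 + X (i + k)) y - F s0 y) / X (i + k) \<partial>M) \<longlonglongrightarrow> (\<integral>y. F' s0 y \<partial>M)"
    proof (rule integral_dominated_convergence[where w=B])
      have mm: "F s \<in> borel_measurable M" for s using m by auto
      then show "\<And>i. (\<lambda>y. (F (s0 + X (i + k)) y - F s0 y) / X (i + k)) \<in> borel_measurable M"
        by measurable
      then show "F' s0 \<in> borel_measurable M"
        using q[THEN LIMSEQ_ignore_initial_segment[where k=k]] by (rule borel_measurable_LIMSEQ_real[rotated])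
    qed (use B bnd q[THEN LIMSEQ_ignore_initial_segment[where k=k]] in auto)
    then have "(\<lambda>i. ((\<integral>y. F (s0 + X (i + k)) y \<partial>M) - (\<integral>y. F s0 y \<partial>M)) / X (i + k)) \<longlonglongrightarrow> (\<integral>y. F' s0 y \<partial>M)"
      using m by (simp add: Bochner_Integration.integral_diff)
    then show "((\<lambda>h. ((\<integral>y. F (s0 + h) y \<partial>M) - (\<integral>y. F s0 y \<partial>M)) / h) \<circ> X) \<longlonglongrightarrow> (\<integral>y. F' s0 y \<partial>M)"
      unfolding o_def by (rule LIMSEQ_offset)
  qed
  then show ?thesis by (simp add: DERIV_def)
qed

section \<open>Functions of polynomial growth, uniformly in time\<close>

definition gauss_weight :: "real \<Rightarrow> real \<Rightarrow> real" where
  "gauss_weight x y = (1 + x\<^sup>2) * (1 + y\<^sup>2)"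

lemma gauss_weight_ge_1: "1 \<le> gauss_weight x y"
  unfolding gauss_weight_def using mult_mono[of 1 "1 + x\<^sup>2" 1 "1 + y\<^sup>2"] by simp

text \<open>The class on which the interchanges of derivative and integral along the flow rest. A
  bound uniform in \<open>t\<close> is available because \<open>t\<close> enters the flow only
  through \<open>sin t\<close> and \<open>cos t\<close>. The weight is at least 1, so two bounds
  merge into one with a larger power; it factors over \<open>x\<close> and \<open>y\<close>, so
  integrating out one variable leaves a bound of the same kind.\<close>

definition tame :: "(real \<Rightarrow> real \<Rightarrow> real \<Rightarrow> 'a::real_normed_vector) \<Rightarrow> bool" where
  "tame F \<longleftrightarrow> continuous_on UNIV (\<lambda>(t, x, y). F t x y) \<and>
     (\<exists>C k. \<forall>t x y. norm (F t x y) \<le> C * gauss_weight x y ^ k)"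

lemma tameI:
  assumes "continuous_on UNIV (\<lambda>(t, x, y). F t x y)"
    and "\<And>t x y. norm (F t x y) \<le> C * gauss_weight x y ^ k"
  shows "tame F"
  using assms unfolding tame_def by blast

lemma tameE:
  assumes "tame F"
  obtains C k where "C \<ge> 1" "\<And>t x y. norm (F t x y) \<le> C * gauss_weight x y ^ k"
proof -
  obtain C k where C: "\<And>t x y. norm (F t x y) \<le> C * gauss_weight x y ^ k"
    using assms unfolding tame_def by blast
  have "norm (F t x y) \<le> max 1 C * gauss_weight x y ^ k" for t x y
    using C[of t x y] gauss_weight_ge_1[of x y]
    by (elim order_trans) (intro mult_right_mono, auto)
  then show thesis using that[of "max 1 C" k] by simp
qed

lemma tame_continuous: "tame F \<Longrightarrow> continuous_on UNIV (\<lambda>(t, x, y). F t x y)"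
  unfolding tame_def by blast

lemma tame_continuous_compose:
  assumes "tame F" "continuous_on S a" "continuous_on S b" "continuous_on S c"
  shows "continuous_on S (\<lambda>z. F (a z) (b z) (c z))"
  using continuous_on_compose2[OF tame_continuous[OF assms(1)], of S "\<lambda>z. (a z, b z, c z)"]
    continuous_on_Pair[OF assms(2) continuous_on_Pair[OF assms(3,4)]] by simp

lemma tame_const: "tame (\<lambda>t x y. c)"
  by (rule tameI[where C="norm c" and k=0]) (auto simp: case_prod_unfold)

lemma tame_fst: "tame (\<lambda>t x y. x :: real)"
proof (rule tameI[where C=1 and k=1])
  fix x y :: real
  have "\<bar>x\<bar> \<le> 1 + x\<^sup>2"
    using zero_le_power2[of "\<bar>x\<bar> - 1"] by (simp add: power2_diff)
  also have "\<dots> \<le> (1 + x\<^sup>2) * (1 + y\<^sup>2)"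
    using mult_left_mono[of 1 "1 + y\<^sup>2" "1 + x\<^sup>2"] by simp
  finally show "norm x \<le> 1 * gauss_weight x y ^ 1" by (simp add: gauss_weight_def)
qed (auto simp: case_prod_unfold intro!: continuous_intros)

lemma tame_snd: "tame (\<lambda>t x y. y :: real)"
proof (rule tameI[where C=1 and k=1])
  fix x y :: real
  have "\<bar>y\<bar> \<le> 1 + y\<^sup>2"
    using zero_le_power2[of "\<bar>y\<bar> - 1"] by (simp add: power2_diff)
  also have "\<dots> \<le> (1 + x\<^sup>2) * (1 + y\<^sup>2)"
    using mult_right_mono[of 1 "1 + x\<^sup>2" "1 + y\<^sup>2"] by simp
  finally show "norm y \<le> 1 * gauss_weight x y ^ 1" by (simp add: gauss_weight_def)
qed (auto simp: case_prod_unfold intro!: continuous_intros)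

lemma tame_sin: "tame (\<lambda>t x y. sin t :: real)"
  by (rule tameI[where C=1 and k=0]) (auto simp: case_prod_unfold intro!: continuous_intros)

lemma tame_cos: "tame (\<lambda>t x y. cos t :: real)"
  by (rule tameI[where C=1 and k=0]) (auto simp: case_prod_unfold intro!: continuous_intros)

lemma tame_add:
  assumes "tame F" "tame G"
  shows "tame (\<lambda>t x y. F t x y + G t x y)"
proof -
  obtain C k where C: "C \<ge> 1" "\<And>t x y. norm (F t x y) \<le> C * gauss_weight x y ^ k"
    using tameE[OF assms(1)] by metis
  obtain D l where D: "D \<ge> 1" "\<And>t x y. norm (G t x y) \<le> D * gauss_weight x y ^ l"
    using tameE[OF assms(2)] by metis
  show ?thesis
  proof (rule tameI[where C="C + D" and k="k + l"])
    fix t x y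
    have "norm (F t x y + G t x y) \<le> C * gauss_weight x y ^ k + D * gauss_weight x y ^ l"
      by (rule order_trans[OF norm_triangle_ineq add_mono[OF C(2) D(2)]])
    also have "\<dots> \<le> C * gauss_weight x y ^ (k + l) + D * gauss_weight x y ^ (k + l)"
      using C(1) D(1) gauss_weight_ge_1[of x y]
      by (intro add_mono mult_left_mono power_increasing) auto
    finally show "norm (F t x y + G t x y) \<le> (C + D) * gauss_weight x y ^ (k + l)"
      by (simp add: distrib_right)
  qed (use assms[THEN tame_continuous] in \<open>auto simp: case_prod_unfold intro: continuous_intros\<close>)
qed

lemma tame_mult:
  fixes F G :: "real \<Rightarrow> real \<Rightarrow> real \<Rightarrow> 'a::real_normed_algebra"
  assumes "tame F" "tame G"
  shows "tame (\<lambda>t x y. F t x y * G t x y)"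
proof -
  obtain C k where C: "C \<ge> 1" "\<And>t x y. norm (F t x y) \<le> C * gauss_weight x y ^ k"
    using tameE[OF assms(1)] by metis
  obtain D l where D: "D \<ge> 1" "\<And>t x y. norm (G t x y) \<le> D * gauss_weight x y ^ l"
    using tameE[OF assms(2)] by metis
  show ?thesis
  proof (rule tameI[where C="C * D" and k="k + l"])
    fix t x y
    have "norm (F t x y * G t x y) \<le> (C * gauss_weight x y ^ k) * (D * gauss_weight x y ^ l)"
      using C(1) gauss_weight_ge_1[of x y]
      by (intro order_trans[OF norm_mult_ineq mult_mono[OF C(2) D(2)]]) auto
    then show "norm (F t x y * G t x y) \<le> (C * D) * gauss_weight x y ^ (k + l)"
      by (simp add: power_add mult_ac)
  qed (use assms[THEN tame_continuous] in \<open>auto simp: case_prod_unfold intro: continuous_intros\<close>)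
qed

lemma tame_linear:
  assumes "tame F" "bounded_linear h"
  shows "tame (\<lambda>t x y. h (F t x y))"
proof -
  obtain C k where C: "C \<ge> 1" "\<And>t x y. norm (F t x y) \<le> C * gauss_weight x y ^ k"
    using tameE[OF assms(1)] by metis
  obtain K where K: "K \<ge> 0" "\<And>z. norm (h z) \<le> norm z * K"
    using bounded_linear.nonneg_bounded[OF assms(2)] by metis
  show ?thesis
  proof (rule tameI[where C="C * K" and k=k])
    fix t x y
    show "norm (h (F t x y)) \<le> (C * K) * gauss_weight x y ^ k"
      using order_trans[OF K(2) mult_right_mono[OF C(2) K(1)]] by (simp add: mult_ac)
  next
    show "continuous_on UNIV (\<lambda>(t, x, y). h (F t x y))"
      using tame_continuous[OF assms(1)] bounded_linear.continuous_on[OF assms(2)]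
      by (auto simp: case_prod_unfold)
  qed
qed

lemma tame_Re: "tame F \<Longrightarrow> tame (\<lambda>t x y. Re (F t x y))"
  by (rule tame_linear[OF _ bounded_linear_Re])

lemma tame_cnj: "tame F \<Longrightarrow> tame (\<lambda>t x y. cnj (F t x y))"
  by (rule tame_linear[OF _ bounded_linear_cnj])

lemma tame_of_real:
  "tame F \<Longrightarrow> tame (\<lambda>t x y. of_real (F t x y) :: 'a::{real_normed_algebra_1, real_inner})"
  by (rule tame_linear[OF _ bounded_linear_of_real])

lemma tame_minus: "tame F \<Longrightarrow> tame (\<lambda>t x y. - F t x y)"
  by (erule tame_linear) (rule bounded_linear_minus[OF bounded_linear_ident])

lemma tame_diff: "tame F \<Longrightarrow> tame G \<Longrightarrow> tame (\<lambda>t x y. F t x y - G t x y)"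
  using tame_add[OF _ tame_minus, of F G] by simp

lemma tame_power:
  fixes F :: "real \<Rightarrow> real \<Rightarrow> real \<Rightarrow> 'a::real_normed_algebra_1"
  shows "tame F \<Longrightarrow> tame (\<lambda>t x y. F t x y ^ n)"
  by (induction n) (auto intro: tame_mult tame_const)

lemma tame_sum: "(\<And>i. i \<in> I \<Longrightarrow> tame (F i)) \<Longrightarrow> tame (\<lambda>t x y. \<Sum>i\<in>I. F i t x y)"
proof (induction I rule: infinite_finite_induct)
  case (insert i I)
  then show ?case by (simp add: tame_add)
qed (simp_all add: tame_const)

lemma tame_poly:
  assumes "tame F"
  shows "tame (\<lambda>t x y. poly f (F t x y :: complex))"
  unfolding poly_altdef using assms by (intro tame_sum tame_mult tame_power tame_const)

text \<open>This is what the regularization buys: for a negative exponent the lower bound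
  \<open>\<epsilon>\<close> keeps the power bounded. For a positive one, rounding the exponent up to
  an integer gives a power of the weight, which is legitimate since \<open>tameE\<close> provides a
  base of at least 1.\<close>

lemma tame_powr:
  fixes F :: "real \<Rightarrow> real \<Rightarrow> real \<Rightarrow> real"
  assumes "tame F" and "\<epsilon> > 0" "\<And>t x y. F t x y \<ge> \<epsilon>"
  shows "tame (\<lambda>t x y. F t x y powr a)"
proof -
  obtain C k where C: "C \<ge> 1" "\<And>t x y. norm (F t x y) \<le> C * gauss_weight x y ^ k"
    using tameE[OF assms(1)] by metis
  have pos: "F t x y > 0" for t x y using assms(2,3) less_le_trans by blast
  have cont: "continuous_on UNIV (\<lambda>(t, x, y). F t x y powr a)"
    using tame_continuous[OF assms(1)] pos
    by (auto simp: case_prod_unfold less_imp_neq[symmetric] intro!: continuous_on_powr continuous_intros)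
  show ?thesis
  proof (cases "a \<le> 0")
    case True
    have "norm (F t x y powr a) \<le> (\<epsilon> powr a) * gauss_weight x y ^ 0" for t x y
      using True assms(2,3) powr_mono2'[of a \<epsilon> "F t x y"] by simp
    with cont show ?thesis by (rule tameI)
  next
    case False
    define n where "n = nat \<lceil>a\<rceil>"
    have an: "a \<le> real n" unfolding n_def by linarith
    have "norm (F t x y powr a) \<le> (C ^ n) * gauss_weight x y ^ (k * n)" for t x y
    proof -
      have ge1: "1 \<le> C * gauss_weight x y ^ k"
        using mult_mono[OF C(1) one_le_power[OF gauss_weight_ge_1, of x y k]] C(1) by simp
      have "F t x y powr a \<le> (C * gauss_weight x y ^ k) powr a"
        using False C(2)[of t x y] pos[of t x y] by (intro powr_mono2) auto
      also have "\<dots> \<le> (C * gauss_weight x y ^ k) powr real n"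
        using an ge1 by (rule powr_mono)
      also have "\<dots> = (C * gauss_weight x y ^ k) ^ n"
        using ge1 by (intro powr_realpow) auto
      finally show ?thesis by (simp add: power_mult_distrib power_mult)
    qed
    with cont show ?thesis by (rule tameI)
  qed
qed

lemmas tame_intros = tame_const tame_fst tame_snd tame_sin tame_cos tame_add tame_mult tame_Re
  tame_cnj tame_of_real tame_minus tame_diff tame_power tame_sum tame_poly

section \<open>Gaussian averages over the last variable\<close>

abbreviation gauss_snd ::
  "(real \<Rightarrow> real \<Rightarrow> real \<Rightarrow> real) \<Rightarrow> real \<Rightarrow> real \<Rightarrow> real \<Rightarrow> real" where
  "gauss_snd F \<equiv> \<lambda>t x y. \<integral>z. F t x z \<partial>std_normal_distribution"

lemma tame_section_bound:
  assumes "tame F"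
  obtains C k where "\<And>t x y. norm (F t x y) \<le> C * (1 + x\<^sup>2) ^ k * (1 + y\<^sup>2) ^ k"
  using tameE[OF assms] by (metis gauss_weight_def power_mult_distrib mult.assoc)

lemma tame_integrable_snd:
  fixes F :: "real \<Rightarrow> real \<Rightarrow> real \<Rightarrow> real"
  assumes "tame F"
  shows "integrable std_normal_distribution (\<lambda>y. F t x y)"
proof -
  obtain C k where C: "\<And>t x y. norm (F t x y) \<le> C * (1 + x\<^sup>2) ^ k * (1 + y\<^sup>2) ^ k"
    using tame_section_bound[OF assms] by metis
  show ?thesis
    by (rule Bochner_Integration.integrable_bound[OF integrable_gauss_weight[of "C * (1 + x\<^sup>2) ^ k" k]])
      (use C in \<open>auto intro!: order_trans[OF _ abs_ge_self] borel_measurable_continuous_onI tame_continuous_compose[OF assms] continuous_intros\<close>)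
qed

text \<open>Turns every statement on the last variable into one on the middle variable; this is how
  the outer integral over \<open>x\<close> is handled.\<close>

lemma tame_swap:
  assumes "tame F"
  shows "tame (\<lambda>t x y. F t y x)"
proof -
  obtain C k where C: "C \<ge> 1" "\<And>t x y. norm (F t x y) \<le> C * gauss_weight x y ^ k"
    using tameE[OF assms(1)] by metis
  have "norm (F t y x) \<le> C * gauss_weight x y ^ k" for t x y
    using C(2)[of t y x] by (simp add: gauss_weight_def mult.commute)
  then show ?thesis
    by (intro tameI[where C=C and k=k])
      (auto simp: case_prod_unfold intro!: tame_continuous_compose[OF assms] continuous_intros)
qed

lemmas tame_integrable_fst = tame_integrable_snd[OF tame_swap]

text \<open>An average keeps an idle last argument, so that it is again a function of three
  arguments and the class is closed under averaging.\<close>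

lemma tame_gauss_snd:
  assumes "tame F"
  shows "tame (gauss_snd F)"
proof -
  obtain C k where C: "\<And>t x y. norm (F t x y) \<le> C * (1 + x\<^sup>2) ^ k * (1 + y\<^sup>2) ^ k"
    using tame_section_bound[OF assms] by metis
  have C0: "C \<ge> 0" using order_trans[OF norm_ge_zero C[of 0 0 0]] by simp
  define D where "D = (\<integral>z. 1 * (1 + z\<^sup>2) ^ k \<partial>std_normal_distribution)"
  have D: "D \<ge> 0" unfolding D_def by (rule Bochner_Integration.integral_nonneg) auto
  show ?thesis
  proof (rule tameI[where C="C * D" and k=k])
    fix t x y
    have "norm (gauss_snd F t x y) \<le> (\<integral>z. C * (1 + x\<^sup>2) ^ k * (1 + z\<^sup>2) ^ k \<partial>std_normal_distribution)"
      by (rule Bochner_Integration.integral_norm_bound_integral[OF tame_integrable_snd[OF assms] integrable_gauss_weight C])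
    also have "\<dots> = C * (1 + x\<^sup>2) ^ k * D" by (simp add: D_def)
    also have "\<dots> = C * D * ((1 + x\<^sup>2) ^ k * 1)" by simp
    also have "\<dots> \<le> C * D * ((1 + x\<^sup>2) ^ k * (1 + y\<^sup>2) ^ k)"
      using C0 D by (intro mult_left_mono) auto
    finally show "norm (gauss_snd F t x y) \<le> C * D * gauss_weight x y ^ k"
      by (simp add: gauss_weight_def power_mult_distrib)
  next
    have "continuous_on UNIV (\<lambda>(t, x). \<integral>z. F t x z \<partial>std_normal_distribution)"
    proof (clarsimp simp: continuous_on_sequentially case_prod_unfold o_def)
      fix u :: "nat \<Rightarrow> real \<times> real" and t x assume u: "u \<longlonglongrightarrow> (t, x)"
      then have ux: "(\<lambda>n. snd (u n)) \<longlonglongrightarrow> x" by (rule tendsto_snd[THEN tendsto_eq_rhs]) simp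
      \<comment> \<open>A convergent sequence is bounded, so the weight in the middle variable is at
        most a constant and a single function dominates all members.\<close>
      then obtain B where "\<And>n. \<bar>snd (u n)\<bar> \<le> B"
        by (metis Bseq_def convergentI convergent_imp_Bseq real_norm_def)
      then have B: "(snd (u n))\<^sup>2 \<le> B\<^sup>2" for n by (meson abs_le_square_iff abs_ge_self order_trans)
      show "(\<lambda>n. \<integral>z. F (fst (u n)) (snd (u n)) z \<partial>std_normal_distribution) \<longlonglongrightarrow> (\<integral>z. F t x z \<partial>std_normal_distribution)"
      proof (rule integral_dominated_convergence[where w="\<lambda>z. C * (1 + B\<^sup>2) ^ k * (1 + z\<^sup>2) ^ k"])
        show "integrable std_normal_distribution (\<lambda>z. C * (1 + B\<^sup>2) ^ k * (1 + z\<^sup>2) ^ k)"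
          by (rule integrable_gauss_weight)
        show "AE z in std_normal_distribution. (\<lambda>n. F (fst (u n)) (snd (u n)) z) \<longlonglongrightarrow> F t x z"
        proof (rule AE_I2)
          fix z
          have "continuous_on UNIV (\<lambda>w. F (fst w) (snd w) z)"
            by (intro tame_continuous_compose[OF assms] continuous_intros)
          from continuous_on_tendsto_compose[OF this u] show "(\<lambda>n. F (fst (u n)) (snd (u n)) z) \<longlonglongrightarrow> F t x z"
            by simp
        qed
        show "AE z in std_normal_distribution. norm (F (fst (u n)) (snd (u n)) z) \<le> C * (1 + B\<^sup>2) ^ k * (1 + z\<^sup>2) ^ k" for n
          by (rule AE_I2, rule order_trans[OF C])
            (intro mult_right_mono mult_left_mono power_mono, use B[of n] C0 in auto)
      qed (use tame_integrable_snd[OF assms] in auto)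
    qed
    from continuous_on_compose2[OF this, of UNIV "\<lambda>z. (fst z, fst (snd z))"]
    show "continuous_on UNIV (\<lambda>(t, x, y). gauss_snd F t x y)"
      by (simp add: case_prod_unfold continuous_on_Pair continuous_on_fst continuous_on_snd continuous_on_id)
  qed
qed

lemma gauss_snd_derivative_time:
  assumes "tame F" "tame F'"
    and "\<And>t x y. ((\<lambda>t. F t x y) has_real_derivative F' t x y) (at t)"
  shows "((\<lambda>t. gauss_snd F t x y) has_real_derivative gauss_snd F' t x y) (at t)"
proof -
  obtain C k where C: "\<And>t x y. norm (F' t x y) \<le> C * (1 + x\<^sup>2) ^ k * (1 + y\<^sup>2) ^ k"
    using tame_section_bound[OF assms(2)] by metis
  show ?thesis
    by (rule has_real_derivative_integral_param[where B="\<lambda>y. C * (1 + x\<^sup>2) ^ k * (1 + y\<^sup>2) ^ k"])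
      (use assms(3) C tame_integrable_snd[OF assms(1)] integrable_gauss_weight[of 1] in auto)
qed

text \<open>In contrast to the time derivative, the bound grows with the variable of
  differentiation; on the unit ball around \<open>x\<close> it is at most its value at
  \<open>\<bar>x\<bar> + 1\<close>.\<close>

lemma gauss_snd_derivative_space:
  assumes "tame F" "tame F'"
    and "\<And>t x y. ((\<lambda>x. F t x y) has_real_derivative F' t x y) (at x)"
  shows "((\<lambda>x. gauss_snd F t x y) has_real_derivative gauss_snd F' t x y) (at x)"
proof -
  obtain C k where C: "\<And>t x y. norm (F' t x y) \<le> C * (1 + x\<^sup>2) ^ k * (1 + y\<^sup>2) ^ k"
    using tame_section_bound[OF assms(2)] by metis
  have C0: "C \<ge> 0" using order_trans[OF norm_ge_zero C[of 0 0 0]] by simp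
  have "norm (F' t s y) \<le> C * (1 + (\<bar>x\<bar> + 1)\<^sup>2) ^ k * (1 + y\<^sup>2) ^ k" if "\<bar>s - x\<bar> \<le> 1" for s y
  proof (rule order_trans[OF C], intro mult_right_mono mult_left_mono power_mono)
    have "\<bar>s\<bar> \<le> \<bar>\<bar>x\<bar> + 1\<bar>" using that by linarith
    then have "s\<^sup>2 \<le> (\<bar>x\<bar> + 1)\<^sup>2" by (simp only: abs_le_square_iff)
    then show "1 + s\<^sup>2 \<le> 1 + (\<bar>x\<bar> + 1)\<^sup>2" by simp
  qed (use C0 in auto)
  then show ?thesis
    by (intro has_real_derivative_integral_param[where B="\<lambda>y. C * (1 + (\<bar>x\<bar> + 1)\<^sup>2) ^ k * (1 + y\<^sup>2) ^ k"])
      (use assms(3) tame_integrable_snd[OF assms(1)] integrable_gauss_weight[of 1] in auto)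
qed

lemma tame_integration_by_parts:
  assumes "tame F" "tame F'"
    and "\<And>t x y. ((\<lambda>y. F t x y) has_real_derivative F' t x y) (at y)"
  shows "(\<integral>y. y * F t x y \<partial>std_normal_distribution) = (\<integral>y. F' t x y \<partial>std_normal_distribution)"
proof -
  obtain C k where C: "\<And>t x y. norm (F t x y) \<le> C * (1 + x\<^sup>2) ^ k * (1 + y\<^sup>2) ^ k"
    using tame_section_bound[OF assms(1)] by metis
  obtain D l where D: "\<And>t x y. norm (F' t x y) \<le> D * (1 + x\<^sup>2) ^ l * (1 + y\<^sup>2) ^ l"
    using tame_section_bound[OF assms(2)] by metis
  let ?E = "max (C * (1 + x\<^sup>2) ^ k) (D * (1 + x\<^sup>2) ^ l)"
  have E: "?E \<ge> 0" using order_trans[OF norm_ge_zero C[of t x 0]] by simp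
  have "(\<integral>y. y *\<^sub>R F t x y \<partial>std_normal_distribution) = (\<integral>y. F' t x y \<partial>std_normal_distribution)"
  proof (rule gaussian_integration_by_parts[where C="?E" and k="max k l"])
    show "((\<lambda>y. F t x y) has_vector_derivative F' t x y) (at y)" for y
      using assms(3) by (simp add: has_real_derivative_iff_has_vector_derivative)
    have "continuous_on UNIV (\<lambda>y. F' t x y)"
      by (intro tame_continuous_compose[OF assms(2)] continuous_intros)
    then show "isCont (\<lambda>y. F' t x y) y" for y by (simp add: continuous_on_eq_continuous_at)
    show "norm (F t x y) \<le> ?E * (1 + y\<^sup>2) ^ max k l" for y
      by (rule order_trans[OF C]) (intro mult_mono power_increasing, use E in auto)
    show "norm (F' t x y) \<le> ?E * (1 + y\<^sup>2) ^ max k l" for y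
      by (rule order_trans[OF D]) (intro mult_mono power_increasing, use E in auto)
  qed
  then show ?thesis by simp
qed

section \<open>The interpolation flow\<close>

text \<open>By 2 (Re z)^2 = |z|^2 + Re (z^2) the quadratic inequality becomes - Re (D w^2) \<le> R
  |w|^2, where D is the number inside the modulus and R the right side of the condition. Optimizing
  the phase of w gives |D| \<le> R.\<close>

lemma complex_hypercontractivity_condition_iff:
  fixes \<omega> :: complex and p q :: real
  shows "cmod (complex_of_real (p - 2) - \<omega> ^ 2 * complex_of_real (q - 2)) \<le> p - cmod \<omega> ^ 2 * q \<longleftrightarrow>
    (\<forall>w. (q - 2) * (Re (\<omega> * w))\<^sup>2 + (cmod (\<omega> * w))\<^sup>2 \<le> (cmod w)\<^sup>2 + (p - 2) * (Re w)\<^sup>2)"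
    (is "cmod ?D \<le> ?R \<longleftrightarrow> (\<forall>w. ?P w)")
proof -
  have sq: "2 * (Re z)\<^sup>2 = (cmod z)\<^sup>2 + Re (z\<^sup>2)" for z
  proof -
    have "Re (z\<^sup>2) = (Re z)\<^sup>2 - (Im z)\<^sup>2" by (simp add: power2_eq_square)
    then show ?thesis using cmod_power2[of z] by linarith
  qed
  have eq: "?P w \<longleftrightarrow> - Re (?D * w\<^sup>2) \<le> ?R * (cmod w)\<^sup>2" for w
  proof -
    have e: "Re (?D * w\<^sup>2) = (p - 2) * Re (w\<^sup>2) - (q - 2) * Re ((\<omega> * w)\<^sup>2)"
    proof -
      have "?D * w\<^sup>2 = (p - 2) *\<^sub>R w\<^sup>2 - (q - 2) *\<^sub>R (\<omega> * w)\<^sup>2"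
        by (simp add: scaleR_conv_of_real algebra_simps power_mult_distrib)
      then show ?thesis by simp
    qed
    have "?P w \<longleftrightarrow> (q - 2) * (2 * (Re (\<omega> * w))\<^sup>2) + 2 * (cmod (\<omega> * w))\<^sup>2
        \<le> 2 * (cmod w)\<^sup>2 + (p - 2) * (2 * (Re w)\<^sup>2)" by linarith
    also have "\<dots> \<longleftrightarrow> - Re (?D * w\<^sup>2) \<le> ?R * (cmod w)\<^sup>2"
      unfolding e sq by (simp add: norm_mult power_mult_distrib algebra_simps)
    finally show ?thesis .
  qed
  show ?thesis
  proof
    assume a: "cmod ?D \<le> ?R"
    show "\<forall>w. ?P w"
    proof
      fix w
      have "- Re (?D * w\<^sup>2) \<le> cmod (?D * w\<^sup>2)" using abs_Re_le_cmod[of "?D * w\<^sup>2"] by linarith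
      also have "\<dots> \<le> ?R * (cmod w)\<^sup>2"
        unfolding norm_mult norm_power using a by (rule mult_right_mono) simp
      finally show "?P w" unfolding eq .
    qed
  next
    assume a: "\<forall>w. ?P w"
    \<comment> \<open>The extremal phase: with w^2 = - cnj D one has D w^2 = - |D|^2.\<close>
    define w where "w = csqrt (- cnj ?D)"
    have w1: "w\<^sup>2 = - cnj ?D" unfolding w_def by (rule power2_csqrt)
    have w2: "(cmod w)\<^sup>2 = cmod ?D" by (simp only: norm_power[symmetric] w1 norm_minus_cancel complex_mod_cnj)
    note w = w1 w2
    have aux: "- Re (z * - cnj z) = cmod z * cmod z" for z
      using cmod_power2[of z] by (simp add: power2_eq_square)
    have "- Re (?D * w\<^sup>2) = cmod ?D * cmod ?D"
      unfolding w1 by (rule aux)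
    then have "cmod ?D * cmod ?D \<le> ?R * cmod ?D" using a[rule_format, of w] w unfolding eq by simp
    \<comment> \<open>For D = 0 the extremal w is 0 and carries no information; w = 1 then yields 0
      \<le> R.\<close>
    moreover have "- Re ?D \<le> ?R" using a[rule_format, of 1] unfolding eq by simp
    ultimately have le: "cmod ?D * cmod ?D \<le> ?R * cmod ?D" "- Re ?D \<le> ?R" by blast+
    show "cmod ?D \<le> ?R"
    proof (cases "?D = 0")
      case True
      from le(2) show ?thesis unfolding True by simp
    next
      case False
      then have "cmod ?D > 0" by (simp only: zero_less_norm_iff not_False_eq_True)
      from mult_right_le_imp_le[OF le(1) this] show ?thesis .
    qed
  qed
qed

lemma integral_nonpos:
  fixes F :: "'a \<Rightarrow> real"
  shows "(\<And>x. F x \<le> 0) \<Longrightarrow> (\<integral>x. F x \<partial>M) \<le> 0"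
  using Bochner_Integration.integral_nonneg[of M "\<lambda>x. - F x"] by simp

section \<open>Differentials of the regularized modulus\<close>

lemma has_vector_derivative_Re_cnj_mult:
  assumes "(h has_vector_derivative h') (at s)" "(v has_vector_derivative v') (at s)"
  shows "((\<lambda>s. Re (cnj (h s) * v s)) has_real_derivative Re (cnj h' * v s) + Re (cnj (h s) * v')) (at s)"
proof -
  have "((\<lambda>s. cnj (h s)) has_vector_derivative cnj h') (at s)"
    using bounded_linear.has_vector_derivative[OF bounded_linear_cnj assms(1)] .
  from has_vector_derivative_mult[OF this assms(2)]
  have "((\<lambda>s. Re (cnj (h s) * v s)) has_vector_derivative Re (cnj (h s) * v' + cnj h' * v s)) (at s)"
    by (rule bounded_linear.has_vector_derivative[OF bounded_linear_Re])
  then show ?thesis by (simp add: has_real_derivative_iff_has_vector_derivative add.commute)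
qed

context
  fixes h v :: "real \<Rightarrow> complex" and h' v' :: complex and s \<epsilon> p :: real and G :: "real \<Rightarrow> real"
  assumes h: "(h has_vector_derivative h') (at s)" and v: "(v has_vector_derivative v') (at s)"
    and eps: "\<epsilon> > 0"
  defines "G \<equiv> (\<lambda>s. Re (cnj (h s) * h s) + \<epsilon>)"
begin

lemma regularized_norm_pos: "G s > 0"
  using eps unfolding G_def by (simp add: add_nonneg_pos)

text \<open>The squared modulus is written \<open>Re (cnj (h s) * h s)\<close>: as a real bilinear
  expression it obeys the product rule even at zeros of \<open>h\<close>, and
  \<open>\<epsilon>\<close> keeps the base of the power positive.\<close>

lemma regularized_norm_derivative:
  "((\<lambda>s. G s powr a) has_real_derivative 2 * a * G s powr (a - 1) * Re (cnj (h s) * h')) (at s)"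
proof -
  have "(G has_real_derivative 2 * Re (cnj (h s) * h')) (at s)"
    unfolding G_def using DERIV_add[OF has_vector_derivative_Re_cnj_mult[OF h h] DERIV_const[of \<epsilon>]]
    by (simp add: mult.commute)
  from DERIV_powr[OF this regularized_norm_pos DERIV_const[of a]] regularized_norm_pos show ?thesis
    by (auto simp: powr_diff field_simps elim!: DERIV_cong)
qed

text \<open>The second differential on the pair of directions \<open>h'\<close> and
  \<open>v\<close>, plus the first differential in the direction \<open>v'\<close>. In both
  applications \<open>h'\<close> is a real multiple of \<open>v\<close>, and the mixed form becomes
  a quadratic one.\<close>

lemma regularized_first_variation_derivative:
  "((\<lambda>s. p * G s powr (p / 2 - 1) * Re (cnj (h s) * v s)) has_real_derivative
     p * (p - 2) * G s powr (p / 2 - 2) * Re (cnj (h s) * h') * Re (cnj (h s) * v s)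
     + p * G s powr (p / 2 - 1) * (Re (cnj h' * v s) + Re (cnj (h s) * v'))) (at s)"
  by (rule derivative_eq_intros regularized_norm_derivative has_vector_derivative_Re_cnj_mult[OF h v] refl)+
    (simp add: algebra_simps)

end

section \<open>Heat evolution of a polynomial along the path\<close>

lemma higher_pderiv_eq_0:
  assumes "degree f < m"
  shows "(pderiv ^^ m) (f :: complex poly) = 0"
proof -
  obtain k where k: "m = Suc k" "degree f \<le> k" using assms by (cases m) auto
  then have "degree ((pderiv ^^ k) f) = 0" by (simp add: degree_higher_pderiv)
  then show ?thesis using k by (simp add: pderiv_eq_0_iff)
qed

lemma poly_has_vector_derivative:
  assumes "(z has_vector_derivative z') (at s)"
  shows "((\<lambda>s. poly (f :: complex poly) (z s)) has_vector_derivative z' * poly (pderiv f) (z s)) (at s)"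
  using field_vector_diff_chain_at[OF assms poly_DERIV[of f]] by (simp add: o_def)

locale gaussian_flow =
  fixes f :: "complex poly" and \<omega> :: complex and p q \<epsilon> :: real
  assumes p: "1 \<le> p" and pq: "p \<le> q" and eps: "\<epsilon> > 0"
    and cond: "cmod (complex_of_real (p - 2) - \<omega> ^ 2 * complex_of_real (q - 2)) \<le> p - cmod \<omega> ^ 2 * q"
begin

definition z :: "real \<Rightarrow> real \<Rightarrow> real \<Rightarrow> complex" where
  "z t x y = \<omega> * of_real (sin t * x) + of_real (cos t * y)"

definition \<tau> :: "real \<Rightarrow> complex" where
  "\<tau> t = (1 - \<omega>\<^sup>2) / 2 * of_real ((sin t)\<^sup>2)"

text \<open>With D for differentiation this is the j-th derivative of exp(\<tau> D^2) f, taken at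
  \<open>z\<close>; heat flow for time s is exp(s D^2 / 2), hence the 2 in \<open>\<tau>\<close>.
  Cutting the series at \<open>degree f\<close> loses nothing, as the further derivatives vanish.
  The index \<open>j\<close> makes the family closed under differentiation.\<close>

definition u :: "nat \<Rightarrow> real \<Rightarrow> real \<Rightarrow> real \<Rightarrow> complex" where
  "u j t x y = (\<Sum>k\<le>degree f. \<tau> t ^ k * of_real (inverse (fact k)) * poly ((pderiv ^^ (2 * k + j)) f) (z t x y))"

lemma tame_u: "tame (u j)"
  unfolding u_def[abs_def] z_def \<tau>_def by (intro tame_intros)

lemma u_space_derivative:
  assumes "((\<lambda>s. z (t s) (x s) (y s)) has_vector_derivative z') (at s)" "t = (\<lambda>s. t0)"
  shows "((\<lambda>s. u j (t s) (x s) (y s)) has_vector_derivative z' * u (Suc j) (t s) (x s) (y s)) (at s)"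
  unfolding u_def assms(2) sum_distrib_left
  by (rule has_vector_derivative_sum)
    (use poly_has_vector_derivative[OF assms(1)[unfolded assms(2)]] in
      \<open>auto intro!: derivative_eq_intros simp: mult_ac\<close>)

lemma u_derivative_x:
  "((\<lambda>x. u j t x y) has_vector_derivative of_real (sin t) * (\<omega> * u (Suc j) t x y)) (at x)"
proof -
  have "((\<lambda>x. z t x y) has_vector_derivative of_real (sin t) * \<omega>) (at x)"
    by (auto simp: z_def mult_ac intro!: derivative_eq_intros)
  from u_space_derivative[where t="\<lambda>s. t" and x="\<lambda>x. x" and y="\<lambda>s. y", OF this] show ?thesis
    by (simp add: mult.assoc)
qed

lemma u_derivative_y:
  "((\<lambda>y. u j t x y) has_vector_derivative of_real (cos t) * u (Suc j) t x y) (at y)"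
proof -
  have "((\<lambda>y. z t x y) has_vector_derivative of_real (cos t)) (at y)"
    by (auto simp: z_def mult_ac intro!: derivative_eq_intros)
  from u_space_derivative[where t="\<lambda>s. t" and x="\<lambda>s. x" and y="\<lambda>y. y", OF this] show ?thesis
    by simp
qed

text \<open>The heat equation: differentiating exp(c D^2) in c brings down D^2. On the left the term
  k = 0 drops out; the surplus top term on the right vanishes because its order of differentiation
  exceeds the degree.\<close>

lemma heat_shift:
  "(\<Sum>k\<le>degree f. of_nat k * c ^ (k - 1) * of_real (inverse (fact k)) * poly ((pderiv ^^ (2 * k + j)) f) w)
   = (\<Sum>k\<le>degree f. c ^ k * of_real (inverse (fact k)) * poly ((pderiv ^^ (2 * k + (j + 2))) f) w)"
proof -
  have "(\<Sum>k\<le>degree f. of_nat k * c ^ (k - 1) * of_real (inverse (fact k)) * poly ((pderiv ^^ (2 * k + j)) f) w)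
    = (\<Sum>k\<in>{Suc 0..<Suc (degree f)}. of_nat k * c ^ (k - 1) * of_real (inverse (fact k)) * poly ((pderiv ^^ (2 * k + j)) f) w)"
    by (rule sum.mono_neutral_right) (auto simp: Suc_le_eq)
  also have "\<dots> = (\<Sum>k\<in>{0..<degree f}. of_nat (Suc k) * c ^ k * of_real (inverse (fact (Suc k))) * poly ((pderiv ^^ (2 * Suc k + j)) f) w)"
    by (subst sum.shift_bounds_Suc_ivl) simp
  also have "\<dots> = (\<Sum>k\<in>{0..<degree f}. c ^ k * of_real (inverse (fact k)) * poly ((pderiv ^^ (2 * k + (j + 2))) f) w)"
  proof (rule sum.cong[OF refl])
    fix k
    have a: "of_nat (Suc k) * (of_real (inverse (fact (Suc k))) :: complex) = of_real (inverse (fact k))"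
      by (simp add: field_simps del: of_nat_Suc)
    have b: "2 * Suc k + j = 2 * k + (j + 2)" by simp
    show "of_nat (Suc k) * c ^ k * of_real (inverse (fact (Suc k))) * poly ((pderiv ^^ (2 * Suc k + j)) f) w
       = c ^ k * of_real (inverse (fact k)) * poly ((pderiv ^^ (2 * k + (j + 2))) f) w"
      unfolding b a[symmetric] by (simp only: mult_ac)
  qed
  also have "\<dots> = (\<Sum>k\<le>degree f. c ^ k * of_real (inverse (fact k)) * poly ((pderiv ^^ (2 * k + (j + 2))) f) w)"
    by (rule sum.mono_neutral_left) (auto simp: higher_pderiv_eq_0 simp del: funpow.simps)
  finally show ?thesis .
qed

definition dz :: "real \<Rightarrow> real \<Rightarrow> real \<Rightarrow> complex" where
  "dz t x y = \<omega> * of_real (cos t * x) - of_real (sin t * y)"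

lemma u_derivative_t:
  "((\<lambda>t. u j t x y) has_vector_derivative
     dz t x y * u (Suc j) t x y + of_real (sin t * cos t) * (1 - \<omega>\<^sup>2) * u (j + 2) t x y) (at t)"
proof -
  have \<tau>: "(\<tau> has_vector_derivative of_real (sin t * cos t) * (1 - \<omega>\<^sup>2)) (at t)"
  proof -
    have "((\<lambda>t. (sin t)\<^sup>2) has_real_derivative 2 * (sin t * cos t)) (at t)"
      by (auto intro!: derivative_eq_intros)
    from has_vector_derivative_mult_right[OF has_vector_derivative_of_real[OF this], of "(1 - \<omega>\<^sup>2) / 2"]
    show ?thesis unfolding \<tau>_def[abs_def] by (simp add: mult_ac)
  qed
  have \<tau>k: "((\<lambda>t. \<tau> t ^ k) has_vector_derivative (of_real (sin t * cos t) * (1 - \<omega>\<^sup>2)) * (of_nat k * \<tau> t ^ (k - 1))) (at t)" for k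
  proof -
    have "((\<lambda>w. w ^ k) has_field_derivative of_nat k * \<tau> t ^ (k - 1)) (at (\<tau> t))"
      by (auto intro!: derivative_eq_intros)
    from field_vector_diff_chain_at[OF \<tau> this] show ?thesis by (simp add: o_def)
  qed
  have zt: "((\<lambda>t. z t x y) has_vector_derivative dz t x y) (at t)"
    unfolding z_def dz_def by (auto intro!: derivative_eq_intros has_vector_derivative_of_real)
  have "((\<lambda>t. u j t x y) has_vector_derivative
     (\<Sum>k\<le>degree f. \<tau> t ^ k * of_real (inverse (fact k)) * (dz t x y * poly (pderiv ((pderiv ^^ (2 * k + j)) f)) (z t x y))
       + ((of_real (sin t * cos t) * (1 - \<omega>\<^sup>2)) * (of_nat k * \<tau> t ^ (k - 1))) * of_real (inverse (fact k))
         * poly ((pderiv ^^ (2 * k + j)) f) (z t x y))) (at t)"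
    unfolding u_def
    by (intro has_vector_derivative_sum has_vector_derivative_mult poly_has_vector_derivative[OF zt]
        has_vector_derivative_mult_left \<tau>k)
  also have "(\<Sum>k\<le>degree f. \<tau> t ^ k * of_real (inverse (fact k)) * (dz t x y * poly (pderiv ((pderiv ^^ (2 * k + j)) f)) (z t x y))
       + ((of_real (sin t * cos t) * (1 - \<omega>\<^sup>2)) * (of_nat k * \<tau> t ^ (k - 1))) * of_real (inverse (fact k))
         * poly ((pderiv ^^ (2 * k + j)) f) (z t x y))
     = dz t x y * u (Suc j) t x y + (of_real (sin t * cos t) * (1 - \<omega>\<^sup>2)) *
        (\<Sum>k\<le>degree f. of_nat k * \<tau> t ^ (k - 1) * of_real (inverse (fact k)) * poly ((pderiv ^^ (2 * k + j)) f) (z t x y))"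
    unfolding u_def sum_distrib_left sum.distrib by (intro arg_cong2[where f="(+)"] sum.cong) (auto simp: mult_ac)
  finally show ?thesis unfolding heat_shift u_def .
qed


section \<open>The regularized modulus along the flow\<close>

definition g :: "real \<Rightarrow> real \<Rightarrow> real \<Rightarrow> real" where
  "g t x y = Re (cnj (u 0 t x y) * u 0 t x y) + \<epsilon>"

definition \<phi> :: "real \<Rightarrow> real \<Rightarrow> real \<Rightarrow> real" where
  "\<phi> t x y = g t x y powr (p / 2)"

text \<open>First and second differential of \<open>\<zeta> \<mapsto> (\<bar>\<zeta>\<bar>\<^sup>2 + \<epsilon>)\<^bsup>p/2\<^esup>\<close> at \<open>u 0 t x y\<close> in the direction \<open>v t x y\<close>.\<close>

definition A :: "(real \<Rightarrow> real \<Rightarrow> real \<Rightarrow> complex) \<Rightarrow> real \<Rightarrow> real \<Rightarrow> real \<Rightarrow> real" where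
  "A v t x y = p * g t x y powr (p / 2 - 1) * Re (cnj (u 0 t x y) * v t x y)"

definition Q :: "(real \<Rightarrow> real \<Rightarrow> real \<Rightarrow> complex) \<Rightarrow> real \<Rightarrow> real \<Rightarrow> real \<Rightarrow> real" where
  "Q v t x y = p * g t x y powr (p / 2 - 1) * Re (cnj (v t x y) * v t x y)
     + p * (p - 2) * g t x y powr (p / 2 - 2) * (Re (cnj (u 0 t x y) * v t x y))\<^sup>2"

lemma g_ge: "g t x y \<ge> \<epsilon>" unfolding g_def by simp

lemma g_pos: "g t x y > 0" using g_ge[of t x y] eps by linarith

lemma tame_g: "tame g"
  unfolding g_def[abs_def] by (intro tame_intros tame_u)

lemma tame_g_powr: "tame (\<lambda>t x y. g t x y powr a)"
  by (rule tame_powr[OF tame_g eps g_ge])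

lemma tame_\<phi>: "tame \<phi>" unfolding \<phi>_def[abs_def] by (rule tame_g_powr)

lemma tame_A: "tame v \<Longrightarrow> tame (A v)"
  unfolding A_def[abs_def] by (intro tame_intros tame_u tame_g_powr)

lemma tame_Q: "tame v \<Longrightarrow> tame (Q v)"
  unfolding Q_def[abs_def] by (intro tame_intros tame_u tame_g_powr)

abbreviation u1 :: "real \<Rightarrow> real \<Rightarrow> real \<Rightarrow> complex" where "u1 \<equiv> u (Suc 0)"
abbreviation u2 :: "real \<Rightarrow> real \<Rightarrow> real \<Rightarrow> complex" where "u2 \<equiv> u (Suc (Suc 0))"
abbreviation \<omega>u1 :: "real \<Rightarrow> real \<Rightarrow> real \<Rightarrow> complex" where "\<omega>u1 \<equiv> \<lambda>t x y. \<omega> * u1 t x y"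
abbreviation \<omega>u2 :: "real \<Rightarrow> real \<Rightarrow> real \<Rightarrow> complex" where "\<omega>u2 \<equiv> \<lambda>t x y. \<omega>\<^sup>2 * u2 t x y"
abbreviation \<omega>u3 :: "real \<Rightarrow> real \<Rightarrow> real \<Rightarrow> complex" where "\<omega>u3 \<equiv> \<lambda>t x y. (1 - \<omega>\<^sup>2) * u2 t x y"

lemma tame_directions: "tame u1" "tame u2" "tame \<omega>u1" "tame \<omega>u2" "tame \<omega>u3"
  by (intro tame_intros tame_u)+

text \<open>What remains of the sin t cos t part of the time derivative after integration by parts
  in y: the heat term minus the y-derivative of \<open>A u1\<close> divided by cos t. The
  counterpart \<open>S\<close> is the x-derivative of \<open>A \<omega>u1\<close> divided by sin
  t.\<close>

definition R :: "real \<Rightarrow> real \<Rightarrow> real \<Rightarrow> real" where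
  "R t x y = A \<omega>u3 t x y - A u2 t x y - Q u1 t x y"

definition S :: "real \<Rightarrow> real \<Rightarrow> real \<Rightarrow> real" where
  "S t x y = Q \<omega>u1 t x y + A \<omega>u2 t x y"

lemma tame_R: "tame R" unfolding R_def[abs_def] by (intro tame_intros tame_A tame_Q tame_u)
lemma tame_S: "tame S" unfolding S_def[abs_def] by (intro tame_intros tame_A tame_Q tame_u)

text \<open>\<open>A\<close> is linear in its direction and (1 - \<omega>^2) - 1 + \<omega>^2 = 0,
  so all first differentials cancel. The heat time was chosen for this; only the difference of two
  quadratic forms is left.\<close>

lemma R_plus_S: "R t x y + S t x y = Q \<omega>u1 t x y - Q u1 t x y"
  unfolding R_def S_def A_def by (simp add: algebra_simps)

lemma \<phi>_derivative_t:
  "((\<lambda>t. \<phi> t x y) has_real_derivative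
     cos t * (x * A \<omega>u1 t x y) - sin t * (y * A u1 t x y) + sin t * cos t * A \<omega>u3 t x y) (at t)"
  unfolding \<phi>_def g_def
  by (rule DERIV_cong[OF regularized_norm_derivative[OF u_derivative_t u_derivative_t eps]])
    (simp add: A_def g_def dz_def numeral_2_eq_2 algebra_simps)

lemma \<phi>_derivative_x: "((\<lambda>x. \<phi> t x y) has_real_derivative sin t * A \<omega>u1 t x y) (at x)"
  unfolding \<phi>_def g_def
  by (rule DERIV_cong[OF regularized_norm_derivative[OF u_derivative_x u_derivative_x eps]])
    (simp add: A_def g_def algebra_simps)

lemma A_derivative_x: "((\<lambda>x. A \<omega>u1 t x y) has_real_derivative sin t * S t x y) (at x)"
proof -
  have v: "((\<lambda>x. \<omega> * u1 t x y) has_vector_derivative of_real (sin t) * (\<omega>\<^sup>2 * u2 t x y)) (at x)"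
    using has_vector_derivative_mult_right[OF u_derivative_x[of "Suc 0"], of \<omega>]
    by (simp add: power2_eq_square mult_ac)
  show ?thesis
    unfolding A_def g_def
    by (rule DERIV_cong[OF regularized_first_variation_derivative[OF u_derivative_x v eps]])
      (simp add: S_def A_def Q_def g_def power2_eq_square algebra_simps)
qed

lemma A_derivative_y: "((\<lambda>y. A u1 t x y) has_real_derivative cos t * (Q u1 t x y + A u2 t x y)) (at y)"
  unfolding A_def g_def
  by (rule DERIV_cong[OF regularized_first_variation_derivative[OF u_derivative_y u_derivative_y eps]])
    (simp add: A_def Q_def g_def power2_eq_square algebra_simps)

section \<open>The averaged functional and the sign of its derivative\<close>

abbreviation V :: "real \<Rightarrow> real \<Rightarrow> real \<Rightarrow> real" where "V \<equiv> gauss_snd \<phi>"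
abbreviation K :: "real \<Rightarrow> real \<Rightarrow> real \<Rightarrow> real" where "K \<equiv> gauss_snd (A \<omega>u1)"

lemmas gauss_integrals = tame_integrable_snd[OF tame_A[OF tame_directions(1)]]
  tame_integrable_snd[OF tame_A[OF tame_directions(2)]] tame_integrable_snd[OF tame_A[OF tame_directions(3)]]
  tame_integrable_snd[OF tame_A[OF tame_directions(4)]] tame_integrable_snd[OF tame_A[OF tame_directions(5)]]
  tame_integrable_snd[OF tame_Q[OF tame_directions(1)]] tame_integrable_snd[OF tame_Q[OF tame_directions(3)]]
  tame_integrable_snd[OF tame_\<phi>] tame_integrable_snd[OF tame_R] tame_integrable_snd[OF tame_S]

text \<open>Only the term with y is integrated by parts here. The term with x has to wait for the
  outer integral, where a power of \<open>V\<close> depends on x as well.\<close>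

lemma V_derivative_t:
  "((\<lambda>t. V t x y) has_real_derivative cos t * (x * K t x y) + sin t * cos t * gauss_snd R t x y) (at t)"
proof -
  let ?F = "\<lambda>t x y. cos t * (x * A \<omega>u1 t x y) - sin t * (y * A u1 t x y) + sin t * cos t * A \<omega>u3 t x y"
  have "tame ?F"
    by (intro tame_intros tame_A tame_u)
  from gauss_snd_derivative_time[OF tame_\<phi> this \<phi>_derivative_t]
  have 1: "((\<lambda>t. V t x y) has_real_derivative gauss_snd ?F t x y) (at t)" .
  have "tame (\<lambda>t x y. y * A u1 t x y)" by (intro tame_intros tame_A tame_u)
  note i = tame_integrable_snd[OF this]
  have "tame (\<lambda>t x y. cos t * (Q u1 t x y + A u2 t x y))" by (intro tame_intros tame_A tame_Q tame_u)
  from tame_integration_by_parts[OF tame_A[OF tame_u] this A_derivative_y]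
  have ibp: "(\<integral>y. y * A u1 t x y \<partial>std_normal_distribution)
    = cos t * (\<integral>y. (Q u1 t x y + A u2 t x y) \<partial>std_normal_distribution)" by simp
  have "gauss_snd ?F t x y = cos t * (x * K t x y) - sin t * (\<integral>y. y * A u1 t x y \<partial>std_normal_distribution)
     + sin t * cos t * gauss_snd (A \<omega>u3) t x y"
    using gauss_integrals i by simp
  also have "\<dots> = cos t * (x * K t x y) + sin t * cos t * gauss_snd R t x y"
    unfolding ibp R_def using gauss_integrals by (simp add: algebra_simps)
  finally show ?thesis using 1 by simp
qed

lemma V_derivative_x: "((\<lambda>x. V t x y) has_real_derivative sin t * K t x y) (at x)"
proof -
  have "tame (\<lambda>t x y. sin t * A \<omega>u1 t x y)" by (intro tame_intros tame_A tame_u)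
  from gauss_snd_derivative_space[OF tame_\<phi> this \<phi>_derivative_x] show ?thesis by simp
qed

lemma K_derivative_x: "((\<lambda>x. K t x y) has_real_derivative sin t * gauss_snd S t x y) (at x)"
proof -
  have "tame (\<lambda>t x y. sin t * S t x y)" by (intro tame_intros tame_S)
  from gauss_snd_derivative_space[OF tame_A[OF tame_directions(3)] this A_derivative_x] show ?thesis by simp
qed

text \<open>The exponent q / p - 2 of \<open>V\<close>, which occurs below, may be negative; this
  lower bound keeps such powers tame.\<close>

lemma V_ge: "V t x y \<ge> \<epsilon> powr (p / 2)"
proof (rule prob_space.integral_ge_const)
  show "prob_space std_normal_distribution" by (rule prob_space_normal_density) simp
  show "AE z in std_normal_distribution. \<epsilon> powr (p / 2) \<le> \<phi> t x z"
    unfolding \<phi>_def using g_ge p eps by (intro AE_I2 powr_mono2) auto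
qed (rule gauss_integrals)

lemma V_pos: "V t x y > 0" by (rule less_le_trans[OF _ V_ge]) (use eps in simp)

lemma tame_V_powr: "tame (\<lambda>t x y. V t x y powr a)"
  by (rule tame_powr[OF tame_gauss_snd[OF tame_\<phi>] _ V_ge]) (use eps in simp)

text \<open>With \<open>c = K / V\<close> this is the form in which Cauchy-Schwarz, \<open>K\<^sup>2 \<le> V \<integral> (A \<omega>u1)\<^sup>2 / \<phi> d\<gamma>\<close>, enters
  the sign of the derivative of \<open>\<Phi>\<close>.\<close>

lemma pointwise_flow_inequality:
  "(q / p - 1) * (2 * c * A \<omega>u1 t x y - c\<^sup>2 * \<phi> t x y) + Q \<omega>u1 t x y - Q u1 t x y \<le> 0"
proof -
  let ?G = "g t x y" and ?h = "u 0 t x y" and ?v = "u1 t x y"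
  define m where "m = Re (cnj ?h * (\<omega> * ?v))"
  define G2 where "G2 = ?G powr (p / 2 - 2)"
  have G2: "G2 > 0" unfolding G2_def using g_pos[of t x y] by simp
  \<comment> \<open>All powers of \<open>g\<close> become multiples of the positive factor
    \<open>G2\<close>, which reduces the claim to a polynomial inequality.\<close>
  have G1: "?G powr (p / 2 - 1) = ?G * G2" "?G powr (p / 2) = ?G\<^sup>2 * G2"
    unfolding G2_def using g_pos[of t x y]
      powr_add[of ?G 1 "p / 2 - 2"] powr_add[of ?G 2 "p / 2 - 2"] by (simp_all add: powr_numeral)
  \<comment> \<open>Completing the square in \<open>c\<close> gives a bound valid for every
    \<open>c\<close>.\<close>
  have "2 * c * (p * (?G * G2) * m) - c\<^sup>2 * (?G\<^sup>2 * G2) = G2 * (p\<^sup>2 * m\<^sup>2 - (c * ?G - p * m)\<^sup>2)"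
    by (simp add: power2_eq_square algebra_simps)
  also have "\<dots> \<le> G2 * (p\<^sup>2 * m\<^sup>2)" using G2 by simp
  finally have "(q / p - 1) * (2 * c * A \<omega>u1 t x y - c\<^sup>2 * \<phi> t x y) \<le> (q / p - 1) * (G2 * (p\<^sup>2 * m\<^sup>2))"
    unfolding A_def \<phi>_def G1 m_def[symmetric] using p pq by (intro mult_left_mono) auto
  also have "\<dots> = p * G2 * ((q - p) * m\<^sup>2)" using p by (simp add: field_simps power2_eq_square)
  finally have 1: "(q / p - 1) * (2 * c * A \<omega>u1 t x y - c\<^sup>2 * \<phi> t x y) \<le> p * G2 * ((q - p) * m\<^sup>2)" .
  have Re: "Re (cnj w * w) = (cmod w)\<^sup>2" for w using cmod_power2[of w] by (simp add: power2_eq_square)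
  have g: "?G = (cmod ?h)\<^sup>2 + \<epsilon>" unfolding g_def Re ..
  have key: "(q - 2) * (Re (\<omega> * w))\<^sup>2 + (cmod (\<omega> * w))\<^sup>2 \<le> (cmod w)\<^sup>2 + (p - 2) * (Re w)\<^sup>2" for w
    using cond unfolding complex_hypercontractivity_condition_iff by blast
  \<comment> \<open>The left side of the condition is nonnegative and p \<le> q, hence |\<omega>|
    \<le> 1. This pays for the \<open>\<epsilon>\<close> inside \<open>g\<close>, which the
    homogeneous inequality \<open>key\<close> does not cover.\<close>
  have "p - (cmod \<omega>)\<^sup>2 * q \<ge> 0" using cond norm_ge_zero order_trans by blast
  then have "(cmod \<omega>)\<^sup>2 * q \<le> 1 * q" using pq by linarith
  then have "(cmod \<omega>)\<^sup>2 \<le> 1" using p pq by simp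
  then have "(cmod \<omega>)\<^sup>2 * (cmod ?v)\<^sup>2 * \<epsilon> \<le> 1 * (cmod ?v)\<^sup>2 * \<epsilon>"
    using eps by (intro mult_right_mono) auto
  \<comment> \<open>The test value w = cnj h * v has modulus |h| |v|, and its real part is the first
    variation of |h|^2 / 2 in the direction v.\<close>
  moreover have "(q - 2) * m\<^sup>2 + (cmod ?h)\<^sup>2 * (cmod \<omega>)\<^sup>2 * (cmod ?v)\<^sup>2
     \<le> (cmod ?h)\<^sup>2 * (cmod ?v)\<^sup>2 + (p - 2) * (Re (cnj ?h * ?v))\<^sup>2"
    using key[of "cnj ?h * ?v"] unfolding m_def by (simp add: norm_mult power_mult_distrib mult_ac)
  ultimately have 2: "(q - 2) * m\<^sup>2 + ?G * ((cmod \<omega>)\<^sup>2 * (cmod ?v)\<^sup>2)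
      \<le> ?G * (cmod ?v)\<^sup>2 + (p - 2) * (Re (cnj ?h * ?v))\<^sup>2"
    unfolding g by (simp add: algebra_simps)
  have "p * G2 * ((q - p) * m\<^sup>2) + Q \<omega>u1 t x y - Q u1 t x y =
    p * G2 * (((q - 2) * m\<^sup>2 + ?G * ((cmod \<omega>)\<^sup>2 * (cmod ?v)\<^sup>2))
      - (?G * (cmod ?v)\<^sup>2 + (p - 2) * (Re (cnj ?h * ?v))\<^sup>2))"
    unfolding Q_def G1 G2_def[symmetric] m_def[symmetric] Re norm_mult power_mult_distrib by (simp add: algebra_simps)
  also have "\<dots> \<le> 0" using 2 p G2 by (intro mult_nonneg_nonpos) auto
  finally show ?thesis using 1 by linarith
qed

definition \<Phi> :: "real \<Rightarrow> real" where
  "\<Phi> t = (\<integral>x. V t x 0 powr (q / p) \<partial>std_normal_distribution)"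

text \<open>The constant c = K / V does not depend on the integrated variable, so the pointwise
  inequality can be integrated as it stands. For this c one has 2 c K - c^2 V = K^2 / V, and
  multiplication by V > 0 clears the denominator.\<close>

lemma \<Phi>_integrand_nonpos: "(q / p - 1) * (K t x y)\<^sup>2 + V t x y * (gauss_snd R t x y + gauss_snd S t x y) \<le> 0"
proof -
  define c where "c = K t x y / V t x y"
  let ?k = "K t x y" and ?V = "V t x y" and ?X = "gauss_snd R t x y + gauss_snd S t x y"
  have V0: "?V \<noteq> 0" by (rule less_imp_neq[OF V_pos, symmetric])
  have cV: "c * ?V = ?k" by (rule nonzero_eq_divide_eq[OF V0, THEN iffD1, OF c_def])
  have "(\<integral>z. (q / p - 1) * (2 * c * A \<omega>u1 t x z - c\<^sup>2 * \<phi> t x z) + (R t x z + S t x z) \<partial>std_normal_distribution) \<le> 0"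
  proof (rule integral_nonpos)
    fix z
    show "(q / p - 1) * (2 * c * A \<omega>u1 t x z - c\<^sup>2 * \<phi> t x z) + (R t x z + S t x z) \<le> 0"
      unfolding R_plus_S using pointwise_flow_inequality[of c t x z] by linarith
  qed
  then have "(q / p - 1) * (2 * c * ?k - c\<^sup>2 * ?V) + ?X \<le> 0"
    using gauss_integrals by simp
  then have "?V * ((q / p - 1) * (2 * c * ?k - c\<^sup>2 * ?V) + ?X) \<le> 0"
    using V_pos[of t x] by (intro mult_nonneg_nonpos) auto
  also have "?V * ((q / p - 1) * (2 * c * ?k - c\<^sup>2 * ?V) + ?X)
     = (q / p - 1) * (2 * (c * ?V) * ?k - (c * ?V)\<^sup>2) + ?V * ?X"
    by (simp only: power2_eq_square algebra_simps)
  also have "\<dots> = (q / p - 1) * ?k\<^sup>2 + ?V * ?X"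
  proof -
    have "2 * k * k - k\<^sup>2 = k\<^sup>2" for k :: real by (simp add: power2_eq_square)
    then show ?thesis unfolding cV by (simp only:)
  qed
  finally show ?thesis .
qed

text \<open>With r = q / p, time differentiation leaves a term x V^(r-1) K. Integrating it by parts
  in x yields (r - 1) V^(r-2) K^2 from the power of \<open>V\<close> and V^(r-1) times the average
  of \<open>S\<close> from \<open>K\<close>, each with a factor sin t. Then sin t cos t is common to
  all terms and V^(r-2) factors out.\<close>

lemma \<Phi>_derivative:
  "(\<Phi> has_real_derivative q / p * (sin t * cos t) * (\<integral>x. V t x 0 powr (q / p - 2) *
     ((q / p - 1) * (K t x 0)\<^sup>2 + V t x 0 * (gauss_snd R t x 0 + gauss_snd S t x 0)) \<partial>std_normal_distribution)) (at t)"
proof -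
  let ?r = "q / p"
  let ?D = "\<lambda>t x y. ?r * V t x y powr (?r - 1) * (cos t * (x * K t x y) + sin t * cos t * gauss_snd R t x y)"
  note V_powr_t = DERIV_powr[OF V_derivative_t V_pos DERIV_const]
  have d: "((\<lambda>t. V t y x powr ?r) has_real_derivative ?D t y x) (at t)" for t x y
    by (rule DERIV_cong[OF V_powr_t]) (use V_pos[of t y] in \<open>simp add: powr_diff field_simps\<close>)
  note tames = tame_V_powr tame_gauss_snd[OF tame_\<phi>] tame_gauss_snd[OF tame_A] tame_gauss_snd[OF tame_R] tame_gauss_snd[OF tame_S] tame_u
  have tD: "tame ?D" by (intro tame_intros tames)
  \<comment> \<open>Swapping makes x the integrated variable; the idle last argument of
    \<open>V\<close> moves to the middle and is set to 0, as in the definition of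
    \<open>\<Phi>\<close>.\<close>
  from gauss_snd_derivative_time[OF tame_swap[OF tame_V_powr[of ?r]] tame_swap[OF tD] d]
  have 1: "(\<Phi> has_real_derivative (\<integral>x. ?D t x 0 \<partial>std_normal_distribution)) (at t)"
    unfolding \<Phi>_def[abs_def] .
  let ?H = "\<lambda>t x y. V t x y powr (?r - 1) * K t x y"
  let ?H' = "\<lambda>t x y. sin t * ((?r - 1) * V t x y powr (?r - 2) * (K t x y)\<^sup>2 + V t x y powr (?r - 1) * gauss_snd S t x y)"
  have H: "((\<lambda>x. ?H t x y) has_real_derivative ?H' t x y) (at x)" for t x y
    by (rule DERIV_cong[OF DERIV_mult[OF DERIV_powr[OF V_derivative_x V_pos DERIV_const] K_derivative_x]])
      (use V_pos[of t x] in \<open>simp add: powr_diff field_simps power2_eq_square\<close>)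
  have tH: "tame ?H" "tame ?H'" by (intro tame_intros tames)+
  from tame_integration_by_parts[OF tame_swap[OF tH(1)] tame_swap[OF tH(2)] H]
  have ibp: "(\<integral>x. x * ?H t x 0 \<partial>std_normal_distribution) = (\<integral>x. ?H' t x 0 \<partial>std_normal_distribution)" .
  have "tame (\<lambda>t x y. x * ?H t x y)" by (intro tame_intros tames)
  note i1 = tame_integrable_fst[OF this]
  have "tame (\<lambda>t x y. V t x y powr (?r - 1) * gauss_snd R t x y)" by (intro tame_intros tames)
  note i2 = tame_integrable_fst[OF this]
  have "(\<integral>x. ?D t x 0 \<partial>std_normal_distribution) =
    (\<integral>x. ?r * cos t * (x * ?H t x 0) + ?r * (sin t * cos t) * (V t x 0 powr (?r - 1) * gauss_snd R t x 0) \<partial>std_normal_distribution)"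
    by (intro Bochner_Integration.integral_cong) (auto simp: algebra_simps)
  also have "\<dots> = ?r * cos t * (\<integral>x. ?H' t x 0 \<partial>std_normal_distribution)
     + ?r * (sin t * cos t) * (\<integral>x. V t x 0 powr (?r - 1) * gauss_snd R t x 0 \<partial>std_normal_distribution)"
    unfolding ibp[symmetric] using i1 i2 by simp
  also have "\<dots> = (\<integral>x. ?r * cos t * ?H' t x 0 + ?r * (sin t * cos t) * (V t x 0 powr (?r - 1) * gauss_snd R t x 0) \<partial>std_normal_distribution)"
    using tame_integrable_fst[OF tH(2)] i2 by simp
  also have "\<dots> = (\<integral>x. ?r * (sin t * cos t) * (V t x 0 powr (?r - 2) *
     ((?r - 1) * (K t x 0)\<^sup>2 + V t x 0 * (gauss_snd R t x 0 + gauss_snd S t x 0))) \<partial>std_normal_distribution)"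
  proof (rule Bochner_Integration.integral_cong[OF refl])
    fix x
    have e: "V t x 0 powr (?r - 1) = V t x 0 powr (?r - 2) * V t x 0"
      using V_pos[of t x] by (simp add: powr_diff field_simps power2_eq_square)
    show "?r * cos t * ?H' t x 0 + ?r * (sin t * cos t) * (V t x 0 powr (?r - 1) * gauss_snd R t x 0)
      = ?r * (sin t * cos t) * (V t x 0 powr (?r - 2) *
     ((?r - 1) * (K t x 0)\<^sup>2 + V t x 0 * (gauss_snd R t x 0 + gauss_snd S t x 0)))"
      unfolding e by (simp only: algebra_simps)
  qed
  also have "\<dots> = ?r * (sin t * cos t) * (\<integral>x. V t x 0 powr (?r - 2) *
     ((?r - 1) * (K t x 0)\<^sup>2 + V t x 0 * (gauss_snd R t x 0 + gauss_snd S t x 0)) \<partial>std_normal_distribution)"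
    by (rule Bochner_Integration.integral_mult_right_zero)
  finally show ?thesis by (rule DERIV_cong[OF 1])
qed

lemma \<Phi>_antimono: "\<Phi> (pi / 2) \<le> \<Phi> 0"
proof (rule DERIV_nonpos_imp_nonincreasing[where f=\<Phi> and a=0 and b="pi / 2"])
  fix t :: real assume t: "0 \<le> t" "t \<le> pi / 2"
  have "(\<integral>x. V t x 0 powr (q / p - 2) *
     ((q / p - 1) * (K t x 0)\<^sup>2 + V t x 0 * (gauss_snd R t x 0 + gauss_snd S t x 0)) \<partial>std_normal_distribution) \<le> 0"
    using \<Phi>_integrand_nonpos by (intro integral_nonpos mult_nonneg_nonpos) auto
  then have "q / p * (sin t * cos t) * (\<integral>x. V t x 0 powr (q / p - 2) *
     ((q / p - 1) * (K t x 0)\<^sup>2 + V t x 0 * (gauss_snd R t x 0 + gauss_snd S t x 0)) \<partial>std_normal_distribution) \<le> 0"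
    using p pq t sin_ge_zero[of t] cos_ge_zero[of t] by (intro mult_nonneg_nonpos) auto
  with \<Phi>_derivative[of t] show "\<exists>y. (\<Phi> has_real_derivative y) (at t) \<and> y \<le> 0" by blast
qed simp

end

section \<open>Hypercontractivity of the Mehler transform\<close>

definition heat :: "complex \<Rightarrow> complex poly \<Rightarrow> complex poly" where
  "heat c f = (\<Sum>k\<le>degree f. smult (c ^ k / fact k) ((pderiv ^^ (2 * k)) f))"

lemma heat_eq_sum:
  assumes "degree f \<le> n"
  shows "heat c f = (\<Sum>k\<le>n. smult (c ^ k / fact k) ((pderiv ^^ (2 * k)) f))"
  unfolding heat_def using assms
  by (intro sum.mono_neutral_left) (auto simp: higher_pderiv_eq_0)

lemma smult_sum_right: "smult a (\<Sum>i\<in>I. f i) = (\<Sum>i\<in>I. smult a (f i))"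
  by (induction I rule: infinite_finite_induct) (simp_all add: smult_add_right)

lemma heat_add: "heat c (f + g) = heat c f + heat c g"
proof -
  let ?n = "max (degree f) (degree g)"
  have "degree (f + g) \<le> ?n" by (rule degree_add_le_max)
  then show ?thesis
    by (simp add: heat_eq_sum[of _ ?n] higher_pderiv_add smult_add_right sum.distrib)
qed

lemma heat_smult: "heat c (smult a f) = smult a (heat c f)"
  by (simp add: heat_eq_sum[OF degree_smult_le] heat_def higher_pderiv_smult smult_sum_right mult.commute)

lemma pderiv_heat: "pderiv (heat c f) = heat c (pderiv f)"
proof -
  have "degree (pderiv f) \<le> degree f" by (simp add: degree_pderiv)
  from heat_eq_sum[OF this] show ?thesis
    unfolding heat_def by (simp add: higher_pderiv_sum[of "Suc 0", simplified] pderiv_smult funpow_swap1)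
qed

lemma higher_pderiv_x_mult:
  "(pderiv ^^ m) ([:0, 1:] * f) = [:0, 1:] * (pderiv ^^ m) f + smult (of_nat m) ((pderiv ^^ (m - 1)) (f :: complex poly))"
proof (induction m)
  case (Suc m)
  have "(pderiv ^^ Suc m) ([:0, 1:] * f) =
    [:0, 1:] * (pderiv ^^ Suc m) f + (pderiv ^^ m) f + smult (of_nat m) (pderiv ((pderiv ^^ (m - 1)) f))"
    by (simp only: funpow.simps o_apply Suc pderiv_add pderiv_mult pderiv_smult)
      (simp add: pderiv_pCons)
  also have "smult (of_nat m) (pderiv ((pderiv ^^ (m - 1)) f)) = smult (of_nat m) ((pderiv ^^ m) f)"
    by (cases m) simp_all
  finally show ?case by (simp add: smult_add_left algebra_simps)
qed simp

text \<open>The commutator of exp(c D^2) with multiplication by x is 2 c D exp(c D^2). It is summed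
  up from D^m x = x D^m + m D^(m-1).\<close>

lemma heat_x_mult: "heat c ([:0, 1:] * f) = [:0, 1:] * heat c f + smult (2 * c) (heat c (pderiv f))"
proof -
  let ?n = "degree f" let ?X = "[:0, 1 :: complex:]"
  have d: "degree (?X * f) \<le> Suc ?n"
    by (rule order_trans[OF degree_mult_le]) simp
  have "heat c (?X * f) = (\<Sum>k\<le>Suc ?n. smult (c ^ k / fact k) (?X * (pderiv ^^ (2 * k)) f))
     + (\<Sum>k\<le>Suc ?n. smult (c ^ k / fact k * of_nat (2 * k)) ((pderiv ^^ (2 * k - 1)) f))"
    unfolding heat_eq_sum[OF d] higher_pderiv_x_mult by (simp only: smult_add_right sum.distrib smult_smult)
  also have "(\<Sum>k\<le>Suc ?n. smult (c ^ k / fact k) (?X * (pderiv ^^ (2 * k)) f)) = ?X * heat c f"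
    by (subst heat_eq_sum[of f "Suc ?n"]) (simp_all only: le_SucI order_refl sum_distrib_left mult_smult_right)
  also have "(\<Sum>k\<le>Suc ?n. smult (c ^ k / fact k * of_nat (2 * k)) ((pderiv ^^ (2 * k - 1)) f))
    = (\<Sum>k\<le>?n. smult (c ^ Suc k / fact (Suc k) * of_nat (2 * Suc k)) ((pderiv ^^ (2 * Suc k - 1)) f))"
    by (subst sum.atMost_Suc_shift) simp
  also have "\<dots> = (\<Sum>k\<le>?n. smult (2 * c) (smult (c ^ k / fact k) ((pderiv ^^ (2 * k)) (pderiv f))))"
  proof (rule sum.cong[OF refl])
    fix k
    have "c ^ Suc k / fact (Suc k) * of_nat (2 * Suc k) = 2 * c * (c ^ k / fact k)"
    proof -
      have "(of_nat (Suc k) :: complex) \<noteq> 0" by (simp only: of_nat_eq_0_iff)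
      then show ?thesis unfolding fact_Suc of_nat_mult power_Suc by (simp add: divide_simps del: of_nat_Suc)
    qed
    moreover have "(pderiv ^^ (2 * Suc k - 1)) f = (pderiv ^^ (2 * k)) (pderiv f)"
      by (simp add: funpow_swap1)
    ultimately show "smult (c ^ Suc k / fact (Suc k) * of_nat (2 * Suc k)) ((pderiv ^^ (2 * Suc k - 1)) f)
      = smult (2 * c) (smult (c ^ k / fact k) ((pderiv ^^ (2 * k)) (pderiv f)))"
      by (simp only: smult_smult)
  qed
  also have "\<dots> = smult (2 * c) (heat c (pderiv f))"
    using heat_eq_sum[of "pderiv f" ?n c] by (simp add: smult_sum_right degree_pderiv)
  finally show ?thesis .
qed

lemma pderiv_hermite: "pderiv (hermite (Suc n)) = smult (of_nat (Suc n)) (hermite n)"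
proof (induction n rule: less_induct)
  case (less n)
  show ?case
  proof (cases n)
    case (Suc m)
    have 1: "pderiv (hermite (Suc m)) = smult (of_nat (Suc m)) (hermite m)" using less Suc by simp
    have 2: "pderiv (hermite m) = (if m = 0 then 0 else smult (of_nat m) (hermite (m - 1)))"
      using less[of "m - 1"] Suc by (cases m) (auto simp del: of_nat_Suc)
    have 3: "hermite (Suc m) = [:0, 1:] * hermite m - (if m = 0 then 0 else smult (of_nat m) (hermite (m - 1)))"
      by (cases m) (simp_all del: of_nat_Suc)
    have "pderiv (hermite (Suc n)) = hermite (Suc m)
       + smult (of_nat (Suc m)) ([:0, 1:] * hermite m - (if m = 0 then 0 else smult (of_nat m) (hermite (m - 1))))"
      unfolding Suc hermite.simps(3) pderiv_diff pderiv_mult pderiv_smult 1 2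
      by (simp add: pderiv_pCons smult_diff_right del: of_nat_Suc)
    also have "\<dots> = smult (of_nat (Suc n)) (hermite n)"
      unfolding 3[symmetric] Suc by (simp only: of_nat_Suc smult_add_left smult_1_left)
    finally show ?thesis .
  qed (simp add: pderiv_pCons)
qed

text \<open>A diagonal operator is determined by its values on the basis, so Hermite polynomials
  suffice. There \<open>heat_x_mult\<close> and \<open>pderiv_hermite\<close> turn the coefficient
  -1 of (n + 1) H_n in the recurrence into (1 - \<omega>^2) - 1 = - \<omega>^2, and the recurrence
  reappears with the common factor \<omega>^(n+2).\<close>

lemma T_op_eq_heat: "T_op \<omega> f = pcompose (heat ((1 - \<omega>\<^sup>2) / 2) f) [:0, \<omega>:]"
proof -
  have c2: "2 * ((1 - \<omega>\<^sup>2) / 2) = 1 - \<omega>\<^sup>2" by simp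
  let ?c = "(1 - \<omega>\<^sup>2) / 2" let ?T = "\<lambda>f. pcompose (heat ?c f) [:0, \<omega>:]"
  have "diag_op hermite \<omega> = ?T"
  proof (rule diag_op_eqI[OF monic_sequence_hermite])
    show "Vector_Spaces.linear smult smult ?T"
      unfolding linear_smult_iff by (simp add: heat_add heat_smult pcompose_add pcompose_smult)
    show "?T (hermite l) = smult (\<omega> ^ l) (hermite l)" for l
    proof (induction l rule: hermite.induct)
      case 1
      show ?case by (simp add: heat_def)
    next
      case 2
      show ?case by (simp add: heat_def pderiv_pCons numeral_2_eq_2 pcompose_pCons)
    next
      case (3 n)
      have "?T (hermite (Suc (Suc n))) = [:0, \<omega>:] * ?T (hermite (Suc n))
          + smult (1 - \<omega>\<^sup>2) (smult (of_nat (Suc n)) (?T (hermite n)))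
          - smult (of_nat (Suc n)) (?T (hermite n))"
      proof -
        have "heat ?c (hermite (Suc (Suc n))) = heat ?c ([:0, 1:] * hermite (Suc n)) + smult (- of_nat (Suc n)) (heat ?c (hermite n))"
          by (simp only: hermite.simps diff_conv_add_uminus smult_minus_left[symmetric] heat_add heat_smult)
        then show ?thesis
          by (simp only: heat_x_mult c2 pderiv_hermite heat_smult pcompose_add pcompose_mult pcompose_smult)
            (simp add: pcompose_pCons c2 del: of_nat_Suc)
      qed
      also have "\<dots> = smult (\<omega> ^ Suc (Suc n)) (hermite (Suc (Suc n)))"
        unfolding 3 hermite.simps
        by (simp add: poly_eq_poly_eq_iff[symmetric] fun_eq_iff algebra_simps power2_eq_square)
      finally show ?case .
    qed
  qed
  then show ?thesis unfolding T_op_def by metis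
qed

lemma pderiv_T_op: "pderiv (T_op \<omega> f) = smult \<omega> (T_op \<omega> (pderiv f))"
  by (simp add: T_op_eq_heat pderiv_pcompose pderiv_heat pderiv_pCons)

lemma T_op_x_mult:
  "T_op \<omega> ([:0, 1:] * f) = smult \<omega> ([:0, 1:] * T_op \<omega> f) + smult (1 - \<omega>\<^sup>2) (T_op \<omega> (pderiv f))"
proof -
  have c2: "2 * ((1 - \<omega>\<^sup>2) / 2) = 1 - \<omega>\<^sup>2" by simp
  show ?thesis
    unfolding T_op_eq_heat heat_x_mult pcompose_add pcompose_mult pcompose_smult c2
    by (simp add: pcompose_pCons)
qed

lemma T_op_linear: "Vector_Spaces.linear smult smult (T_op \<omega>)"
  unfolding T_op_def by (rule diag_op_linear[OF monic_sequence_hermite])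

lemma T_op_1: "T_op \<omega> 1 = 1"
  using diag_op_basis[OF monic_sequence_hermite, of \<omega> 0] by (simp add: T_op_def)

section \<open>From the flow to norm inequalities\<close>

lemma tame_poly_fun_snd: "tame (\<lambda>t x y. poly_fun f y)"
  unfolding poly_fun_def by (intro tame_intros)

lemma tame_regularized:
  assumes "\<epsilon> > 0"
  shows "tame (\<lambda>t x y. ((cmod (poly_fun f y))\<^sup>2 + \<epsilon>) powr a)"
proof -
  have "(cmod z)\<^sup>2 = Re (cnj z * z)" for z using cmod_power2[of z] by (simp add: power2_eq_square)
  then have "tame (\<lambda>t x y. (cmod (poly_fun f y))\<^sup>2 + \<epsilon>)"
    by (simp only:) (intro tame_intros tame_poly_fun_snd)
  from tame_powr[OF this assms] show ?thesis by simp
qed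

lemmas integrable_regularized = tame_integrable_snd[OF tame_regularized]

lemma power2_powr_half:
  assumes "0 \<le> (a :: real)"
  shows "a\<^sup>2 powr (p / 2) = a powr p"
proof (cases "a = 0")
  case False
  then have "a\<^sup>2 = a powr 2" using assms by (simp add: powr_numeral)
  then show ?thesis by (simp only: powr_powr) simp
qed simp

lemma powr_le_regularized:
  assumes "0 \<le> \<epsilon>" "0 \<le> p"
  shows "cmod w powr p \<le> ((cmod w)\<^sup>2 + \<epsilon>) powr (p / 2)"
proof -
  have "cmod w powr p = ((cmod w)\<^sup>2) powr (p / 2)" by (simp add: power2_powr_half)
  also have "\<dots> \<le> ((cmod w)\<^sup>2 + \<epsilon>) powr (p / 2)"
    using assms by (intro powr_mono2) auto
  finally show ?thesis .
qed

lemma poly_fun_measurable [measurable]: "poly_fun f \<in> borel_measurable borel"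
  unfolding poly_fun_def[abs_def]
  by (intro borel_measurable_continuous_onI continuous_intros)

lemma integrable_poly_fun_powr:
  assumes "0 \<le> p"
  shows "integrable std_normal_distribution (\<lambda>x. cmod (poly_fun f x) powr p)"
  by (rule Bochner_Integration.integrable_bound[OF integrable_regularized[of 1 f "p / 2"]])
    (use powr_le_regularized[of 1 p] assms in auto)

text \<open>Monotonicity of \<open>\<Phi>\<close>, read at its endpoints. At pi/2 the integrand is
  free of y and the inner average is trivial; at 0 it is free of x and the outer one is
  trivial.\<close>

lemma regularized_hypercontractivity:
  assumes "1 \<le> p" "p \<le> q" and eps: "\<epsilon> > 0"
    and cond: "cmod (complex_of_real (p - 2) - \<omega> ^ 2 * complex_of_real (q - 2)) \<le> p - cmod \<omega> ^ 2 * q"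
  shows "(\<integral>x. ((cmod (poly_fun (T_op \<omega> f) x))\<^sup>2 + \<epsilon>) powr (q / 2) \<partial>std_normal_distribution)
    \<le> (\<integral>x. ((cmod (poly_fun f x))\<^sup>2 + \<epsilon>) powr (p / 2) \<partial>std_normal_distribution) powr (q / p)"
proof -
  interpret gaussian_flow f \<omega> p q \<epsilon> by unfold_locales fact+
  interpret N: prob_space std_normal_distribution by (rule prob_space_normal_density) simp
  have N: "N.prob UNIV = 1" using N.prob_space by simp
  have Re: "Re (cnj z * z) = (cmod z)\<^sup>2" for z using cmod_power2[of z] by (simp add: power2_eq_square)
  have "u 0 (pi / 2) x y = poly_fun (T_op \<omega> f) x" for x y
  proof -
    have z: "z (pi / 2) x y = \<omega> * of_real x" by (simp add: z_def)
    have \<tau>: "\<tau> (pi / 2) = (1 - \<omega>\<^sup>2) / 2" by (simp add: \<tau>_def)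
    have w: "poly [:0, \<omega>:] (complex_of_real x) = \<omega> * of_real x" by (simp add: mult.commute)
    show ?thesis
      unfolding u_def \<tau> z poly_fun_def T_op_eq_heat heat_def poly_pcompose poly_sum poly_smult w
      by (rule sum.cong) (simp_all only: add_0_right divide_inverse of_real_inverse of_real_fact)
  qed
  then have "V (pi / 2) x y powr (q / p) = ((cmod (poly_fun (T_op \<omega> f) x))\<^sup>2 + \<epsilon>) powr (q / 2)" for x y
    unfolding \<phi>_def g_def Re using p by (simp add: powr_powr N)
  then have 1: "\<Phi> (pi / 2) = (\<integral>x. ((cmod (poly_fun (T_op \<omega> f) x))\<^sup>2 + \<epsilon>) powr (q / 2) \<partial>std_normal_distribution)"
    unfolding \<Phi>_def by simp
  have "u 0 0 x y = poly_fun f y" for x y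
  proof -
    \<comment> \<open>The heat time vanishes at t = 0, so by 0^0 = 1 only the term k = 0
      survives.\<close>
    have "u 0 0 x y = (\<Sum>k\<in>{0}. \<tau> 0 ^ k * of_real (inverse (fact k)) * poly ((pderiv ^^ (2 * k + 0)) f) (z 0 x y))"
      unfolding u_def by (rule sum.mono_neutral_right) (auto simp: \<tau>_def power_0_left)
    then show ?thesis by (simp add: z_def poly_fun_def)
  qed
  then have "V 0 x y = (\<integral>x. ((cmod (poly_fun f x))\<^sup>2 + \<epsilon>) powr (p / 2) \<partial>std_normal_distribution)" for x y
    unfolding \<phi>_def g_def Re by simp
  then have 2: "\<Phi> 0 = (\<integral>x. ((cmod (poly_fun f x))\<^sup>2 + \<epsilon>) powr (p / 2) \<partial>std_normal_distribution) powr (q / p)"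
    unfolding \<Phi>_def by (simp add: N)
  show ?thesis using \<Phi>_antimono unfolding 1 2 .
qed

text \<open>On the left the regularization is dropped by monotonicity, so only the right side needs
  a limit; there the integrand for \<epsilon> = 1 dominates.\<close>

lemma gaussian_hypercontractivity:
  assumes "1 \<le> p" "p \<le> q"
    and cond: "cmod (complex_of_real (p - 2) - \<omega> ^ 2 * complex_of_real (q - 2)) \<le> p - cmod \<omega> ^ 2 * q"
  shows "Lp_norm q std_normal_distribution (poly_fun (T_op \<omega> f)) \<le> Lp_norm p std_normal_distribution (poly_fun f)"
proof -
  define e where "e n = inverse (real (Suc n))" for n
  have e: "e n > 0" "e n \<le> 1" for n by (auto simp: e_def inverse_le_1_iff)
  let ?I = "\<integral>x. cmod (poly_fun (T_op \<omega> f) x) powr q \<partial>std_normal_distribution"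
  let ?J = "\<integral>x. cmod (poly_fun f x) powr p \<partial>std_normal_distribution"
  have I: "?I \<ge> 0" and J: "?J \<ge> 0" by (auto intro!: Bochner_Integration.integral_nonneg)
  let ?R = "\<lambda>n x. ((cmod (poly_fun f x))\<^sup>2 + e n) powr (p / 2)"
  have le: "?I \<le> (\<integral>x. ?R n x \<partial>std_normal_distribution) powr (q / p)" for n
  proof (rule order_trans[OF _ regularized_hypercontractivity[OF assms(1,2) e(1) cond]])
    show "?I \<le> (\<integral>x. ((cmod (poly_fun (T_op \<omega> f) x))\<^sup>2 + e n) powr (q / 2) \<partial>std_normal_distribution)"
      using powr_le_regularized[of "e n" q] e[of n] assms
      by (intro Bochner_Integration.integral_mono integrable_poly_fun_powr integrable_regularized) auto
  qed
  have lim: "(\<lambda>n. ?R n x) \<longlonglongrightarrow> cmod (poly_fun f x) powr p" for x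
  proof -
    have "e \<longlonglongrightarrow> 0" unfolding e_def[abs_def] by (rule LIMSEQ_inverse_real_of_nat)
    then have "(\<lambda>n. (cmod (poly_fun f x))\<^sup>2 + e n) \<longlonglongrightarrow> (cmod (poly_fun f x))\<^sup>2 + 0"
      by (intro tendsto_intros)
    then have "(\<lambda>n. ?R n x) \<longlonglongrightarrow> ((cmod (poly_fun f x))\<^sup>2 + 0) powr (p / 2)"
      using assms(1) e(1) by (intro tendsto_powr') (auto simp: add_nonneg_nonneg less_imp_le)
    moreover have "((cmod (poly_fun f x))\<^sup>2 + 0) powr (p / 2) = cmod (poly_fun f x) powr p"
      by (simp add: power2_powr_half)
    ultimately show ?thesis by simp
  qed
  have "(\<lambda>n. \<integral>x. ?R n x \<partial>std_normal_distribution) \<longlonglongrightarrow> ?J"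
  proof (rule integral_dominated_convergence[where w="\<lambda>x. ((cmod (poly_fun f x))\<^sup>2 + 1) powr (p / 2)"])
    show "AE x in std_normal_distribution. norm (?R n x) \<le> ((cmod (poly_fun f x))\<^sup>2 + 1) powr (p / 2)" for n
      using e[of n] assms(1) by (intro AE_I2) (auto intro!: powr_mono2)
  qed (use lim integrable_regularized[of 1 f "p / 2"] in auto)
  then have "(\<lambda>n. (\<integral>x. ?R n x \<partial>std_normal_distribution) powr (q / p)) \<longlonglongrightarrow> ?J powr (q / p)"
    using assms by (intro tendsto_powr') (auto intro!: always_eventually Bochner_Integration.integral_nonneg)
  then have "?I \<le> ?J powr (q / p)"
    using le by (intro LIMSEQ_le_const) auto
  then have "?I powr (1 / q) \<le> (?J powr (q / p)) powr (1 / q)"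
    using I assms by (intro powr_mono2) auto
  then show ?thesis
    unfolding Lp_norm_def using assms by (simp add: powr_powr)
qed

section \<open>Second-order expansion of norms\<close>

text \<open>The quotient by s^2 extends continuously to s = 0 and is therefore bounded on a compact
  interval. The interval is the range of |1 + w|^2 - 1 for |w| \<le> 1/2.\<close>

lemma powr_second_order_bound:
  fixes \<kappa> :: real
  obtains C where "C \<ge> 0" "\<And>s. -3/4 \<le> s \<Longrightarrow> s \<le> 5/4 \<Longrightarrow> \<bar>(1 + s) powr \<kappa> - 1 - \<kappa> * s\<bar> \<le> C * s\<^sup>2"
proof -
  define h where "h s = (if s = 0 then \<kappa> * (\<kappa> - 1) / 2 else ((1 + s) powr \<kappa> - 1 - \<kappa> * s) / s\<^sup>2)" for s :: real
  have "((\<lambda>s::real. ((1 + s) powr \<kappa> - 1 - \<kappa> * s) / s\<^sup>2) \<longlongrightarrow> \<kappa> * (\<kappa> - 1) / 2) (at 0)"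
    by real_asymp
  moreover have "\<forall>\<^sub>F s in at 0. ((1 + s) powr \<kappa> - 1 - \<kappa> * s) / s\<^sup>2 = h s"
    by (auto simp: h_def eventually_at_filter)
  ultimately have "(h \<longlongrightarrow> h 0) (at 0)"
    by (auto simp: h_def elim: Lim_transform_eventually)
  then have c0: "isCont h 0" by (simp add: isCont_def)
  have c1: "isCont h s" if "s \<noteq> 0" "-1 < s" for s
  proof -
    have "isCont (\<lambda>s. ((1 + s) powr \<kappa> - 1 - \<kappa> * s) / s\<^sup>2) s"
      using that by (intro continuous_intros) auto
    moreover have "\<forall>\<^sub>F x in nhds s. h x = ((1 + x) powr \<kappa> - 1 - \<kappa> * x) / x\<^sup>2"
      using t1_space_nhds[OF that(1)] by eventually_elim (simp add: h_def)
    ultimately show ?thesis by (simp add: isCont_cong)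
  qed
  have "continuous_on {-3/4..5/4} h"
  proof (rule continuous_at_imp_continuous_on, rule ballI)
    fix s :: real assume "s \<in> {-3/4..5/4}"
    then have "-1 < s" by simp
    then show "isCont h s" using c0 c1[of s] by (cases "s = 0") simp_all
  qed
  then have "bounded (h ` {-3/4..5/4})"
    by (intro compact_imp_bounded compact_continuous_image) auto
  then obtain C where "\<forall>v\<in>h ` {-3/4..5/4}. norm v \<le> C" unfolding bounded_iff ..
  then have C: "\<And>s. s \<in> {-3/4..5/4} \<Longrightarrow> \<bar>h s\<bar> \<le> C" by simp
  have "\<bar>(1 + s) powr \<kappa> - 1 - \<kappa> * s\<bar> \<le> C * s\<^sup>2" if "-3/4 \<le> s" "s \<le> 5/4" for s
    using C[of s] that by (cases "s = 0") (auto simp: h_def abs_divide divide_le_eq)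
  moreover have "C \<ge> 0" using C[of 0] abs_ge_zero order_trans by fastforce
  ultimately show ?thesis using that by blast
qed

text \<open>Valid for all w, not only small ones, because it has to dominate integrands on the whole
  line. Near 0 it is a Taylor estimate in s = |1 + w|^2 - 1; away from 0 the inequality 1 \<le> 4
  |w|^2 absorbs the terms of lower order.\<close>

lemma cmod_powr_second_order_bound:
  fixes r :: real
  assumes r: "0 < r"
  obtains C where "\<And>w. \<bar>cmod (1 + w) powr r - 1 - r * Re w\<bar> \<le> C * ((cmod w)\<^sup>2 * (1 + cmod w ^ nat \<lceil>r\<rceil>))"
proof -
  define n where "n = nat \<lceil>r\<rceil>"
  have rn: "r \<le> real n" unfolding n_def by linarith
  obtain C where C: "C \<ge> 0" "\<And>s. -3/4 \<le> s \<Longrightarrow> s \<le> 5/4 \<Longrightarrow> \<bar>(1 + s) powr (r/2) - 1 - (r/2) * s\<bar> \<le> C * s\<^sup>2"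
    using powr_second_order_bound[of "r/2"] by metis
  \<comment> \<open>The first constant belongs to |w| \<ge> 1/2, where 1 + |w| \<le> 3 |w|; the
    second to |w| < 1/2, where |s| \<le> 5/2 |w|.\<close>
  define D where "D = max (4 * 3 ^ n + 4 + 2 * r) (C * (25/4) + r / 2)"
  have D: "D \<ge> 0" using r unfolding D_def by (simp add: le_max_iff_disj)
  have "\<bar>cmod (1 + w) powr r - 1 - r * Re w\<bar> \<le> D * ((cmod w)\<^sup>2 * (1 + cmod w ^ n))" for w
  proof (cases "cmod w \<ge> 1 / 2")
    case True
    let ?m = "cmod w"
    have t: "cmod (1 + w) \<le> 1 + ?m" using norm_triangle_ineq[of 1 w] by simp
    have "cmod (1 + w) powr r \<le> (1 + ?m) powr r" using t r by (intro powr_mono2) auto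
    also have "\<dots> \<le> (1 + ?m) powr real n" using rn by (intro powr_mono) auto
    also have "\<dots> = (1 + ?m) ^ n" by (rule powr_realpow) (simp add: add_pos_nonneg)
    also have "\<dots> \<le> (3 * ?m) ^ n" using True by (intro power_mono) auto
    finally have 1: "cmod (1 + w) powr r \<le> 3 ^ n * ?m ^ n" by (simp add: power_mult_distrib)
    have 2: "1 \<le> 4 * ?m\<^sup>2" using power_mono[OF True, of 2] by (simp add: power2_eq_square)
    have 3: "?m \<le> 2 * ?m\<^sup>2" using mult_right_mono[OF True, of ?m] by (simp add: power2_eq_square)
    have "3 ^ n * ?m ^ n * 1 \<le> 3 ^ n * ?m ^ n * (4 * ?m\<^sup>2)" using 2 by (intro mult_left_mono) auto
    moreover have "r * \<bar>Re w\<bar> \<le> r * (2 * ?m\<^sup>2)" using 3 abs_Re_le_cmod[of w] r by (intro mult_left_mono) auto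
    moreover have "\<bar>cmod (1 + w) powr r - 1 - r * Re w\<bar> \<le> cmod (1 + w) powr r + 1 + r * \<bar>Re w\<bar>"
      using r powr_ge_zero[of "cmod (1 + w)" r] abs_mult[of r "Re w"] by linarith
    ultimately have "\<bar>cmod (1 + w) powr r - 1 - r * Re w\<bar> \<le> 3 ^ n * ?m ^ n * (4 * ?m\<^sup>2) + 4 * ?m\<^sup>2 + r * (2 * ?m\<^sup>2)"
      using 1 2 by linarith
    also have "\<dots> \<le> (4 * 3 ^ n + 4 + 2 * r) * (?m\<^sup>2 * (1 + ?m ^ n))"
    proof -
      have "(4 * 3 ^ n + 4 + 2 * r) * (?m\<^sup>2 * (1 + ?m ^ n)) - (3 ^ n * ?m ^ n * (4 * ?m\<^sup>2) + 4 * ?m\<^sup>2 + r * (2 * ?m\<^sup>2))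
        = 4 * 3 ^ n * ?m\<^sup>2 + (4 + 2 * r) * (?m\<^sup>2 * ?m ^ n)" by (simp add: algebra_simps)
      also have "\<dots> \<ge> 0" using r by simp
      finally show ?thesis by simp
    qed
    also have "\<dots> \<le> D * (?m\<^sup>2 * (1 + ?m ^ n))" unfolding D_def by (intro mult_right_mono) auto
    finally show ?thesis .
  next
    case False
    let ?m = "cmod w"
    define s where "s = 2 * Re w + ?m\<^sup>2"
    have sq: "(cmod (1 + w))\<^sup>2 = 1 + s"
      using cmod_power2[of "1 + w"] cmod_power2[of w] by (simp add: s_def power2_eq_square algebra_simps)
    have m: "?m \<le> 1 / 2" "0 \<le> ?m" using False by auto
    have ss: "\<bar>s\<bar> \<le> 5/2 * ?m"
    proof -
      have "?m\<^sup>2 \<le> 1/2 * ?m" unfolding power2_eq_square using m by (intro mult_right_mono) auto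
      then show ?thesis
        using abs_Re_le_cmod[of w] abs_triangle_ineq[of "2 * Re w" "?m\<^sup>2"] unfolding s_def by (simp add: abs_mult)
    qed
    have s2: "s \<le> 5/4" using ss m by linarith
    have "(1 - ?m)\<^sup>2 \<le> (cmod (1 + w))\<^sup>2"
      using norm_triangle_ineq2[of 1 "- w"] m by (intro power_mono) auto
    moreover have "(1/2)\<^sup>2 \<le> (1 - ?m)\<^sup>2" using m by (intro power_mono) auto
    ultimately have s1: "-3/4 \<le> s" using sq by (simp add: power2_eq_square)
    have e: "cmod (1 + w) powr r = (1 + s) powr (r/2)" unfolding sq[symmetric] by (simp add: power2_powr_half)
    have "\<bar>cmod (1 + w) powr r - 1 - r * Re w\<bar> = \<bar>((1 + s) powr (r/2) - 1 - (r/2) * s) + (r/2) * ?m\<^sup>2\<bar>"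
      unfolding e s_def by (simp add: algebra_simps)
    also have "\<dots> \<le> C * s\<^sup>2 + (r/2) * ?m\<^sup>2"
      using C(2)[OF s1 s2] r by (intro order_trans[OF abs_triangle_ineq]) (simp add: abs_mult)
    also have "\<dots> \<le> C * (25/4 * ?m\<^sup>2) + (r/2) * ?m\<^sup>2"
    proof -
      have "\<bar>s\<bar>\<^sup>2 \<le> (5/2 * ?m)\<^sup>2" using ss by (intro power_mono) auto
      then show ?thesis using C(1) by (intro add_right_mono mult_left_mono) (auto simp: power2_eq_square)
    qed
    also have "\<dots> = (C * (25/4) + r / 2) * (?m\<^sup>2 * 1)" by (simp add: algebra_simps)
    also have "\<dots> \<le> D * (?m\<^sup>2 * (1 + ?m ^ n))"
      unfolding D_def[symmetric] using D by (intro mult_mono) (auto simp: D_def)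
    finally show ?thesis .
  qed
  then show ?thesis using that unfolding n_def by blast
qed

section \<open>Standardized measures and affine test functions\<close>

lemma standardized_integrable_power: "standardized \<alpha> \<Longrightarrow> integrable \<alpha> (\<lambda>x. x ^ n)"
  unfolding standardized_def by blast

lemma standardized_prob_space: "standardized \<alpha> \<Longrightarrow> prob_space \<alpha>"
  unfolding standardized_def real_distribution_def by blast

lemma standardized_sets: "standardized \<alpha> \<Longrightarrow> sets \<alpha> = sets borel"
  unfolding standardized_def by (simp add: real_distribution.events_eq_borel)

lemma standardized_moments:
  assumes "standardized \<alpha>"
  shows "(\<integral>x. x \<partial>\<alpha>) = 0" "(\<integral>x. x\<^sup>2 \<partial>\<alpha>) = 1" "(\<integral>x. c \<partial>\<alpha>) = (c :: 'a::{banach, second_countable_topology})"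
proof -
  interpret prob_space \<alpha> by (rule standardized_prob_space[OF assms])
  show 0: "(\<integral>x. x \<partial>\<alpha>) = 0" using assms unfolding standardized_def by blast
  have "variance (\<lambda>x. x) = 1" using assms unfolding standardized_def by blast
  then show "(\<integral>x. x\<^sup>2 \<partial>\<alpha>) = 1" unfolding 0 by simp
  show "(\<integral>x. c \<partial>\<alpha>) = c" by (simp add: prob_space)
qed

lemma standardized_std_normal: "standardized std_normal_distribution"
proof -
  have 0: "(\<integral>x. x \<partial>std_normal_distribution) = 0"
    using integral_std_normal_distribution_moment_odd[of 1] by simp
  have "(\<integral>x. x\<^sup>2 \<partial>std_normal_distribution) = 1"
    using std_normal_distribution_even_moments(1)[of 1] by (simp add: fact_numeral)
  with 0 show ?thesis
    unfolding standardized_def 0 using real_dist_normal_dist integrable_std_normal_distribution_moment by simp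
qed

text \<open>The linear term is subtracted before dividing by e^2; it integrates to 0 since the mean
  is 0. The rest converges to L x^2 under a dominating function, and the unit variance turns this
  into L.\<close>

lemma affine_moment_expansion:
  fixes a :: complex
  assumes st: "standardized \<alpha>" and r: "0 < r" and e: "e \<longlonglongrightarrow> 0" "\<And>n. 0 < e n" "\<And>n. e n \<le> 1"
  shows "(\<lambda>n. ((\<integral>x. cmod (1 + of_real (e n) * a * of_real x) powr r \<partial>\<alpha>) - 1) / (e n)\<^sup>2)
    \<longlonglongrightarrow> r / 2 * ((cmod a)\<^sup>2 + (r - 2) * (Re a)\<^sup>2)"
proof -
  interpret prob_space \<alpha> by (rule standardized_prob_space[OF st])
  note [measurable_cong] = standardized_sets[OF st]
  note ip = standardized_integrable_power[OF st]
  let ?N = "nat \<lceil>r\<rceil>"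
  obtain C where C: "\<And>w. \<bar>cmod (1 + w) powr r - 1 - r * Re w\<bar> \<le> C * ((cmod w)\<^sup>2 * (1 + cmod w ^ ?N))"
    using cmod_powr_second_order_bound[OF r] by metis
  have C0: "0 \<le> C" using order_trans[OF abs_ge_zero C[of 1]] by (simp add: zero_le_mult_iff)
  define L where "L = r / 2 * ((cmod a)\<^sup>2 + (r - 2) * (Re a)\<^sup>2)"
  define D where "D n x = (cmod (1 + of_real (e n) * a * of_real x) powr r - 1 - r * (e n * Re a * x)) / (e n)\<^sup>2" for n x
  define B where "B x = C * ((cmod a)\<^sup>2 * x\<^sup>2 + cmod a ^ (2 + ?N) * \<bar>x\<bar> ^ (2 + ?N))" for x :: real
  have ia: "integrable \<alpha> (\<lambda>x. \<bar>x\<bar> ^ k)" for k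
    using integrable_abs[OF ip[of k]] by (simp add: power_abs)
  have iB: "integrable \<alpha> B" unfolding B_def[abs_def]
    by (intro Bochner_Integration.integrable_mult_right Bochner_Integration.integrable_add ip ia)
  have bD: "\<bar>D n x\<bar> \<le> B x" for n x
  proof -
    let ?w = "of_real (e n) * a * of_real x"
    have cw: "cmod ?w = e n * (cmod a * \<bar>x\<bar>)" using e(2)[of n] by (simp add: norm_mult)
    have "\<bar>D n x\<bar> * (e n)\<^sup>2 = \<bar>cmod (1 + ?w) powr r - 1 - r * Re ?w\<bar>"
      unfolding D_def using e(2)[of n] by (simp add: abs_divide)
    also have "\<dots> \<le> C * ((cmod ?w)\<^sup>2 * (1 + cmod ?w ^ ?N))" by (rule C)
    also have "\<dots> \<le> C * ((cmod ?w)\<^sup>2 * (1 + (cmod a * \<bar>x\<bar>) ^ ?N))"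
      unfolding cw using C0 e(2,3)[of n]
      by (intro mult_left_mono add_left_mono power_mono mult_left_le_one_le) auto
    also have "\<dots> = B x * (e n)\<^sup>2"
      unfolding cw B_def by (simp add: power_mult_distrib power_add algebra_simps power2_eq_square)
    finally show ?thesis using e(2)[of n] by simp
  qed
  have lim: "(\<lambda>n. D n x) \<longlonglongrightarrow> L * x\<^sup>2" for x
  proof -
    \<comment> \<open>The squared modulus of 1 + e a x is the real polynomial 1 + b e + c e^2 in e,
      which makes the limit an expansion in one real variable.\<close>
    define b c where "b = 2 * Re a * x" and "c = (cmod a)\<^sup>2 * x\<^sup>2"
    have "((\<lambda>t::real. ((1 + b * t + c * t\<^sup>2) powr (r/2) - 1 - (r/2) * b * t) / t\<^sup>2) \<longlongrightarrow>
       b * (b * ((r/2 - 1) * (r/2))) / 2 + c * (r/2)) (at_right 0)"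
      by real_asymp
    moreover have "filterlim e (at_right 0) sequentially"
      unfolding filterlim_at using e(1,2) by (auto intro!: always_eventually simp: less_imp_neq[THEN not_sym])
    ultimately have "(\<lambda>n. ((1 + b * e n + c * (e n)\<^sup>2) powr (r/2) - 1 - (r/2) * b * e n) / (e n)\<^sup>2)
      \<longlonglongrightarrow> b * (b * ((r/2 - 1) * (r/2))) / 2 + c * (r/2)" by (rule filterlim_compose)
    moreover have "((1 + b * e n + c * (e n)\<^sup>2) powr (r/2) - 1 - (r/2) * b * e n) / (e n)\<^sup>2 = D n x" for n
    proof -
      have "1 + b * e n + c * (e n)\<^sup>2 = (cmod (1 + of_real (e n) * a * of_real x))\<^sup>2"
        unfolding b_def c_def cmod_power2 by (simp add: power2_eq_square algebra_simps)
      then show ?thesis unfolding D_def by (simp add: power2_powr_half b_def mult_ac)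
    qed
    moreover have "b * (b * ((r/2 - 1) * (r/2))) / 2 + c * (r/2) = L * x\<^sup>2"
      unfolding b_def c_def L_def by (simp add: power2_eq_square field_simps)
    ultimately show ?thesis by simp
  qed
  have [measurable]: "D n \<in> borel_measurable \<alpha>" for n unfolding D_def[abs_def] by measurable
  have "(\<lambda>n. \<integral>x. D n x \<partial>\<alpha>) \<longlonglongrightarrow> (\<integral>x. L * x\<^sup>2 \<partial>\<alpha>)"
    by (rule integral_dominated_convergence[where w=B]) (use iB bD lim in auto)
  also have "(\<integral>x. L * x\<^sup>2 \<partial>\<alpha>) = L" using standardized_moments(2)[OF st] by simp
  finally have 1: "(\<lambda>n. \<integral>x. D n x \<partial>\<alpha>) \<longlonglongrightarrow> L" .
  have "(\<integral>x. D n x \<partial>\<alpha>) = ((\<integral>x. cmod (1 + of_real (e n) * a * of_real x) powr r \<partial>\<alpha>) - 1) / (e n)\<^sup>2" for n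
  proof -
    have iD: "integrable \<alpha> (D n)"
      by (rule Bochner_Integration.integrable_bound[OF iB]) (use bD in \<open>auto intro!: order_trans[OF _ abs_ge_self]\<close>)
    have ix: "integrable \<alpha> (\<lambda>x. x)" using ip[of 1] by simp
    have "(\<lambda>x. cmod (1 + of_real (e n) * a * of_real x) powr r) = (\<lambda>x. D n x * (e n)\<^sup>2 + 1 + r * e n * Re a * x)"
      unfolding D_def using e(2)[of n] by (auto simp: fun_eq_iff less_imp_neq[symmetric])
    then have "(\<integral>x. cmod (1 + of_real (e n) * a * of_real x) powr r \<partial>\<alpha>) = (\<integral>x. D n x \<partial>\<alpha>) * (e n)\<^sup>2 + 1"
      using iD ix standardized_moments(1)[OF st] standardized_moments(3)[OF st, of "1::real"] by simp
    then show ?thesis using e(2)[of n] by simp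
  qed
  with 1 show ?thesis unfolding L_def by simp
qed

text \<open>The moment is 1 + y with y of order e^2. Hence (1 + y)^(1/r) = 1 + y / r up to an error
  of order e^4, and the factor r of the moment expansion cancels.\<close>

lemma Lp_norm_affine_expansion:
  fixes a :: complex
  assumes st: "standardized \<alpha>" and r: "0 < r" and e: "e \<longlonglongrightarrow> 0" "\<And>n. 0 < e n" "\<And>n. e n \<le> 1"
  shows "(\<lambda>n. (Lp_norm r \<alpha> (\<lambda>x. 1 + of_real (e n) * a * of_real x) - 1) / (e n)\<^sup>2)
    \<longlonglongrightarrow> ((cmod a)\<^sup>2 + (r - 2) * (Re a)\<^sup>2) / 2"
proof -
  let ?L = "(cmod a)\<^sup>2 + (r - 2) * (Re a)\<^sup>2"
  define y where "y n = (\<integral>x. cmod (1 + of_real (e n) * a * of_real x) powr r \<partial>\<alpha>) - 1" for n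
  have y: "(\<lambda>n. y n / (e n)\<^sup>2) \<longlonglongrightarrow> r / 2 * ?L"
    unfolding y_def by (rule affine_moment_expansion[OF assms])
  have y2: "(\<lambda>n. y n / (e n)\<^sup>2 * (e n)\<^sup>2) \<longlonglongrightarrow> r / 2 * ?L * 0\<^sup>2"
    by (intro tendsto_intros y e)
  then have y0: "y \<longlonglongrightarrow> 0" using e(2) by (simp add: less_imp_neq[symmetric])
  obtain C where C: "C \<ge> 0" "\<And>s. -3/4 \<le> s \<Longrightarrow> s \<le> 5/4 \<Longrightarrow> \<bar>(1 + s) powr (1/r) - 1 - (1/r) * s\<bar> \<le> C * s\<^sup>2"
    using powr_second_order_bound[of "1/r"] by metis
  have "\<forall>\<^sub>F n in sequentially. \<bar>y n\<bar> < 3/4"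
    using tendsto_rabs[OF y0] by (intro order_tendstoD(2)[where y="\<bar>0\<bar>"]) auto
  then have ev: "\<forall>\<^sub>F n in sequentially. norm (((1 + y n) powr (1/r) - 1 - (1/r) * y n) / (e n)\<^sup>2) \<le> C * (y n / (e n)\<^sup>2 * y n)"
  proof (rule eventually_mono)
    fix n assume "\<bar>y n\<bar> < 3/4"
    then have "\<bar>(1 + y n) powr (1/r) - 1 - (1/r) * y n\<bar> \<le> C * (y n)\<^sup>2" by (intro C(2)) auto
    then show "norm (((1 + y n) powr (1/r) - 1 - (1/r) * y n) / (e n)\<^sup>2) \<le> C * (y n / (e n)\<^sup>2 * y n)"
      using e(2)[of n] by (simp add: divide_simps power2_eq_square)
  qed
  have "(\<lambda>n. C * (y n / (e n)\<^sup>2 * y n)) \<longlonglongrightarrow> C * (r / 2 * ?L * 0)"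
    by (intro tendsto_intros y y0)
  then have "(\<lambda>n. C * (y n / (e n)\<^sup>2 * y n)) \<longlonglongrightarrow> 0" by simp
  from Lim_null_comparison[OF ev this]
  have "(\<lambda>n. ((1 + y n) powr (1/r) - 1 - (1/r) * y n) / (e n)\<^sup>2) \<longlonglongrightarrow> 0" .
  from tendsto_add[OF this tendsto_mult_left[OF y, of "1/r"]]
  have "(\<lambda>n. ((1 + y n) powr (1/r) - 1) / (e n)\<^sup>2) \<longlonglongrightarrow> 1/r * (r / 2 * ?L)"
    by (simp add: diff_divide_distrib)
  then show ?thesis unfolding Lp_norm_def y_def using r by simp
qed

lemma contractive_on_affine_imp_condition:
  assumes st: "standardized \<alpha>" and pq: "1 \<le> p" "p \<le> q"
    and le: "\<And>a. Lp_norm q \<alpha> (\<lambda>x. 1 + \<omega> * a * of_real x) \<le> Lp_norm p \<alpha> (\<lambda>x. 1 + a * of_real x)"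
  shows "cmod (complex_of_real (p - 2) - \<omega> ^ 2 * complex_of_real (q - 2)) \<le> p - cmod \<omega> ^ 2 * q"
  unfolding complex_hypercontractivity_condition_iff
proof
  fix a :: complex
  define e where "e n = inverse (real (Suc n))" for n
  have e: "e \<longlonglongrightarrow> 0" "\<And>n. 0 < e n" "\<And>n. e n \<le> 1"
    using LIMSEQ_inverse_real_of_nat by (simp_all add: e_def[abs_def] inverse_le_1_iff)
  have "((cmod (\<omega> * a))\<^sup>2 + (q - 2) * (Re (\<omega> * a))\<^sup>2) / 2 \<le> ((cmod a)\<^sup>2 + (p - 2) * (Re a)\<^sup>2) / 2"
  proof (rule LIMSEQ_le[OF Lp_norm_affine_expansion[OF st _ e] Lp_norm_affine_expansion[OF st _ e]])
    have "(Lp_norm q \<alpha> (\<lambda>x. 1 + of_real (e n) * (\<omega> * a) * of_real x) - 1) / (e n)\<^sup>2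
        \<le> (Lp_norm p \<alpha> (\<lambda>x. 1 + of_real (e n) * a * of_real x) - 1) / (e n)\<^sup>2" for n
      using le[of "of_real (e n) * a"] by (intro divide_right_mono diff_right_mono) (simp_all add: mult_ac)
    then show "\<exists>N. \<forall>n\<ge>N. (Lp_norm q \<alpha> (\<lambda>x. 1 + of_real (e n) * (\<omega> * a) * of_real x) - 1) / (e n)\<^sup>2
        \<le> (Lp_norm p \<alpha> (\<lambda>x. 1 + of_real (e n) * a * of_real x) - 1) / (e n)\<^sup>2" by blast
  qed (use pq in auto)
  then show "(q - 2) * (Re (\<omega> * a))\<^sup>2 + (cmod (\<omega> * a))\<^sup>2 \<le> (cmod a)\<^sup>2 + (p - 2) * (Re a)\<^sup>2" by simp
qed

section \<open>The limit theorem\<close>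

text \<open>The increments of N^\<kappa> are asymptotic to \<kappa> N^(\<kappa>-1), which is where 1
  / \<kappa> comes from. As \<open>b\<close> is complex, the usual squeezing by order is replaced by
  telescoping norms.\<close>

lemma stolz_cesaro_powr:
  fixes b :: "nat \<Rightarrow> complex"
  assumes k: "\<kappa> > 0"
    and lim: "(\<lambda>N. (b (Suc N) - b N) / of_real (real N powr (\<kappa> - 1))) \<longlonglongrightarrow> c"
  shows "(\<lambda>N. b N / of_real (real N powr \<kappa>)) \<longlonglongrightarrow> c / of_real \<kappa>"
proof -
  define w where "w N = real (Suc N) powr \<kappa> - real N powr \<kappa>" for N
  have w0: "w N > 0" for N unfolding w_def using k by (simp add: powr_less_mono2)
  define l where "l = c / of_real \<kappa>"
  have "(\<lambda>N. real N powr (\<kappa> - 1) / (real (Suc N) powr \<kappa> - real N powr \<kappa>)) \<longlonglongrightarrow> inverse \<kappa>"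
    using k by real_asymp
  then have "(\<lambda>N. (b (Suc N) - b N) / of_real (real N powr (\<kappa> - 1)) * of_real (real N powr (\<kappa> - 1) / w N)) \<longlonglongrightarrow> c * of_real (inverse \<kappa>)"
    unfolding w_def by (intro tendsto_mult lim tendsto_of_real)
  moreover have "\<forall>\<^sub>F N in sequentially. (b (Suc N) - b N) / of_real (real N powr (\<kappa> - 1)) * of_real (real N powr (\<kappa> - 1) / w N)
     = (b (Suc N) - b N) / of_real (w N)"
    using eventually_gt_at_top[of "0::nat"] by eventually_elim simp
  ultimately have el: "(\<lambda>N. (b (Suc N) - b N) / of_real (w N)) \<longlonglongrightarrow> l"
    unfolding l_def by (auto intro: Lim_transform_eventually simp: divide_inverse)
  \<comment> \<open>Without the expected main term the increments are at most e/2 times those of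
    N^\<kappa>, so their sum is at most e/2 N^\<kappa> plus a constant.\<close>
  define D where "D N = b N - l * of_real (real N powr \<kappa>)" for N
  have D: "D (Suc N) - D N = (b (Suc N) - b N) - l * of_real (w N)" for N
    unfolding D_def w_def by (simp add: algebra_simps)
  show ?thesis
  proof (fold l_def, rule LIMSEQ_I)
    fix e :: real assume e: "0 < e"
    obtain N0 where N0: "\<And>N. N \<ge> N0 \<Longrightarrow> cmod ((b (Suc N) - b N) / of_real (w N) - l) < e / 2"
      using LIMSEQ_D[OF el, of "e / 2"] e by auto
    have step: "cmod (D (Suc N) - D N) \<le> e / 2 * w N" if "N \<ge> N0" for N
    proof -
      have "D (Suc N) - D N = ((b (Suc N) - b N) / of_real (w N) - l) * of_real (w N)"
        unfolding D using w0[of N] by (simp add: field_simps)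
      then show ?thesis using N0[OF that] w0[of N] by (simp add: norm_mult less_imp_le)
    qed
    have DN: "cmod (D N) \<le> cmod (D N0) + e / 2 * (real N powr \<kappa> - real N0 powr \<kappa>)" if "N \<ge> N0" for N
      using that
    proof (induction N rule: dec_induct)
      case (step N)
      have "cmod (D (Suc N)) \<le> cmod (D N) + cmod (D (Suc N) - D N)"
        using norm_triangle_ineq[of "D N" "D (Suc N) - D N"] by simp
      also have "\<dots> \<le> cmod (D N0) + e / 2 * (real N powr \<kappa> - real N0 powr \<kappa>) + e / 2 * w N"
        using step.IH \<open>\<And>N. N \<ge> N0 \<Longrightarrow> cmod (D (Suc N) - D N) \<le> e / 2 * w N\<close>[OF step.hyps(1)] by linarith
      finally show ?case unfolding w_def by (simp add: algebra_simps)
    qed simp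
    have "(\<lambda>N. cmod (D N0) / real N powr \<kappa>) \<longlonglongrightarrow> 0" using k by real_asymp
    then obtain N1 where N1: "\<And>N. N \<ge> N1 \<Longrightarrow> cmod (D N0) / real N powr \<kappa> < e / 2"
      using LIMSEQ_D[of _ 0 "e / 2"] e by force
    have "cmod (b N / of_real (real N powr \<kappa>) - l) < e" if N: "N \<ge> max 1 (max N0 N1)" for N
    proof -
      have p: "real N powr \<kappa> > 0" using N by simp
      have "b N / of_real (real N powr \<kappa>) - l = D N / of_real (real N powr \<kappa>)"
        unfolding D_def using p by (simp add: field_simps)
      then have "cmod (b N / of_real (real N powr \<kappa>) - l) = cmod (D N) / real N powr \<kappa>"
        using p by (simp add: norm_divide)
      also have "\<dots> \<le> (cmod (D N0) + e / 2 * real N powr \<kappa>) / real N powr \<kappa>"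
      proof (rule divide_right_mono)
        have "e / 2 * real N0 powr \<kappa> \<ge> 0" using e by simp
        then show "cmod (D N) \<le> cmod (D N0) + e / 2 * real N powr \<kappa>"
          using DN[of N] N by (simp add: algebra_simps)
      qed (use p in simp)
      also have "\<dots> = cmod (D N0) / real N powr \<kappa> + e / 2" using p by (simp add: field_simps)
      also have "\<dots> < e"
      proof -
        have "N1 \<le> N" using N by simp
        from N1[OF this] show ?thesis by linarith
      qed
      finally show ?thesis .
    qed
    then show "\<exists>no. \<forall>n\<ge>no. norm (b n / of_real (real n powr \<kappa>) - l) < e" by blast
  qed
qed

text \<open>Evaluates \<open>x\<^sub>0\<^bsup>j\<^sub>0\<^esup> x\<^sub>1\<^bsup>j\<^sub>1\<^esup> \<cdots>\<close> as \<open>c 0 j\<^sub>0 * c 1 j\<^sub>1 * \<cdots>\<close>; ordinary evaluation is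
  \<open>c i j = x\<^sub>i\<^sup>j\<close>, and the operator \<open>K_N\<close> is \<open>c i j = K(p\<^sub>j)(x\<^sub>i)\<close> up to scaling.\<close>

definition umbral :: "nat \<Rightarrow> (nat \<Rightarrow> nat \<Rightarrow> complex) \<Rightarrow> mpoly \<Rightarrow> complex" where
  "umbral N c F = (\<Sum>m\<in>Poly_Mapping.keys F. Poly_Mapping.lookup F m * (\<Prod>i<N. c i (Poly_Mapping.lookup m i)))"

lemma umbral_add: "umbral N c (F + G) = umbral N c F + umbral N c G"
  unfolding umbral_def by (rule setsum_keys_plus_distrib) (auto simp: algebra_simps)

lemma umbral_zero [simp]: "umbral N c 0 = 0" by (simp add: umbral_def)

lemma umbral_single:
  "umbral N c (Poly_Mapping.single m a) = a * (\<Prod>i<N. c i (Poly_Mapping.lookup m i))"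
  by (simp add: umbral_def)

lemma umbral_sum: "umbral N c (\<Sum>i\<in>I. F i) = (\<Sum>i\<in>I. umbral N c (F i))"
  by (induction I rule: infinite_finite_induct) (simp_all add: umbral_add)

lemma umbral_mconst: "umbral N c (mconst a * F) = a * umbral N c F"
  by (induction F rule: mpoly_induct) (simp_all add: mconst_def mult_single umbral_single distrib_left umbral_add)

lemma mvar_power: "mvar i ^ k = Poly_Mapping.single (Poly_Mapping.single i k) 1"
  by (induction k) (simp_all add: mvar_def mult_single flip: single_add)

text \<open>The value of \<open>umbral\<close> on the n-th power of the sum of the first M
  variables, with the last variable split off by the binomial theorem.\<close>

fun umbral_power :: "(nat \<Rightarrow> nat \<Rightarrow> complex) \<Rightarrow> nat \<Rightarrow> nat \<Rightarrow> complex" where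
  "umbral_power c 0 n = (if n = 0 then 1 else 0)"
| "umbral_power c (Suc M) n = (\<Sum>j\<le>n. of_nat (n choose j) * umbral_power c M (n - j) * c M j)"

text \<open>For general \<open>c\<close> the map \<open>umbral\<close> is not multiplicative; it
  only factors over separate variables. Hence the induction carries a monomial in variables outside
  the sum, and each step moves a power of the variable with index \<open>M\<close> into it.\<close>

lemma umbral_sum_power_single:
  assumes "M \<le> N" "\<And>i. i < M \<Longrightarrow> Poly_Mapping.lookup m i = 0"
  shows "umbral N c ((\<Sum>i<M. mvar i) ^ n * Poly_Mapping.single m a) =
    a * umbral_power c M n * (\<Prod>i\<in>{M..<N}. c i (Poly_Mapping.lookup m i))"
  using assms
proof (induction M arbitrary: n m a)
  case 0
  show ?case by (cases n) (simp_all add: umbral_single lessThan_atLeast0)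
next
  case (Suc M)
  let ?S = "\<Sum>i<M. mvar i"
  let ?P = "\<Prod>i\<in>{Suc M..<N}. c i (Poly_Mapping.lookup m i)"
  have t: "of_nat (n choose j) * mvar M ^ j * ?S ^ (n - j) * Poly_Mapping.single m a
     = ?S ^ (n - j) * Poly_Mapping.single (m + Poly_Mapping.single M j) (of_nat (n choose j) * a)" for j
  proof -
    have "of_nat (n choose j) * mvar M ^ j * ?S ^ (n - j) * Poly_Mapping.single m a
       = ?S ^ (n - j) * (Poly_Mapping.single 0 (of_nat (n choose j)) * Poly_Mapping.single (Poly_Mapping.single M j) 1 * Poly_Mapping.single m a)"
      by (simp only: mvar_power single_of_nat mult_ac)
    then show ?thesis by (simp only: mult_single add_0_left mult_1_right add.commute)
  qed
  have "(\<Sum>i<Suc M. mvar i) ^ n * Poly_Mapping.single m a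
      = (\<Sum>j\<le>n. of_nat (n choose j) * mvar M ^ j * ?S ^ (n - j)) * Poly_Mapping.single m a"
    by (simp add: binomial_ring add.commute[of _ "mvar M"])
  also have "\<dots> = (\<Sum>j\<le>n. ?S ^ (n - j) * Poly_Mapping.single (m + Poly_Mapping.single M j) (of_nat (n choose j) * a))"
    unfolding sum_distrib_right t ..
  finally have "umbral N c ((\<Sum>i<Suc M. mvar i) ^ n * Poly_Mapping.single m a) =
    (\<Sum>j\<le>n. umbral N c (?S ^ (n - j) * Poly_Mapping.single (m + Poly_Mapping.single M j) (of_nat (n choose j) * a)))"
    by (simp add: umbral_sum)
  also have "\<dots> = (\<Sum>j\<le>n. of_nat (n choose j) * a * umbral_power c M (n - j) * (c M j * ?P))"
  proof (rule sum.cong[OF refl])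
    fix j
    have "umbral N c (?S ^ (n - j) * Poly_Mapping.single (m + Poly_Mapping.single M j) (of_nat (n choose j) * a))
      = of_nat (n choose j) * a * umbral_power c M (n - j) *
        (\<Prod>i\<in>{M..<N}. c i (Poly_Mapping.lookup (m + Poly_Mapping.single M j) i))"
      using Suc.prems by (intro Suc.IH) (auto simp: lookup_add lookup_single when_def)
    also have "(\<Prod>i\<in>{M..<N}. c i (Poly_Mapping.lookup (m + Poly_Mapping.single M j) i)) = c M j * ?P"
    proof -
      have "{M..<N} = insert M {Suc M..<N}" using Suc.prems by auto
      moreover have "(\<Prod>i\<in>{Suc M..<N}. c i (Poly_Mapping.lookup (m + Poly_Mapping.single M j) i)) = ?P"
        by (rule prod.cong) (auto simp: lookup_add lookup_single when_def)
      ultimately show ?thesis using Suc.prems by (simp add: lookup_add)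
    qed
    finally show "umbral N c (?S ^ (n - j) * Poly_Mapping.single (m + Poly_Mapping.single M j) (of_nat (n choose j) * a))
      = of_nat (n choose j) * a * umbral_power c M (n - j) * (c M j * ?P)" .
  qed
  also have "\<dots> = a * umbral_power c (Suc M) n * ?P"
    unfolding umbral_power.simps sum_distrib_left sum_distrib_right by (simp add: mult_ac)
  finally show ?case .
qed

lemma umbral_sum_power: "umbral N c ((\<Sum>i<N. mvar i) ^ n) = umbral_power c N n"
  using umbral_sum_power_single[of N N 0 c n 1] by simp

lemma umbral_plus_poly: "umbral N c (plus_poly N f) = (\<Sum>n\<le>degree f. coeff f n * umbral_power c N n)"
proof -
  have c0: "mconst 0 = 0" by (simp add: mconst_def)
  have "degree (map_poly mconst f) = degree f"
    by (rule degree_map_poly) (metis mconst_def lookup_single_eq lookup_zero)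
  then have "plus_poly N f = (\<Sum>n\<le>degree f. mconst (coeff f n) * (\<Sum>i<N. mvar i) ^ n)"
    unfolding plus_poly_def poly_altdef by (simp add: coeff_map_poly c0)
  then show ?thesis by (simp add: umbral_sum umbral_mconst umbral_sum_power)
qed

lemma umbral_power_scale: "umbral_power (\<lambda>i j. s ^ j * c i j) M n = s ^ n * umbral_power c M n"
proof (induction M arbitrary: n)
  case (Suc M)
  have "umbral_power (\<lambda>i j. s ^ j * c i j) (Suc M) n
      = (\<Sum>j\<le>n. s ^ n * (of_nat (n choose j) * umbral_power c M (n - j) * c M j))"
    unfolding umbral_power.simps Suc
  proof (rule sum.cong[OF refl])
    fix j assume "j \<in> {..n}"
    then have "s ^ n = s ^ (n - j) * s ^ j" by (simp flip: power_add)
    then show "of_nat (n choose j) * (s ^ (n - j) * umbral_power c M (n - j)) * (s ^ j * c M j)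
      = s ^ n * (of_nat (n choose j) * umbral_power c M (n - j) * c M j)" by simp
  qed
  then show ?case by (simp add: sum_distrib_left)
qed simp

lemma umbral_power_cong:
  assumes "\<And>i j. i < M \<Longrightarrow> c i j = d i j"
  shows "umbral_power c M n = umbral_power d M n"
  using assms by (induction M arbitrary: n) simp_all

text \<open>The power of N distributes over the variables and is absorbed into \<open>c\<close>. For
  N = 0 this would fail, since \<open>0 powr 0 = 0\<close>.\<close>

lemma K_N_umbral:
  assumes "N > 0"
  shows "K_N K N F x =
    umbral N (\<lambda>i j. of_real (real N powr (- (1/2))) ^ j * K (monom 1 j) (sqrt (real N) * x i)) F"
proof -
  have e: "complex_of_real (real N powr (- real (\<Sum>i<N. Poly_Mapping.lookup m i) / 2))
     = (\<Prod>i<N. of_real (real N powr (- (1/2))) ^ Poly_Mapping.lookup m i)" for m :: "nat \<Rightarrow>\<^sub>0 nat"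
  proof -
    have "real N powr (- real (\<Sum>i<N. Poly_Mapping.lookup m i) / 2)
      = (real N powr (- (1/2))) powr real (\<Sum>i<N. Poly_Mapping.lookup m i)"
      by (simp only: powr_powr) simp
    also have "\<dots> = (real N powr (- (1/2))) ^ (\<Sum>i<N. Poly_Mapping.lookup m i)"
      using assms by (intro powr_realpow) simp
    finally show ?thesis by (simp add: power_sum)
  qed
  show ?thesis unfolding K_N_def umbral_def e prod.distrib ..
qed

section \<open>Integration over the product measure\<close>

lemma poly_fun_simps [simp]:
  "poly_fun (f + g) x = poly_fun f x + poly_fun g x"
  "poly_fun (f * g) x = poly_fun f x * poly_fun g x"
  "poly_fun (smult c f) x = c * poly_fun f x"
  "poly_fun (monom c n) x = c * of_real x ^ n"
  "poly_fun 1 x = 1" "poly_fun 0 x = 0"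
  by (simp_all add: poly_fun_def poly_monom)

lemma poly_fun_sum: "poly_fun (\<Sum>i\<in>I. f i) x = (\<Sum>i\<in>I. poly_fun (f i) x)"
  by (simp add: poly_fun_def poly_sum)

lemma integrable_of_real_power:
  "standardized \<alpha> \<Longrightarrow> integrable \<alpha> (\<lambda>x. complex_of_real x ^ n)"
  using integrable_of_real[OF standardized_integrable_power, of \<alpha> n] by simp

lemma integrable_poly_fun:
  assumes "standardized \<alpha>"
  shows "integrable \<alpha> (poly_fun f)"
  unfolding poly_fun_def[abs_def] poly_altdef
  by (intro Bochner_Integration.integrable_sum Bochner_Integration.integrable_mult_right integrable_of_real_power[OF assms])

text \<open>\<open>L j k\<close> plays the role of \<open>\<integral> K(p\<^sub>j) p\<^sub>k d\<alpha>\<close>, and \<open>sum_moment L N n m\<close> is the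
  corresponding quantity for the \<open>N\<close>-fold product, \<open>(x\<^sub>1 + \<cdots> + x\<^sub>N)\<^sup>n\<close> and \<open>(x\<^sub>1 + \<cdots> + x\<^sub>N)\<^sup>m\<close>.\<close>

fun sum_moment :: "(nat \<Rightarrow> nat \<Rightarrow> complex) \<Rightarrow> nat \<Rightarrow> nat \<Rightarrow> nat \<Rightarrow> complex" where
  "sum_moment L 0 n m = (if n = 0 \<and> m = 0 then 1 else 0)"
| "sum_moment L (Suc N) n m = (\<Sum>j\<le>n. \<Sum>k\<le>m.
     of_nat (n choose j) * of_nat (m choose k) * L j k * sum_moment L N (n - j) (m - k))"

text \<open>The variables not yet in the sum carry arbitrary polynomials \<open>h i\<close>, so that
  the factor \<kappa>_j(x) x^k of the variable just split off can be absorbed by updating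
  \<open>h\<close> at \<open>M\<close>. Integrability and value go through the induction
  together.\<close>

lemma has_integral_umbral_power_section:
  fixes \<kappa> :: "nat \<Rightarrow> complex poly"
  assumes st: "standardized \<alpha>" and "M \<le> N"
  shows "has_bochner_integral (Pi\<^sub>M {..<N} (\<lambda>_. \<alpha>))
    (\<lambda>x. umbral_power (\<lambda>i j. poly_fun (\<kappa> j) (x i)) M n * of_real (\<Sum>i<M. x i) ^ m * (\<Prod>i\<in>{M..<N}. poly_fun (h i) (x i)))
    (sum_moment (\<lambda>j k. \<integral>x. poly_fun (\<kappa> j) x * of_real x ^ k \<partial>\<alpha>) M n m * (\<Prod>i\<in>{M..<N}. \<integral>x. poly_fun (h i) x \<partial>\<alpha>))"
  using assms(2)
proof (induction M arbitrary: n m h)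
  case 0
  interpret prob_space \<alpha> by (rule standardized_prob_space[OF st])
  interpret product_sigma_finite "\<lambda>_::nat. \<alpha>" by unfold_locales
  have "has_bochner_integral (Pi\<^sub>M {..<N} (\<lambda>_. \<alpha>)) (\<lambda>x. \<Prod>i<N. poly_fun (h i) (x i)) (\<Prod>i<N. \<integral>x. poly_fun (h i) x \<partial>\<alpha>)"
    using product_integrable_prod[of "{..<N}" "\<lambda>i. poly_fun (h i)"] product_integral_prod[of "{..<N}" "\<lambda>i. poly_fun (h i)"]
      integrable_poly_fun[OF st] by (simp add: has_bochner_integral_iff)
  then show ?case by (cases "m = 0"; cases "n = 0") (simp_all add: lessThan_atLeast0 power_0_left has_bochner_integral_zero)
next
  case (Suc M)
  let ?L = "\<lambda>j k. \<integral>x. poly_fun (\<kappa> j) x * of_real x ^ k \<partial>\<alpha>"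
  let ?W = "\<lambda>x n. umbral_power (\<lambda>i j. poly_fun (\<kappa> j) (x i)) M n"
  let ?P = "\<lambda>x. \<Prod>i\<in>{Suc M..<N}. poly_fun (h i) (x i)"
  let ?I = "\<Prod>i\<in>{Suc M..<N}. \<integral>x. poly_fun (h i) x \<partial>\<alpha>"
  have ins: "{M..<N} = insert M {Suc M..<N}" using Suc.prems by auto
  have "has_bochner_integral (Pi\<^sub>M {..<N} (\<lambda>_. \<alpha>))
     (\<lambda>x. ?W x (n - j) * of_real (\<Sum>i<M. x i) ^ (m - k) * (poly_fun (\<kappa> j) (x M) * of_real (x M) ^ k * ?P x))
     (sum_moment ?L M (n - j) (m - k) * (?L j k * ?I))" for j k
  proof -
    have pf: "poly_fun (\<kappa> j * monom 1 k) = (\<lambda>x. poly_fun (\<kappa> j) x * of_real x ^ k)"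
      by (simp add: fun_eq_iff)
    have "(\<Prod>i\<in>{M..<N}. poly_fun ((h(M := \<kappa> j * monom 1 k)) i) (x i)) = poly_fun (\<kappa> j) (x M) * of_real (x M) ^ k * ?P x" for x
      unfolding ins by (subst prod.insert) (auto intro!: arg_cong2[where f="(*)"] prod.cong simp: pf simp del: mult_cancel_left mult_cancel_right)
    moreover have "(\<Prod>i\<in>{M..<N}. \<integral>x. poly_fun ((h(M := \<kappa> j * monom 1 k)) i) x \<partial>\<alpha>) = ?L j k * ?I"
      unfolding ins by (subst prod.insert) (auto intro!: arg_cong2[where f="(*)"] prod.cong simp: pf simp del: mult_cancel_left mult_cancel_right)
    ultimately show ?thesis
      using Suc.IH[of "n - j" "m - k" "h(M := \<kappa> j * monom 1 k)"] Suc.prems by simp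
  qed
  then have "has_bochner_integral (Pi\<^sub>M {..<N} (\<lambda>_. \<alpha>))
     (\<lambda>x. \<Sum>j\<le>n. \<Sum>k\<le>m. of_nat (n choose j) * of_nat (m choose k) *
        (?W x (n - j) * of_real (\<Sum>i<M. x i) ^ (m - k) * (poly_fun (\<kappa> j) (x M) * of_real (x M) ^ k * ?P x)))
     (\<Sum>j\<le>n. \<Sum>k\<le>m. of_nat (n choose j) * of_nat (m choose k) * (sum_moment ?L M (n - j) (m - k) * (?L j k * ?I)))"
    by (intro has_bochner_integral_sum has_bochner_integral_mult_right)
  also have "(\<lambda>x. \<Sum>j\<le>n. \<Sum>k\<le>m. of_nat (n choose j) * of_nat (m choose k) *
        (?W x (n - j) * of_real (\<Sum>i<M. x i) ^ (m - k) * (poly_fun (\<kappa> j) (x M) * of_real (x M) ^ k * ?P x)))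
      = (\<lambda>x. umbral_power (\<lambda>i j. poly_fun (\<kappa> j) (x i)) (Suc M) n * of_real (\<Sum>i<Suc M. x i) ^ m * ?P x)"
  proof
    fix x
    have b: "complex_of_real (\<Sum>i<Suc M. x i) ^ m = (\<Sum>k\<le>m. of_nat (m choose k) * of_real (x M) ^ k * of_real (\<Sum>i<M. x i) ^ (m - k))"
      using binomial_ring[of "complex_of_real (x M)" "of_real (\<Sum>i<M. x i)" m] by (simp add: add.commute)
    show "(\<Sum>j\<le>n. \<Sum>k\<le>m. of_nat (n choose j) * of_nat (m choose k) *
        (?W x (n - j) * of_real (\<Sum>i<M. x i) ^ (m - k) * (poly_fun (\<kappa> j) (x M) * of_real (x M) ^ k * ?P x)))
      = umbral_power (\<lambda>i j. poly_fun (\<kappa> j) (x i)) (Suc M) n * of_real (\<Sum>i<Suc M. x i) ^ m * ?P x"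
      unfolding b umbral_power.simps unfolding sum_product unfolding sum_distrib_right
      by (intro sum.cong refl) (simp only: mult_ac)
  qed
  also have "(\<Sum>j\<le>n. \<Sum>k\<le>m. of_nat (n choose j) * of_nat (m choose k) * (sum_moment ?L M (n - j) (m - k) * (?L j k * ?I)))
     = sum_moment ?L (Suc M) n m * ?I"
    unfolding sum_moment.simps sum_distrib_right by (intro sum.cong refl) (simp only: mult_ac)
  finally show ?case .
qed

lemma has_integral_umbral_power:
  fixes \<kappa> :: "nat \<Rightarrow> complex poly"
  assumes st: "standardized \<alpha>"
  shows "has_bochner_integral (Pi\<^sub>M {..<N} (\<lambda>_. \<alpha>))
    (\<lambda>x. umbral_power (\<lambda>i j. poly_fun (\<kappa> j) (x i)) N n * of_real (\<Sum>i<N. x i) ^ m)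
    (sum_moment (\<lambda>j k. \<integral>x. poly_fun (\<kappa> j) x * of_real x ^ k \<partial>\<alpha>) N n m)"
  using has_integral_umbral_power_section[OF st order_refl, of N \<kappa> n m] by simp

lemma integral_K_N_plus:
  fixes \<kappa> :: "nat \<Rightarrow> complex poly"
  assumes st: "standardized \<alpha>" and N: "N > 0" and K: "\<And>j. K (monom 1 j) = poly_fun (\<kappa> j)"
  shows "(\<integral>x. K_N K N (plus_poly N f) x * plus_fun N g x \<partial>scaled_prod \<alpha> N) =
    (\<Sum>n\<le>degree f. \<Sum>m\<le>degree g. coeff f n * coeff g m *
      (sum_moment (\<lambda>j k. \<integral>x. poly_fun (\<kappa> j) x * of_real x ^ k \<partial>\<alpha>) N n m / of_real (real N powr (real (n + m) / 2))))"
proof -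
  define s where "s = complex_of_real (real N powr (- (1/2)))"
  let ?h = "\<lambda>x. K_N K N (plus_poly N f) x * plus_fun N g x"
  have meas: "?h \<in> borel_measurable (Pi\<^sub>M {..<N} (\<lambda>_. borel))"
    unfolding K_N_def plus_fun_def K by measurable
  have sN: "s = 1 / of_real (sqrt (real N))"
  proof -
    have "real N powr (- (1/2)) = 1 / sqrt (real N)"
      using powr_half_sqrt[of "real N"] by (simp only: powr_minus_divide of_nat_0_le_iff)
    then show ?thesis unfolding s_def by (simp only: of_real_divide of_real_1)
  qed
  have sp: "s ^ n * s ^ m = 1 / of_real (real N powr (real (n + m) / 2))" for n m
  proof -
    have "(real N powr (- (1/2))) ^ (n + m) = (real N powr (- (1/2))) powr real (n + m)"
      using N by (intro powr_realpow[symmetric]) simp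
    also have "\<dots> = 1 / (real N powr (real (n + m) / 2))"
      by (simp only: powr_powr powr_minus_divide[symmetric]) simp
    finally have "(real N powr (- (1/2))) ^ (n + m) = 1 / (real N powr (real (n + m) / 2))" .
    then show ?thesis unfolding s_def
      by (simp only: of_real_power[symmetric] of_real_mult[symmetric] power_add[symmetric] of_real_divide of_real_1)
  qed
  have eq: "?h (\<lambda>i\<in>{..<N}. x i / sqrt (real N)) = (\<Sum>n\<le>degree f. \<Sum>m\<le>degree g. coeff f n * coeff g m * (s ^ n * s ^ m) *
      (umbral_power (\<lambda>i j. poly_fun (\<kappa> j) (x i)) N n * of_real (\<Sum>i<N. x i) ^ m))" for x
  proof -
    have 1: "K_N K N (plus_poly N f) (\<lambda>i\<in>{..<N}. x i / sqrt (real N))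
        = (\<Sum>n\<le>degree f. coeff f n * (s ^ n * umbral_power (\<lambda>i j. poly_fun (\<kappa> j) (x i)) N n))"
    proof -
      have "umbral_power (\<lambda>i j. s ^ j * K (monom 1 j) (sqrt (real N) * (\<lambda>i\<in>{..<N}. x i / sqrt (real N)) i)) N n
        = umbral_power (\<lambda>i j. s ^ j * poly_fun (\<kappa> j) (x i)) N n" for n
        using N by (intro umbral_power_cong) (simp add: K)
      then show ?thesis
        unfolding K_N_umbral[OF N] umbral_plus_poly s_def[symmetric] by (simp only: umbral_power_scale)
    qed
    have "(\<Sum>i<N. (\<lambda>i\<in>{..<N}. x i / sqrt (real N)) i) = (\<Sum>i<N. x i) / sqrt (real N)"
      by (simp add: sum_divide_distrib)
    then have 2: "plus_fun N g (\<lambda>i\<in>{..<N}. x i / sqrt (real N)) = (\<Sum>m\<le>degree g. coeff g m * (s ^ m * of_real (\<Sum>i<N. x i) ^ m))"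
      unfolding plus_fun_def poly_fun_def poly_altdef sN
      by (simp add: power_divide)
    show ?thesis unfolding 1 2 sum_product by (intro sum.cong refl) (simp only: mult_ac)
  qed
  have "(\<integral>x. ?h x \<partial>scaled_prod \<alpha> N) = (\<integral>x. ?h (\<lambda>i\<in>{..<N}. x i / sqrt (real N)) \<partial>Pi\<^sub>M {..<N} (\<lambda>_. \<alpha>))"
    by (rule integral_scaled_prod[OF standardized_sets[OF st] meas])
  also have "\<dots> = (\<Sum>n\<le>degree f. \<Sum>m\<le>degree g. coeff f n * coeff g m * (s ^ n * s ^ m) *
      sum_moment (\<lambda>j k. \<integral>x. poly_fun (\<kappa> j) x * of_real x ^ k \<partial>\<alpha>) N n m)"
    unfolding eq
    by (intro has_bochner_integral_integral_eq has_bochner_integral_sum has_bochner_integral_mult_right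
        has_integral_umbral_power[OF st])
  finally show ?thesis unfolding sp by (simp add: mult_ac)
qed

text \<open>Hypothesis \<open>G\<close> is the limit of the recursion in N: the terms with j + k = 1
  vanish by centering, those with j + k > 2 are of lower order, and the Stolz-Cesaro step divides
  the rest by (n + m) / 2.\<close>

lemma sum_moment_tendsto:
  fixes L G :: "nat \<Rightarrow> nat \<Rightarrow> complex"
  assumes L: "L 0 0 = 1" "L 0 (Suc 0) = 0" "L (Suc 0) 0 = 0"
    and G0: "G 0 0 = 1"
    and G: "\<And>n m. of_nat (n + m) * G n m = L 2 0 * of_nat (n * (n - 1)) * G (n - 2) m
      + 2 * L (Suc 0) (Suc 0) * of_nat (n * m) * G (n - 1) (m - 1) + L 0 2 * of_nat (m * (m - 1)) * G n (m - 2)"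
  shows "(\<lambda>N. sum_moment L N n m / of_real (real N powr (real (n + m) / 2))) \<longlonglongrightarrow> G n m"
proof (induction "n + m" arbitrary: n m rule: less_induct)
  case less
  let ?S = "sum_moment L"
  show ?case
  proof (cases "n + m = 0")
    case True
    have "?S N 0 0 = 1" for N by (induction N) (simp_all add: L)
    moreover have "\<forall>\<^sub>F N in sequentially. real N powr 0 = 1"
      using eventually_gt_at_top[of "0::nat"] by eventually_elim simp
    ultimately have "\<forall>\<^sub>F N in sequentially. G 0 0 = ?S N 0 0 / of_real (real N powr 0)"
      unfolding G0 by (auto elim: eventually_mono)
    from Lim_transform_eventually[OF tendsto_const this] show ?thesis using True by simp
  next
    case False
    define \<kappa> where "\<kappa> = real (n + m) / 2"
    have \<kappa>: "\<kappa> > 0" unfolding \<kappa>_def using False by (auto simp only: half_gt_zero_iff of_nat_0_less_iff)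
    let ?I = "{..n} \<times> {..m} - {(0, 0)}"
    let ?C = "\<lambda>j k. of_nat (n choose j) * of_nat (m choose k) * L j k"
    let ?X = "\<lambda>j k. if j + k = 2 then ?C j k * G (n - j) (m - k) else 0"
    \<comment> \<open>Since \<open>L 0 0 = 1\<close>, taking the difference removes the term to
      which the new variable contributes nothing.\<close>
    have diff: "?S (Suc N) n m - ?S N n m = (\<Sum>(j, k)\<in>?I. ?C j k * ?S N (n - j) (m - k))" for N
    proof -
      have "?S (Suc N) n m = (\<Sum>(j, k)\<in>{..n} \<times> {..m}. ?C j k * ?S N (n - j) (m - k))"
        by (simp add: sum.cartesian_product)
      also have "\<dots> = ?C 0 0 * ?S N n m + (\<Sum>(j, k)\<in>?I. ?C j k * ?S N (n - j) (m - k))"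
        by (subst sum.remove[of _ "(0, 0)"]) auto
      finally show ?thesis by (simp add: L)
    qed
    have summand: "(\<lambda>N. ?C j k * ?S N (n - j) (m - k) / of_real (real N powr (\<kappa> - 1))) \<longlonglongrightarrow> ?X j k"
      if jk: "(j, k) \<in> ?I" for j k
    proof (cases "j + k = 1")
      case True
      then have "L j k = 0" using L by (cases j) auto
      then show ?thesis using True by simp
    next
      case False
      \<comment> \<open>Half the excess of the order over 2; such a summand is smaller than the
        leading ones by N^(-d).\<close>
      define d where "d = real (j + k) / 2 - 1"
      have jk2: "j + k \<ge> 2" "j \<le> n" "k \<le> m" using jk False by auto
      have "(\<lambda>N. ?S N (n - j) (m - k) / of_real (real N powr (real ((n - j) + (m - k)) / 2))) \<longlonglongrightarrow> G (n - j) (m - k)"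
        using jk2 by (intro less) auto
      moreover have d: "(\<lambda>N. complex_of_real (real N powr (- d))) \<longlonglongrightarrow> (if j + k = 2 then 1 else 0)"
      proof (cases "j + k = 2")
        case True
        then have "\<forall>\<^sub>F N in sequentially. 1 = complex_of_real (real N powr (- d))"
          by (intro eventually_mono[OF eventually_gt_at_top[of "0::nat"]]) (simp add: d_def)
        from Lim_transform_eventually[OF tendsto_const this] True show ?thesis by simp
      next
        case False
        then have "d > 0" using jk2 unfolding d_def by simp
        then have "(\<lambda>N. real N powr (- d)) \<longlonglongrightarrow> 0" by real_asymp
        from tendsto_of_real[OF this] False show ?thesis by simp
      qed
      ultimately have "(\<lambda>N. ?C j k * (?S N (n - j) (m - k) / of_real (real N powr (real ((n - j) + (m - k)) / 2)) * of_real (real N powr (- d))))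
        \<longlonglongrightarrow> ?C j k * (G (n - j) (m - k) * (if j + k = 2 then 1 else 0))"
        by (intro tendsto_intros)
      moreover have "\<forall>\<^sub>F N in sequentially. ?C j k * (?S N (n - j) (m - k) / of_real (real N powr (real ((n - j) + (m - k)) / 2)) * of_real (real N powr (- d)))
        = ?C j k * ?S N (n - j) (m - k) / of_real (real N powr (\<kappa> - 1))"
      proof (rule always_eventually, rule allI)
        fix N
        have "\<kappa> - 1 = real ((n - j) + (m - k)) / 2 + d"
          unfolding \<kappa>_def d_def using jk2 by (simp add: of_nat_diff field_simps)
        then have e: "real N powr (\<kappa> - 1) = real N powr (real ((n - j) + (m - k)) / 2) * real N powr d"
          by (simp only: powr_add)
        show "?C j k * (?S N (n - j) (m - k) / of_real (real N powr (real ((n - j) + (m - k)) / 2)) * of_real (real N powr (- d)))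
        = ?C j k * ?S N (n - j) (m - k) / of_real (real N powr (\<kappa> - 1))"
          unfolding e powr_minus of_real_mult of_real_inverse by (simp only: divide_inverse inverse_mult_distrib mult_ac)
      qed
      ultimately show ?thesis by (auto elim: Lim_transform_eventually)
    qed
    have "(\<lambda>N. \<Sum>(j, k)\<in>?I. ?C j k * ?S N (n - j) (m - k) / of_real (real N powr (\<kappa> - 1))) \<longlonglongrightarrow> (\<Sum>(j, k)\<in>?I. ?X j k)"
    proof (rule tendsto_sum)
      fix i assume i: "i \<in> ?I"
      obtain j k where "i = (j, k)" by (cases i)
      with summand[of j k] i show "(\<lambda>N. case i of (j, k) \<Rightarrow> ?C j k * ?S N (n - j) (m - k) / of_real (real N powr (\<kappa> - 1)))
        \<longlonglongrightarrow> (case i of (j, k) \<Rightarrow> ?X j k)" by simp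
    qed
    then have lim: "(\<lambda>N. (?S (Suc N) n m - ?S N n m) / of_real (real N powr (\<kappa> - 1))) \<longlonglongrightarrow> (\<Sum>(j, k)\<in>?I. ?X j k)"
      unfolding diff by (simp add: sum_divide_distrib case_prod_unfold)
    \<comment> \<open>For small n or m some of the three index pairs lie outside the range of
      summation; their binomial coefficients are 0.\<close>
    have "(\<Sum>(j, k)\<in>?I. ?X j k) = (\<Sum>(j, k)\<in>{(2, 0), (1, 1), (0, 2)}. ?X j k)"
    proof (rule sum.mono_neutral_cong)
      fix i assume "i \<in> {(2, 0), (1, 1), (0, 2)} - ?I"
      then show "(case i of (j, k) \<Rightarrow> ?X j k) = 0" by (auto simp: binomial_eq_0)
    next
      fix i assume "i \<in> ?I - {(2, 0), (1, 1), (0, 2)}"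
      moreover obtain j k where jk: "i = (j, k)" by (cases i)
      ultimately have "j + k \<noteq> 2" by auto
      then show "(case i of (j, k) \<Rightarrow> ?X j k) = 0" by (simp add: jk)
    qed auto
    also have "\<dots> = ?C 2 0 * G (n - 2) m + ?C 1 1 * G (n - 1) (m - 1) + ?C 0 2 * G n (m - 2)"
      by simp
    also have "\<dots> = of_real \<kappa> * G n m"
    proof -
      have c2: "2 * complex_of_nat (n choose 2) = of_nat (n * (n - 1))" for n
      proof -
        have "2 * (n choose 2) = n * (n - 1)"
          unfolding choose_two by (rule dvd_mult_div_cancel) (cases n, simp_all)
        then show ?thesis by (metis of_nat_mult of_nat_numeral)
      qed
      have "2 * (?C 2 0 * G (n - 2) m + ?C 1 1 * G (n - 1) (m - 1) + ?C 0 2 * G n (m - 2))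
        = L 2 0 * (2 * of_nat (n choose 2)) * G (n - 2) m + 2 * L (Suc 0) (Suc 0) * of_nat (n * m) * G (n - 1) (m - 1)
          + L 0 2 * (2 * of_nat (m choose 2)) * G n (m - 2)"
        by (simp add: algebra_simps)
      also have "\<dots> = of_nat (n + m) * G n m" unfolding c2 G ..
      finally have 2: "2 * (?C 2 0 * G (n - 2) m + ?C 1 1 * G (n - 1) (m - 1) + ?C 0 2 * G n (m - 2)) = of_nat (n + m) * G n m" .
      have "2 * complex_of_real \<kappa> = of_nat (n + m)" unfolding \<kappa>_def by simp
      with 2 have "2 * (?C 2 0 * G (n - 2) m + ?C 1 1 * G (n - 1) (m - 1) + ?C 0 2 * G n (m - 2)) = 2 * (of_real \<kappa> * G n m)"
        by (simp only: mult.assoc[symmetric])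
      then show ?thesis by (simp only: mult_cancel_left) simp
    qed
    finally show ?thesis
      using stolz_cesaro_powr[OF \<kappa> lim] \<kappa> unfolding \<kappa>_def[symmetric] by simp
  qed
qed

section \<open>Gaussian pairings of the Mehler transform with monomials\<close>

lemma poly_fun_has_vector_derivative:
  "(poly_fun f has_vector_derivative poly_fun (pderiv f) x) (at x)"
  using poly_has_vector_derivative[OF has_vector_derivative_of_real[OF DERIV_ident], of f x]
  unfolding poly_fun_def[abs_def] by simp

lemma gaussian_integral_x_mult:
  "(\<integral>x. poly_fun ([:0, 1:] * f) x \<partial>std_normal_distribution) = (\<integral>x. poly_fun (pderiv f) x \<partial>std_normal_distribution)"
proof -
  have bound: "\<exists>C k. \<forall>y. norm (poly_fun h y) \<le> C * (1 + y\<^sup>2) ^ k" for h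
  proof -
    obtain C k where "\<forall>t x y. norm (poly_fun h y) \<le> C * gauss_weight x y ^ k"
      using tame_poly_fun_snd[of h] unfolding tame_def by blast
    then have "norm (poly_fun h y) \<le> C * gauss_weight 0 y ^ k" for y by blast
    then show ?thesis by (intro exI[of _ C] exI[of _ k]) (simp add: gauss_weight_def)
  qed
  obtain C k where C: "\<And>y. norm (poly_fun f y) \<le> C * (1 + y\<^sup>2) ^ k" using bound by metis
  obtain D l where D: "\<And>y. norm (poly_fun (pderiv f) y) \<le> D * (1 + y\<^sup>2) ^ l" using bound by metis
  have C0: "0 \<le> C" using order_trans[OF norm_ge_zero C[of 0]] by simp
  have b: "norm (poly_fun f y) \<le> max C D * (1 + y\<^sup>2) ^ max k l"
    "norm (poly_fun (pderiv f) y) \<le> max C D * (1 + y\<^sup>2) ^ max k l" for y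
    by (rule order_trans[OF C] order_trans[OF D],
        intro mult_mono power_increasing, use C0 in \<open>auto simp: le_max_iff_disj\<close>)+
  have "isCont (poly_fun (pderiv f)) x" for x
    unfolding poly_fun_def[abs_def] by (intro continuous_intros)
  from gaussian_integration_by_parts[OF poly_fun_has_vector_derivative this b]
  show ?thesis by (simp add: poly_fun_def scaleR_conv_of_real)
qed

lemma integral_poly_fun_add:
  "standardized \<alpha> \<Longrightarrow> (\<integral>x. poly_fun (f + g) x \<partial>\<alpha>) = (\<integral>x. poly_fun f x \<partial>\<alpha>) + (\<integral>x. poly_fun g x \<partial>\<alpha>)"
  unfolding poly_fun_simps(1) by (intro Bochner_Integration.integral_add integrable_poly_fun)

lemma integral_poly_fun_smult:
  "(\<integral>x. poly_fun (smult c f) x \<partial>\<alpha>) = c * (\<integral>x. poly_fun f x \<partial>\<alpha>)"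
  unfolding poly_fun_simps(3) by (rule Bochner_Integration.integral_mult_right_zero)

lemmas gauss_integral_poly_simps = integral_poly_fun_add[OF standardized_std_normal] integral_poly_fun_smult

definition gauss_moment :: "complex \<Rightarrow> nat \<Rightarrow> nat \<Rightarrow> complex" where
  "gauss_moment \<omega> n m = (\<integral>x. poly_fun (T_op \<omega> (monom 1 n) * monom 1 m) x \<partial>std_normal_distribution)"

lemma monom_Suc_mult: "monom (1 :: complex) (Suc n) = [:0, 1:] * monom 1 n"
  by (simp add: monom_Suc)

lemma pderiv_monom_1: "pderiv (monom (1 :: complex) n) = smult (of_nat n) (monom 1 (n - 1))"
  by (simp add: pderiv_monom smult_monom)

lemma gauss_moment_aux:
  "(\<integral>x. poly_fun ([:0, 1:] * (T_op \<omega> (monom 1 n) * monom 1 m)) x \<partial>std_normal_distribution)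
   = \<omega> * of_nat n * gauss_moment \<omega> (n - 1) m + of_nat m * gauss_moment \<omega> n (m - 1)"
proof -
  have "pderiv (T_op \<omega> (monom 1 n) * monom 1 m)
     = smult (\<omega> * of_nat n) (T_op \<omega> (monom 1 (n - 1)) * monom 1 m) + smult (of_nat m) (T_op \<omega> (monom 1 n) * monom 1 (m - 1))"
    using T_op_linear[of \<omega>] unfolding linear_smult_iff pderiv_mult pderiv_T_op pderiv_monom_1 by (simp add: mult.commute)
  then show ?thesis
    by (simp only: gaussian_integral_x_mult gauss_moment_def gauss_integral_poly_simps)
qed

lemma gauss_moment_Suc_right:
  "gauss_moment \<omega> n (Suc m) = \<omega> * of_nat n * gauss_moment \<omega> (n - 1) m + of_nat m * gauss_moment \<omega> n (m - 1)"
  using gauss_moment_aux[of \<omega> n m] unfolding gauss_moment_def monom_Suc_mult by (simp only: mult_ac)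

text \<open>\<open>T_op_x_mult\<close> moves the factor x out of the transform; integration by parts
  then contributes \<omega>^2, which 1 - \<omega>^2 completes to the coefficient 1.\<close>

lemma gauss_moment_Suc_left:
  "gauss_moment \<omega> (Suc n) m = of_nat n * gauss_moment \<omega> (n - 1) m + \<omega> * of_nat m * gauss_moment \<omega> n (m - 1)"
proof -
  have "T_op \<omega> (monom 1 (Suc n)) * monom 1 m = smult \<omega> ([:0, 1:] * (T_op \<omega> (monom 1 n) * monom 1 m))
    + smult ((1 - \<omega>\<^sup>2) * of_nat n) (T_op \<omega> (monom 1 (n - 1)) * monom 1 m)"
    using T_op_linear[of \<omega>] unfolding linear_smult_iff monom_Suc_mult T_op_x_mult pderiv_monom_1
    by (simp add: distrib_right mult.assoc)
  then have "gauss_moment \<omega> (Suc n) m = \<omega> * (\<integral>x. poly_fun ([:0, 1:] * (T_op \<omega> (monom 1 n) * monom 1 m)) x \<partial>std_normal_distribution)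
    + (1 - \<omega>\<^sup>2) * of_nat n * gauss_moment \<omega> (n - 1) m"
    by (simp only: gauss_moment_def gauss_integral_poly_simps)
  then show ?thesis unfolding gauss_moment_aux by (simp add: algebra_simps power2_eq_square)
qed

text \<open>The sum of the recursions on the left and on the right index, each containing the mixed
  term once. It has the form required by \<open>sum_moment_tendsto\<close> with second moments 1,
  \<omega> and 1.\<close>

lemma gauss_moment_recurrence:
  "of_nat (n + m) * gauss_moment \<omega> n m = 1 * of_nat (n * (n - 1)) * gauss_moment \<omega> (n - 2) m
     + 2 * \<omega> * of_nat (n * m) * gauss_moment \<omega> (n - 1) (m - 1) + 1 * of_nat (m * (m - 1)) * gauss_moment \<omega> n (m - 2)"
proof -
  have 1: "of_nat n * gauss_moment \<omega> n m = of_nat (n * (n - 1)) * gauss_moment \<omega> (n - 2) m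
      + \<omega> * of_nat (n * m) * gauss_moment \<omega> (n - 1) (m - 1)"
    by (cases n) (simp_all add: gauss_moment_Suc_left algebra_simps)
  have 2: "of_nat m * gauss_moment \<omega> n m = of_nat (m * (m - 1)) * gauss_moment \<omega> n (m - 2)
      + \<omega> * of_nat (n * m) * gauss_moment \<omega> (n - 1) (m - 1)"
    by (cases m) (simp_all add: gauss_moment_Suc_right algebra_simps)
  have "of_nat (n + m) * gauss_moment \<omega> n m = of_nat n * gauss_moment \<omega> n m + of_nat m * gauss_moment \<omega> n m"
    by (simp add: distrib_right)
  then show ?thesis unfolding 1 2 by (simp add: algebra_simps)
qed

lemma gauss_moment_0_0: "gauss_moment \<omega> 0 0 = 1"
  using standardized_moments(3)[OF standardized_std_normal, of "1 :: complex"]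
  unfolding gauss_moment_def monom_0 one_pCons[symmetric] T_op_1 mult_1_right poly_fun_simps(5) .

lemma linear_smult_sum:
  assumes "Vector_Spaces.linear smult smult (T :: complex poly \<Rightarrow> complex poly)"
  shows "T f = (\<Sum>n\<le>degree f. smult (coeff f n) (T (monom 1 n)))"
proof -
  have z: "T 0 = 0" using assms unfolding linear_smult_iff by (metis smult_0_left)
  have s: "T (\<Sum>n\<in>I. g n) = (\<Sum>n\<in>I. T (g n))" for I :: "nat set" and g
    by (induction I rule: infinite_finite_induct) (use assms z in \<open>auto simp: linear_smult_iff\<close>)
  have "T f = T (\<Sum>n\<le>degree f. smult (coeff f n) (monom 1 n))"
    using poly_as_sum_of_monoms[of f] by (simp add: smult_monom)
  then show ?thesis unfolding s using assms by (simp add: linear_smult_iff)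
qed

lemma gaussian_bilinear_expansion:
  "(\<integral>x. poly_fun (T_op \<omega> f) x * poly_fun g x \<partial>std_normal_distribution)
   = (\<Sum>n\<le>degree f. \<Sum>m\<le>degree g. coeff f n * coeff g m * gauss_moment \<omega> n m)"
proof -
  have "T_op \<omega> f * g = (\<Sum>n\<le>degree f. \<Sum>m\<le>degree g. smult (coeff f n * coeff g m) (T_op \<omega> (monom 1 n) * monom 1 m))"
  proof -
    have "T_op \<omega> f * g = (\<Sum>n\<le>degree f. smult (coeff f n) (T_op \<omega> (monom 1 n))) * (\<Sum>m\<le>degree g. smult (coeff g m) (monom 1 m))"
      using poly_as_sum_of_monoms[of g] linear_smult_sum[OF T_op_linear, of \<omega> f] by (simp add: smult_monom)
    then show ?thesis unfolding sum_product by (simp add: mult_ac)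
  qed
  then have "(\<integral>x. poly_fun (T_op \<omega> f * g) x \<partial>std_normal_distribution)
    = (\<integral>x. (\<Sum>n\<le>degree f. \<Sum>m\<le>degree g. coeff f n * coeff g m * poly_fun (T_op \<omega> (monom 1 n) * monom 1 m) x) \<partial>std_normal_distribution)"
    by (simp only: poly_fun_sum poly_fun_simps(3))
  also have "\<dots> = (\<Sum>n\<le>degree f. \<Sum>m\<le>degree g. coeff f n * coeff g m * gauss_moment \<omega> n m)"
    unfolding gauss_moment_def
    by (intro has_bochner_integral_integral_eq has_bochner_integral_sum has_bochner_integral_mult_right)
      (simp only: has_bochner_integral_iff integrable_poly_fun[OF standardized_std_normal] simp_thms)
  finally show ?thesis by simp
qed

text \<open>The six prescribed values are the moments of total order at most two; they make the
  limit recursion that of \<open>gauss_moment\<close>, and bilinearity does the rest.\<close>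

lemma clt_limit_T_op:
  assumes st: "standardized \<alpha>" and K: "\<And>j. K (monom 1 j) = poly_fun (\<kappa> j)"
    and L: "(\<integral>x. poly_fun (\<kappa> 0) x \<partial>\<alpha>) = 1" "(\<integral>x. poly_fun (\<kappa> 0) x * of_real x \<partial>\<alpha>) = 0"
      "(\<integral>x. poly_fun (\<kappa> 1) x \<partial>\<alpha>) = 0" "(\<integral>x. poly_fun (\<kappa> 1) x * of_real x \<partial>\<alpha>) = \<omega>"
      "(\<integral>x. poly_fun (\<kappa> 0) x * of_real x ^ 2 \<partial>\<alpha>) = 1" "(\<integral>x. poly_fun (\<kappa> 2) x \<partial>\<alpha>) = 1"
  shows "clt_limit \<alpha> K (\<lambda>f. poly_fun (T_op \<omega> f))"
  unfolding clt_limit_def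
proof (intro allI)
  fix f g
  let ?L = "\<lambda>j k. \<integral>x. poly_fun (\<kappa> j) x * of_real x ^ k \<partial>\<alpha>"
  have "(\<lambda>N. sum_moment ?L N n m / of_real (real N powr (real (n + m) / 2))) \<longlonglongrightarrow> gauss_moment \<omega> n m" for n m
  proof (rule sum_moment_tendsto)
    show "of_nat (n + m) * gauss_moment \<omega> n m = ?L 2 0 * of_nat (n * (n - 1)) * gauss_moment \<omega> (n - 2) m
      + 2 * ?L (Suc 0) (Suc 0) * of_nat (n * m) * gauss_moment \<omega> (n - 1) (m - 1)
      + ?L 0 2 * of_nat (m * (m - 1)) * gauss_moment \<omega> n (m - 2)" for n m
      unfolding gauss_moment_recurrence using L by (simp del: of_nat_mult)
  qed (use L gauss_moment_0_0 in simp_all)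
  then have "(\<lambda>N. \<Sum>n\<le>degree f. \<Sum>m\<le>degree g. coeff f n * coeff g m *
      (sum_moment ?L N n m / of_real (real N powr (real (n + m) / 2))))
     \<longlonglongrightarrow> (\<Sum>n\<le>degree f. \<Sum>m\<le>degree g. coeff f n * coeff g m * gauss_moment \<omega> n m)"
    by (intro tendsto_sum tendsto_mult_left)
  moreover have "\<forall>\<^sub>F N in sequentially. (\<Sum>n\<le>degree f. \<Sum>m\<le>degree g. coeff f n * coeff g m *
      (sum_moment ?L N n m / of_real (real N powr (real (n + m) / 2))))
    = (\<integral>x. K_N K N (plus_poly N f) x * plus_fun N g x \<partial>scaled_prod \<alpha> N)"
    by (rule eventually_mono[OF eventually_gt_at_top[of "0::nat"]]) (rule integral_K_N_plus[where \<kappa>=\<kappa>, OF st _ K, symmetric])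
  ultimately show "(\<lambda>N. \<integral>x. K_N K N (plus_poly N f) x * plus_fun N g x \<partial>scaled_prod \<alpha> N)
        \<longlonglongrightarrow> (\<integral>x. poly_fun (T_op \<omega> f) x * poly_fun g x \<partial>std_normal_distribution)"
    unfolding gaussian_bilinear_expansion by (rule Lim_transform_eventually)
qed

lemma finite_poly_fun_zeros:
  assumes "f \<noteq> 0"
  shows "finite {x. poly_fun f x = 0}"
proof -
  have "finite (complex_of_real ` {x. poly_fun f x = 0})"
    by (rule finite_subset[OF _ poly_roots_finite[OF assms]]) (auto simp: poly_fun_def)
  then show ?thesis by (rule finite_imageD) (simp add: inj_on_def)
qed

text \<open>On the real line the polynomial with conjugated coefficients is the conjugate of
  \<open>d\<close>. Testing with it gives a vanishing integral of |d|^2, while a nonzero polynomial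
  has only finitely many zeros.\<close>

lemma gaussian_orthogonal_to_polys:
  assumes "\<And>g. (\<integral>x. poly_fun d x * poly_fun g x \<partial>std_normal_distribution) = 0"
  shows "d = 0"
proof -
  define d' where "d' = map_poly cnj d"
  have d': "poly_fun d' x = cnj (poly_fun d x)" for x
    by (simp only: d'_def poly_fun_def poly_cnj complex_cnj_complex_of_real)
  have "(\<integral>x. complex_of_real ((cmod (poly_fun d x))\<^sup>2) \<partial>std_normal_distribution) = 0"
    using assms[of d'] unfolding d' complex_norm_square[symmetric] .
  then have i0: "(\<integral>x. (cmod (poly_fun d x))\<^sup>2 \<partial>std_normal_distribution) = 0"
    unfolding integral_complex_of_real by (simp only: of_real_eq_0_iff)
  have "integrable std_normal_distribution (\<lambda>x. (cmod (poly_fun d x))\<^sup>2)"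
    using integrable_poly_fun_powr[of 2 d] by (simp add: powr_numeral)
  with i0 have "AE x in std_normal_distribution. (cmod (poly_fun d x))\<^sup>2 = 0"
    by (subst (asm) integral_nonneg_eq_0_iff_AE) auto
  then have ae: "AE x in lborel. poly_fun d x = 0"
    by (subst (asm) AE_density) (auto simp: normal_density_pos)
  show ?thesis
  proof (rule ccontr)
    assume "d \<noteq> 0"
    then have "{x. poly_fun d x = 0} \<in> null_sets lborel"
      by (intro finite_imp_null_set_lborel finite_poly_fun_zeros)
    from AE_not_in[OF this] have "AE x in lborel. \<not> poly_fun d x = 0" by simp
    with ae have "AE x in (lborel :: real measure). x \<notin> UNIV" by eventually_elim simp
    then show False by (subst (asm) AE_iff_null_sets[symmetric]) (simp_all add: null_sets_def)
  qed
qed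

section \<open>Uniqueness and the main theorem\<close>

text \<open>In modulus, density times weight is a multiple of the Gaussian density of variance 1 /
  (1 + Re \<tau>), positive by hypothesis.\<close>

lemma integrable_complex_gauss_moment:
  assumes "Re \<tau> > -1"
  shows "integrable std_normal_distribution (\<lambda>x. of_real x ^ n * exp (- \<tau> * of_real x ^ 2 / 2))"
    and "((\<lambda>x. std_normal_density x *\<^sub>R (of_real x ^ n * exp (- \<tau> * of_real x ^ 2 / 2))) \<longlongrightarrow> 0) at_top"
    and "((\<lambda>x. std_normal_density x *\<^sub>R (of_real x ^ n * exp (- \<tau> * of_real x ^ 2 / 2))) \<longlongrightarrow> 0) at_bot"
proof -
  define a where "a = 1 + Re \<tau>"
  have a: "a > 0" using assms by (simp add: a_def)
  let ?G = "\<lambda>x. of_real x ^ n * exp (- \<tau> * of_real x ^ 2 / 2) :: complex"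
  have norm: "norm (std_normal_density x *\<^sub>R ?G x) = \<bar>x\<bar> ^ n * (exp (- a * x\<^sup>2 / 2) / sqrt (2 * pi))" for x
  proof -
    have "Re (- \<tau> * of_real x ^ 2 / 2) = - Re \<tau> * x\<^sup>2 / 2" by (simp flip: of_real_power)
    moreover have "exp (- x\<^sup>2 / 2) * exp (- Re \<tau> * x\<^sup>2 / 2) = exp (- a * x\<^sup>2 / 2)"
      unfolding a_def by (simp add: field_simps flip: exp_add)
    ultimately show ?thesis
      unfolding std_normal_density_def by (simp add: norm_mult norm_power field_simps)
  qed
  define \<sigma> where "\<sigma> = 1 / sqrt a"
  have \<sigma>: "\<sigma> > 0" "\<sigma>\<^sup>2 = 1 / a" using a by (simp_all add: \<sigma>_def power_divide)
  have dens: "normal_density 0 \<sigma> x = exp (- a * x\<^sup>2 / 2) / sqrt (2 * pi) * sqrt a" for x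
    unfolding normal_density_def \<sigma>(2) using a by (simp add: real_sqrt_divide field_simps)
  have "integrable lborel (\<lambda>x. normal_density 0 \<sigma> x * \<bar>x - 0\<bar> ^ n)"
    using \<sigma>(1) by (rule integrable_normal_moment_abs)
  then have "integrable lborel (\<lambda>x. (normal_density 0 \<sigma> x * \<bar>x\<bar> ^ n) / sqrt a)" by simp
  also have "(\<lambda>x. (normal_density 0 \<sigma> x * \<bar>x\<bar> ^ n) / sqrt a) = (\<lambda>x. norm (std_normal_density x *\<^sub>R ?G x))"
    unfolding norm dens using a by (auto simp: fun_eq_iff)
  finally have int: "integrable lborel (\<lambda>x. norm (std_normal_density x *\<^sub>R ?G x))" .
  have m: "?G \<in> borel_measurable borel"
    by (intro borel_measurable_continuous_onI continuous_intros) auto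
  then have "(\<lambda>x. std_normal_density x *\<^sub>R ?G x) \<in> borel_measurable lborel"
    by (intro borel_measurable_scaleR) auto
  from integrable_norm_cancel[OF int this] show "integrable std_normal_distribution ?G"
    using std_normal_distribution_integrable_iff[OF m] by blast
  have l: "((\<lambda>x. \<bar>x\<bar> ^ n * (exp (- a * x\<^sup>2 / 2) / sqrt (2 * pi))) \<longlongrightarrow> 0) at_top"
    "((\<lambda>x. \<bar>x\<bar> ^ n * (exp (- a * x\<^sup>2 / 2) / sqrt (2 * pi))) \<longlongrightarrow> 0) at_bot"
    using a by real_asymp+
  show "((\<lambda>x. std_normal_density x *\<^sub>R ?G x) \<longlongrightarrow> 0) at_top"
    by (rule tendsto_norm_zero_cancel) (use l(1) in \<open>simp only: norm\<close>)
  show "((\<lambda>x. std_normal_density x *\<^sub>R ?G x) \<longlongrightarrow> 0) at_bot"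
    by (rule tendsto_norm_zero_cancel) (use l(2) in \<open>simp only: norm\<close>)
qed

text \<open>Integration by parts shows that the variance of the complex Gaussian weight
  \<open>e\<^bsup>-\<tau>x\<^sup>2/2\<^esup> d\<gamma>\<close> is \<open>1 / (1 + \<tau>)\<close>, so it is \<open>1\<close> only for \<open>\<tau> = 0\<close>.\<close>

lemma complex_gauss_variance_one_imp:
  assumes \<tau>: "Re \<tau> > -1" and s: "(\<integral>x. s * exp (- \<tau> * of_real x ^ 2 / 2) \<partial>std_normal_distribution) = 1"
    and v: "(\<integral>x. s * exp (- \<tau> * of_real x ^ 2 / 2) * of_real x ^ 2 \<partial>std_normal_distribution) = 1"
  shows "\<tau> = 0"
proof -
  let ?e = "\<lambda>x::real. exp (- \<tau> * of_real x ^ 2 / 2)"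
  let ?G = "\<lambda>x::real. s * (of_real x ^ 1 * ?e x)" and ?G' = "\<lambda>x::real. s * (of_real x ^ 0 * ?e x) - \<tau> * (s * (of_real x ^ 2 * ?e x))"
  note i = integrable_complex_gauss_moment[OF \<tau>]
  have e: "(?e has_vector_derivative - \<tau> * of_real x * ?e x) (at x)" for x
  proof -
    have "((\<lambda>z. exp (- \<tau> * z ^ 2 / 2)) has_field_derivative - \<tau> * of_real x * ?e x) (at (of_real x))"
      by (auto intro!: derivative_eq_intros)
    from field_vector_diff_chain_at[OF has_vector_derivative_of_real[OF DERIV_ident] this]
    show ?thesis by (simp add: o_def)
  qed
  have d: "(?G has_vector_derivative ?G' x) (at x)" for x
    by (rule has_vector_derivative_eq_rhs[OF has_vector_derivative_mult_right[OF has_vector_derivative_mult[OF _ e]]])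
      (auto intro!: derivative_eq_intros simp: algebra_simps power2_eq_square)
  have "(\<integral>x. x *\<^sub>R ?G x \<partial>std_normal_distribution) = (\<integral>x. ?G' x \<partial>std_normal_distribution)"
  proof (rule gaussian_integration_by_parts_general[OF d])
    show "isCont ?G' x" for x by (intro continuous_intros) auto
    have "integrable std_normal_distribution (\<lambda>x. s * (of_real x ^ 2 * ?e x))"
      using i(1) by (rule Bochner_Integration.integrable_mult_right)
    then show "integrable std_normal_distribution (\<lambda>x. x *\<^sub>R ?G x)"
      by (simp add: scaleR_conv_of_real power2_eq_square mult_ac)
    show "integrable std_normal_distribution ?G'"
      by (intro Bochner_Integration.integrable_diff Bochner_Integration.integrable_mult_right i(1))
    have sw: "std_normal_density x *\<^sub>R ?G x = s * (std_normal_density x *\<^sub>R (of_real x ^ 1 * ?e x))" for x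
      by (simp only: mult_scaleR_right)
    show "((\<lambda>x. std_normal_density x *\<^sub>R ?G x) \<longlongrightarrow> 0) at_top"
      unfolding sw by (rule tendsto_mult_right_zero[OF i(2)])
    show "((\<lambda>x. std_normal_density x *\<^sub>R ?G x) \<longlongrightarrow> 0) at_bot"
      unfolding sw by (rule tendsto_mult_right_zero[OF i(3)])
  qed
  also have "(\<integral>x. x *\<^sub>R ?G x \<partial>std_normal_distribution) = 1"
    using v by (simp add: scaleR_conv_of_real power2_eq_square mult_ac)
  also have "(\<integral>x. ?G' x \<partial>std_normal_distribution) =
    (\<integral>x. s * (of_real x ^ 0 * ?e x) \<partial>std_normal_distribution) - \<tau> * (\<integral>x. s * (of_real x ^ 2 * ?e x) \<partial>std_normal_distribution)"
    by (subst Bochner_Integration.integral_diff)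
      (intro Bochner_Integration.integrable_mult_right i(1) Bochner_Integration.integral_mult_right_zero arg_cong2[where f=minus] refl)+
  also have "\<dots> = 1 - \<tau>" using s v by (simp add: mult_ac)
  finally show ?thesis by simp
qed

text \<open>Operators are compared, not parameters, since the latter are not determined: for c = 0
  every w gives the same operator. Once \<tau> = 0, both sides are polynomials and equal pairings
  identify them.\<close>

lemma centered_gaussian_op_eqI:
  assumes "C \<in> centered_gaussian_ops"
    and eq: "\<And>f g. (\<integral>x. C f x * poly_fun g x \<partial>std_normal_distribution) = (\<integral>x. poly_fun (T_op \<omega> f) x * poly_fun g x \<partial>std_normal_distribution)"
  shows "C = (\<lambda>f. poly_fun (T_op \<omega> f))"
proof -
  obtain c w \<tau> where C: "C = (\<lambda>f. M_op \<tau> (poly_fun (T_op w (S_op c f))))" and \<tau>: "Re \<tau> > -1"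
    using assms(1) unfolding centered_gaussian_ops_def by blast
  have C1: "C 1 x = csqrt (1 + \<tau>) * exp (- \<tau> * of_real x ^ 2 / 2)" for x
    unfolding C M_op_def S_op_def by (simp add: pcompose_1 T_op_1)
  have m: "(\<integral>x. complex_of_real (x ^ n) \<partial>std_normal_distribution) = of_real (\<integral>x. x ^ n \<partial>std_normal_distribution)" for n
    by (rule integral_complex_of_real)
  note sm = standardized_moments[OF standardized_std_normal]
  have "\<tau> = 0"
  proof (rule complex_gauss_variance_one_imp[OF \<tau>])
    show "(\<integral>x. csqrt (1 + \<tau>) * exp (- \<tau> * of_real x ^ 2 / 2) \<partial>std_normal_distribution) = 1"
      using eq[of 1 1] unfolding C1 T_op_1 poly_fun_simps mult_1_right sm(3) .
    have "(\<integral>x. csqrt (1 + \<tau>) * exp (- \<tau> * of_real x ^ 2 / 2) * of_real x ^ 2 \<partial>std_normal_distribution)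
      = (\<integral>x. complex_of_real (x ^ 2) \<partial>std_normal_distribution)"
      using eq[of 1 "monom 1 2"] unfolding C1 T_op_1 poly_fun_simps mult_1_left of_real_power .
    then show "(\<integral>x. csqrt (1 + \<tau>) * exp (- \<tau> * of_real x ^ 2 / 2) * of_real x ^ 2 \<partial>std_normal_distribution) = 1"
      unfolding m sm by simp
  qed
  then have C': "C f = poly_fun (T_op w (S_op c f))" for f
    unfolding C M_op_def by (simp add: fun_eq_iff)
  have "T_op w (S_op c f) = T_op \<omega> f" for f
  proof -
    have "T_op w (S_op c f) - T_op \<omega> f = 0"
    proof (rule gaussian_orthogonal_to_polys)
      fix g
      let ?h = "T_op w (S_op c f)"
      have "(\<integral>x. poly_fun (?h * g + smult (-1) (T_op \<omega> f * g)) x \<partial>std_normal_distribution) = 0"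
        unfolding gauss_integral_poly_simps using eq[of f g] unfolding C' poly_fun_simps(2) by simp
      moreover have "?h * g + smult (-1) (T_op \<omega> f * g) = (?h - T_op \<omega> f) * g" by (simp add: algebra_simps)
      ultimately show "(\<integral>x. poly_fun (?h - T_op \<omega> f) x * poly_fun g x \<partial>std_normal_distribution) = 0"
        by (simp only: poly_fun_simps(2))
    qed
    then show ?thesis by simp
  qed
  then show ?thesis using C' by (simp add: fun_eq_iff)
qed

lemma T_op_in_centered_gaussian_ops: "(\<lambda>f. poly_fun (T_op \<omega> f)) \<in> centered_gaussian_ops"
proof -
  have "(\<lambda>f. poly_fun (T_op \<omega> f)) = (\<lambda>f. M_op 0 (poly_fun (T_op \<omega> (S_op 1 f))))"
    unfolding M_op_def S_op_def by (simp add: fun_eq_iff pcompose_idR)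
  then show ?thesis unfolding centered_gaussian_ops_def by force
qed

section \<open>The operator on polynomials of degree at most two\<close>

lemma poly_fun_affine: "poly_fun [:1, a:] = (\<lambda>x. 1 + a * of_real x)"
  by (simp add: poly_fun_def fun_eq_iff mult.commute)

context
  fixes \<alpha> :: "real measure" and P :: "nat \<Rightarrow> complex poly"
  assumes st: "standardized \<alpha>" and P: "monic_orthogonal \<alpha> P"
begin

lemma complex_moments:
  "(\<integral>x. complex_of_real x \<partial>\<alpha>) = 0" "(\<integral>x. complex_of_real x ^ 2 \<partial>\<alpha>) = 1" "(\<integral>x. (c :: complex) \<partial>\<alpha>) = c"
  using standardized_moments[OF st] integral_complex_of_real[of \<alpha> "\<lambda>x. x"] integral_complex_of_real[of \<alpha> "\<lambda>x. x\<^sup>2"]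
  by simp_all

lemma poly_moments:
  "(\<integral>x. poly_fun 1 x \<partial>\<alpha>) = 1" "(\<integral>x. poly_fun (monom 1 1) x \<partial>\<alpha>) = 0" "(\<integral>x. poly_fun (monom 1 2) x \<partial>\<alpha>) = 1"
  unfolding poly_fun_simps mult_1_left power_one_right by (rule complex_moments)+

lemma orthogonal_monic: "monic_sequence P" using P unfolding monic_orthogonal_def by blast

lemma orthogonal_integral_0: "0 < l \<Longrightarrow> (\<integral>x. poly_fun (P l) x \<partial>\<alpha>) = 0"
  using P unfolding monic_orthogonal_def by (metis (no_types, lifting) Bochner_Integration.integral_cong mult_1_right power_0)

lemma orthogonal_0: "P 0 = 1"
proof -
  have "degree (P 0) = 0" "coeff (P 0) 0 = 1"
    using orthogonal_monic unfolding monic_sequence_def by metis+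
  then show ?thesis by (metis degree_0_id one_pCons)
qed

lemma orthogonal_1: "P 1 = [:0, 1:]"
proof -
  have d: "degree (P 1) = 1" "coeff (P 1) 1 = 1"
    using orthogonal_monic unfolding monic_sequence_def by metis+
  define c where "c = coeff (P 1) 0"
  have c: "P 1 = [:c, 1:]"
  proof (rule poly_eqI)
    fix n :: nat
    have "n = 0 \<or> n = 1 \<or> n > 1" by arith
    then show "coeff (P 1) n = coeff [:c, 1:] n"
      by (elim disjE) (use d in \<open>simp_all add: c_def coeff_eq_0\<close>)
  qed
  have "P 1 = smult c 1 + monom 1 1" unfolding c by (simp add: monom_altdef one_pCons)
  then have "0 = c * 1 + 0"
    using orthogonal_integral_0[of 1] by (simp only: integral_poly_fun_add[OF st] integral_poly_fun_smult poly_moments zero_less_one)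
  then have "0 = c" unfolding mult_1_right add_0_right .
  then show ?thesis unfolding c by simp
qed

text \<open>Mean 0 and variance 1 fix the constant coefficient. The coefficient \<open>c\<close>,
  minus the third moment, depends on \<alpha> but may stay unknown, as it multiplies a function of
  mean 0.\<close>

lemma orthogonal_2: obtains c where "P 2 = [:-1, c, 1:]"
proof -
  have d: "degree (P 2) = 2" "coeff (P 2) 2 = 1"
    using orthogonal_monic unfolding monic_sequence_def by metis+
  define b c where "b = coeff (P 2) 0" and "c = coeff (P 2) 1"
  have P2: "P 2 = [:b, c, 1:]"
  proof (rule poly_eqI)
    fix n
    show "coeff (P 2) n = coeff [:b, c, 1:] n"
    proof (cases "n \<le> 2")
      case True
      then have "n = 0 \<or> n = 1 \<or> n = 2" by auto
      then show ?thesis using d by (auto simp: b_def c_def numeral_2_eq_2)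
    next
      case False
      then have "coeff (P 2) n = 0" using d by (intro coeff_eq_0) simp
      moreover have "coeff [:b, c, 1:] n = 0" using False by (intro coeff_eq_0) simp
      ultimately show ?thesis by simp
    qed
  qed
  have "P 2 = smult b 1 + (smult c (monom 1 1) + monom 1 2)"
    unfolding P2 by (simp add: monom_altdef power2_eq_square one_pCons)
  then have "0 = b * 1 + (c * 0 + 1)"
    using orthogonal_integral_0[of 2]
    by (simp only: integral_poly_fun_add[OF st] integral_poly_fun_smult poly_moments zero_less_numeral)
  then have "0 = b + 1" unfolding mult_1_right mult_zero_right add_0_left .
  from this[symmetric] have "b = -1" unfolding eq_neg_iff_add_eq_0 .
  then show ?thesis using that P2 by simp
qed

text \<open>In x^2 = P_2 - c P_1 + P_0 only the last summand has nonzero mean, and it is fixed; so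
  the third value does not depend on \<omega>.\<close>

lemma diag_op_monom:
  "diag_op P \<omega> (monom 1 0) = 1" "diag_op P \<omega> (monom 1 1) = smult \<omega> (monom 1 1)"
  "(\<integral>x. poly_fun (diag_op P \<omega> (monom 1 2)) x \<partial>\<alpha>) = 1"
proof -
  note lin = diag_op_linear[OF orthogonal_monic, of \<omega>, unfolded linear_smult_iff, THEN conjunct1, rule_format]
    diag_op_linear[OF orthogonal_monic, of \<omega>, unfolded linear_smult_iff, THEN conjunct2, rule_format]
  note basis = diag_op_basis[OF orthogonal_monic, of \<omega>]
  show 0: "diag_op P \<omega> (monom 1 0) = 1"
    using basis[of 0] by (simp add: orthogonal_0 monom_0 one_pCons)
  show 1: "diag_op P \<omega> (monom 1 1) = smult \<omega> (monom 1 1)"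
    using basis[of 1] orthogonal_1 by (simp add: monom_altdef)
  obtain c where c: "P 2 = [:-1, c, 1:]" by (rule orthogonal_2)
  have m: "monom 1 2 = P 2 + (smult (-c) (monom 1 1) + smult 1 (monom 1 0))"
    unfolding c by (simp add: monom_altdef power2_eq_square one_pCons)
  have "diag_op P \<omega> (monom 1 2) = smult (\<omega> ^ 2) (P 2) + (smult (-c) (smult \<omega> (monom 1 1)) + smult 1 1)"
    unfolding m lin basis 0 1 ..
  then have "(\<integral>x. poly_fun (diag_op P \<omega> (monom 1 2)) x \<partial>\<alpha>) = \<omega> ^ 2 * 0 + (- c * (\<omega> * 0) + 1 * 1)"
    using orthogonal_integral_0[of 2]
    by (simp only: integral_poly_fun_add[OF st] integral_poly_fun_smult poly_moments zero_less_numeral)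
  then show "(\<integral>x. poly_fun (diag_op P \<omega> (monom 1 2)) x \<partial>\<alpha>) = 1" by simp
qed

text \<open>In degree at most one the operator is the same for every standardized \<alpha>;
  therefore affine test functions give one necessary condition for all of them.\<close>

lemma diag_op_affine: "diag_op P \<omega> [:1, a:] = [:1, \<omega> * a:]"
proof -
  note lin = diag_op_linear[OF orthogonal_monic, of \<omega>, unfolded linear_smult_iff, THEN conjunct1, rule_format]
    diag_op_linear[OF orthogonal_monic, of \<omega>, unfolded linear_smult_iff, THEN conjunct2, rule_format]
  have m: "[:1, a:] = monom 1 0 + smult a (monom 1 1)" by (simp add: monom_altdef one_pCons)
  have "diag_op P \<omega> [:1, a:] = 1 + smult a (smult \<omega> (monom 1 1))"
    unfolding m lin diag_op_monom ..
  then show ?thesis by (simp add: monom_altdef one_pCons mult.commute)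
qed

lemma K_op_clt_limit: "clt_limit \<alpha> (K_op P \<omega>) (\<lambda>f. poly_fun (T_op \<omega> f))"
proof (rule clt_limit_T_op[where \<kappa>="\<lambda>j. diag_op P \<omega> (monom 1 j)", OF st])
  show "(\<integral>x. poly_fun (diag_op P \<omega> (monom 1 1)) x * of_real x \<partial>\<alpha>) = \<omega>"
    using complex_moments(2) unfolding diag_op_monom by (simp add: mult.assoc power2_eq_square)
qed (use diag_op_monom complex_moments in \<open>simp_all add: K_op_def\<close>)

lemma K_op_contractive_imp_condition:
  assumes "1 \<le> p" "p \<le> q" "\<And>f. Lp_norm q \<alpha> (K_op P \<omega> f) \<le> Lp_norm p \<alpha> (poly_fun f)"
  shows "cmod (complex_of_real (p - 2) - \<omega> ^ 2 * complex_of_real (q - 2)) \<le> p - cmod \<omega> ^ 2 * q"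
proof (rule contractive_on_affine_imp_condition[OF st assms(1,2)])
  show "Lp_norm q \<alpha> (\<lambda>x. 1 + \<omega> * a * of_real x) \<le> Lp_norm p \<alpha> (\<lambda>x. 1 + a * of_real x)" for a
    using assms(3)[of "[:1, a:]"] unfolding K_op_def diag_op_affine poly_fun_affine .
qed

text \<open>The constant 1 is fixed, and H_2 = x^2 - 1 has mean 0 under a standardized
  measure.\<close>

lemma K_op_matrix_elems:
  "matrix_elem \<alpha> (K_op P \<omega>) 0 0 = 1" "matrix_elem \<alpha> (K_op P \<omega>) 0 1 = 0"
  "matrix_elem \<alpha> (K_op P \<omega>) 1 0 = 0" "matrix_elem \<alpha> (K_op P \<omega>) 0 2 = 0"
proof -
  have h: "hermite 0 = monom 1 0" "hermite 1 = monom 1 1" "hermite 2 = monom 1 2 + smult (-1) 1"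
    by (simp_all add: monom_altdef numeral_2_eq_2 one_pCons)
  show "matrix_elem \<alpha> (K_op P \<omega>) 0 0 = 1" "matrix_elem \<alpha> (K_op P \<omega>) 0 1 = 0"
    "matrix_elem \<alpha> (K_op P \<omega>) 1 0 = 0"
    unfolding matrix_elem_def K_op_def h diag_op_monom using complex_moments by simp_all
  have "matrix_elem \<alpha> (K_op P \<omega>) 0 2 = (\<integral>x. poly_fun (monom 1 2 + smult (-1) 1) x \<partial>\<alpha>)"
    unfolding matrix_elem_def K_op_def h diag_op_monom by simp
  also have "\<dots> = 0"
    unfolding integral_poly_fun_add[OF st] integral_poly_fun_smult poly_moments by simp
  finally show "matrix_elem \<alpha> (K_op P \<omega>) 0 2 = 0" .
qed

end

lemma hermite_orthogonal: "monic_orthogonal std_normal_distribution hermite"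
proof -
  have "(\<integral>x. poly_fun (hermite l * monom 1 j) x \<partial>std_normal_distribution) = 0" if "j < l" for l j
    using that
  proof (induction j arbitrary: l rule: less_induct)
    case (less j)
    obtain k where l: "l = Suc k" using less.prems by (cases l) auto
    text \<open>The three-term recurrence reads \<open>H\<^sub>l = x H\<^sub>k - H\<^sub>k'\<close>, so the Gaussian integral of
      \<open>H\<^sub>l g\<close> is that of \<open>H\<^sub>k g'\<close>.\<close>
    have H: "hermite l = [:0, 1:] * hermite k + smult (-1) (pderiv (hermite k))"
      unfolding l using pderiv_hermite by (cases k) (simp_all del: of_nat_Suc)
    have e: "hermite l * monom 1 j = [:0, 1:] * (hermite k * monom 1 j) + smult (-1) (pderiv (hermite k) * monom 1 j)"
      unfolding H by (simp only: distrib_right mult.assoc mult_smult_left)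
    have "(\<integral>x. poly_fun (hermite l * monom 1 j) x \<partial>std_normal_distribution)
      = (\<integral>x. poly_fun (pderiv (hermite k * monom 1 j) + smult (-1) (pderiv (hermite k) * monom 1 j)) x \<partial>std_normal_distribution)"
      unfolding e gauss_integral_poly_simps gaussian_integral_x_mult ..
    also have "pderiv (hermite k * monom 1 j) + smult (-1) (pderiv (hermite k) * monom 1 j)
       = smult (of_nat j) (hermite k * monom 1 (j - 1))"
      unfolding pderiv_mult pderiv_monom_1 by (simp add: mult.commute)
    also have "(\<integral>x. poly_fun \<dots> x \<partial>std_normal_distribution) = 0"
    proof (cases j)
      case (Suc i)
      then have "(\<integral>x. poly_fun (hermite k * monom 1 (j - 1)) x \<partial>std_normal_distribution) = 0"
        using less.prems l by (intro less.IH) simp_all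
      then show ?thesis unfolding gauss_integral_poly_simps by (simp only: mult_zero_right)
    qed simp
    finally show ?case .
  qed
  then show ?thesis unfolding monic_orthogonal_def using monic_sequence_hermite by simp
qed

theorem corollary3:
  fixes \<alpha> :: "real measure" and P :: "nat \<Rightarrow> complex poly" and \<omega> :: complex
  assumes "standardized \<alpha>" and "monic_orthogonal \<alpha> P"
  shows "matrix_elem \<alpha> (K_op P \<omega>) 0 0 = 1
    \<and> matrix_elem \<alpha> (K_op P \<omega>) 0 1 = 0
    \<and> matrix_elem \<alpha> (K_op P \<omega>) 1 0 = 0
    \<and> Re (matrix_elem \<alpha> (K_op P \<omega>) 0 2) > - 1
    \<and> (\<lambda>f. poly_fun (T_op \<omega> f)) \<in> centered_gaussian_ops
    \<and> clt_limit \<alpha> (K_op P \<omega>) (\<lambda>f. poly_fun (T_op \<omega> f))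
    \<and> (\<forall>C\<in>centered_gaussian_ops.
         clt_limit \<alpha> (K_op P \<omega>) C \<longrightarrow> C = (\<lambda>f. poly_fun (T_op \<omega> f)))
    \<and> (\<forall>p q :: real. 1 \<le> p \<and> p \<le> q \<longrightarrow>
         ((\<forall>f. Lp_norm q \<alpha> (K_op P \<omega> f) \<le> Lp_norm p \<alpha> (poly_fun f)) \<longrightarrow>
          (\<forall>f. Lp_norm q std_normal_distribution (poly_fun (T_op \<omega> f))
             \<le> Lp_norm p std_normal_distribution (poly_fun f)))
       \<and> ((\<forall>f. Lp_norm q std_normal_distribution (poly_fun (T_op \<omega> f))
             \<le> Lp_norm p std_normal_distribution (poly_fun f)) \<longleftrightarrow>
          cmod (complex_of_real (p - 2) - \<omega> ^ 2 * complex_of_real (q - 2))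
             \<le> p - cmod \<omega> ^ 2 * q))"
proof (intro conjI ballI allI impI)
  note elems = K_op_matrix_elems[OF assms, of \<omega>]
  show "matrix_elem \<alpha> (K_op P \<omega>) 0 0 = 1" "matrix_elem \<alpha> (K_op P \<omega>) 0 1 = 0"
    "matrix_elem \<alpha> (K_op P \<omega>) 1 0 = 0" "Re (matrix_elem \<alpha> (K_op P \<omega>) 0 2) > - 1"
    by (simp_all only: elems zero_complex.sel)
  show "(\<lambda>f. poly_fun (T_op \<omega> f)) \<in> centered_gaussian_ops" by (rule T_op_in_centered_gaussian_ops)
  note clt = K_op_clt_limit[OF assms, of \<omega>]
  show "clt_limit \<alpha> (K_op P \<omega>) (\<lambda>f. poly_fun (T_op \<omega> f))" by (rule clt)
  show "C = (\<lambda>f. poly_fun (T_op \<omega> f))" if "C \<in> centered_gaussian_ops" "clt_limit \<alpha> (K_op P \<omega>) C" for C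
    using that(1)
  proof (rule centered_gaussian_op_eqI)
    show "(\<integral>x. C f x * poly_fun g x \<partial>std_normal_distribution)
        = (\<integral>x. poly_fun (T_op \<omega> f) x * poly_fun g x \<partial>std_normal_distribution)" for f g
      using that(2) clt unfolding clt_limit_def by (blast intro: LIMSEQ_unique)
  qed
next
  fix p q :: real
  assume pq: "1 \<le> p \<and> p \<le> q"
  let ?cond = "cmod (complex_of_real (p - 2) - \<omega> ^ 2 * complex_of_real (q - 2)) \<le> p - cmod \<omega> ^ 2 * q"
  have suff: "Lp_norm q std_normal_distribution (poly_fun (T_op \<omega> f)) \<le> Lp_norm p std_normal_distribution (poly_fun f)"
    if ?cond for f
    using gaussian_hypercontractivity[OF _ _ that] pq by blast
  show "Lp_norm q std_normal_distribution (poly_fun (T_op \<omega> f)) \<le> Lp_norm p std_normal_distribution (poly_fun f)"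
    if "\<forall>f. Lp_norm q \<alpha> (K_op P \<omega> f) \<le> Lp_norm p \<alpha> (poly_fun f)" for f
    using K_op_contractive_imp_condition[OF assms, of p q \<omega>] pq that by (intro suff) blast
  show "(\<forall>f. Lp_norm q std_normal_distribution (poly_fun (T_op \<omega> f))
             \<le> Lp_norm p std_normal_distribution (poly_fun f)) \<longleftrightarrow> ?cond"
  proof
    assume "\<forall>f. Lp_norm q std_normal_distribution (poly_fun (T_op \<omega> f)) \<le> Lp_norm p std_normal_distribution (poly_fun f)"
    then show ?cond
      using K_op_contractive_imp_condition[OF standardized_std_normal hermite_orthogonal, of p q \<omega>] pq
      unfolding K_op_def T_op_def by blast
  qed (use suff in blast)
qed

end
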